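(* Let $n\ge1$, $s\in(0,1)$, and let $\Omega\subset\mathbb{R}^n$ be a bounded open set with Lipschitz boundary. Let $A\subset\Omega$ be an open set and let $\psi\in L^\infty(A)$. Then there exists a constant $\Upsilon=\Upsilon(n,s)>1$, depending only on $n$ and $s$, such that for every $\varphi:\mathbb{R}^n\to\mathbb{R}$ with $$\mathrm{Tail}_s(\varphi,\Omega_{\Upsilon\,\mathrm{diam}(\Omega)}\setminus\Omega;\,\cdot\,)\in L^1(\Omega)$$ there exists a unique function $u\in\mathcal{W}^s_{\varphi,\psi}(\Omega,A)$ that solves the obstacle problem in $\Omega$ with exterior data $\varphi$ and obstacle $\psi$ in $A$. Moreover, $$\|u\|_{W^{s,1}(\Omega)}\le C\Big(\|\mathrm{Tail}_s(\varphi,\Omega_{\Upsilon\,\mathrm{diam}(\Omega)}\setminus\Omega;\,\cdot\,)\|_{L^1(\Omega)}+\|\psi\|_{L^\infty(A)}+1\Big),$$ where $C=C(n,s,\Omega)>0$ depends only on $n$, $s$ and $\Omega$.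
   Context: For $\delta\in\mathbb{R}$, $\Omega_\delta:=\{x\in\mathbb{R}^n:\bar d_\Omega(x)<\delta\}$, where $\bar d_\Omega(x)=d(x,\Omega)-d(x,\mathbb{R}^n\setminus\Omega)$ is the signed distance from $\partial\Omega$, negative inside $\Omega$. For $O\subset\mathbb{R}^n\setminus\Omega$ and $x\in\Omega$, $$\mathrm{Tail}_s(u,O;x)=\int_O\frac{|u(y)|}{|x-y|^{n+s}}\,dy.$$ The norm is $\|u\|_{W^{s,1}(\Omega)}=\|u\|_{L^1(\Omega)}+\int_\Omega\int_\Omega\frac{|u(x)-u(y)|}{|x-y|^{n+s}}\,dx\,dy$. Obstacle problem. Set $g_s(t)=(1+t^2)^{-\frac{n+1+s}{2}}$, $G_s(t)=\int_0^t g_s(\tau)\,d\tau$, $\mathcal{G}_s(t)=\int_0^tG_s(\tau)\,d\tau$, and $Q(\Omega)=\mathbb{R}^{2n}\setminus(\mathbb{R}^n\setminus\Omega)^2$. Functions are measurable and identified when equal a.e. $\mathcal{W}^s(\Omega)$ is the set of $u:\mathbb{R}^n\to\mathbb{R}$ with $\|u\|_{W^{s,1}(\Omega)}<\infty$. For $A\subset\Omega$ open and $\psi\in L^\infty(A)$, $$\mathcal{W}^s_{\varphi,\psi}(\Omega,A):=\{u\in\mathcal{W}^s(\Omega):u=\varphi\text{ on }\mathbb{R}^n\setminus\Omega,\ u\ge\psi\text{ a.e. in }A\}.$$ A function $u$ solves the obstacle problem (in $\Omega$, with exterior data $\varphi$ and obstacle $\psi$ in $A$) if $u\in\mathcal{W}^s_{\varphi,\psi}(\Omega,A)$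 and for every $v\in\mathcal{W}^s_{\varphi,\psi}(\Omega,A)$ $$\iint_{Q(\Omega)}\left\{\mathcal{G}_s\Big(\tfrac{u(x)-u(y)}{|x-y|}\Big)-\mathcal{G}_s\Big(\tfrac{v(x)-v(y)}{|x-y|}\Big)\right\}\frac{dx\,dy}{|x-y|^{n-1+s}}\le0.$$ *)

theory Defs
  imports "HOL-Analysis.Analysis" "HOL-Probability.Essential_Supremum"
begin

text \<open>
  Throughout, \<open>\<real>\<^sup>n\<close> is \<open>real ^ 'n\<close> with \<open>n = CARD('n)\<close>. Functions are Lebesgue measurable
  and identified when they agree almost everywhere, so equality of functions is always equality
  a.e. Integrals of nonnegative functions (norms, tails) take values in \<^typ>\<open>ennreal\<close>.
  The kernels \<open>1 / |x - y|\<^sup>a\<close> take the value 0 on the diagonal, a null set.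
\<close>

text \<open>
  Locally the set is the strict subgraph of a Lipschitz function over the hyperplane orthogonal
  to some unit vector \<open>e\<close>. For \<open>n = 1\<close> the hyperplane is \<open>{0}\<close> and \<open>\<gamma>\<close> is a constant.
\<close>

definition lipschitz_boundary :: "(real ^ 'n) set \<Rightarrow> bool" where
  "lipschitz_boundary \<Omega> \<longleftrightarrow>
     (\<forall>p\<in>frontier \<Omega>. \<exists>r>0. \<exists>e L. \<exists>\<gamma> :: real ^ 'n \<Rightarrow> real.
        norm e = 1 \<and> L-lipschitz_on {y. y \<bullet> e = 0} \<gamma> \<and>
        \<Omega> \<inter> ball p r = {x \<in> ball p r. x \<bullet> e < \<gamma> (x - (x \<bullet> e) *\<^sub>R e)})"

definition signed_dist :: "(real ^ 'n) set \<Rightarrow> real ^ 'n \<Rightarrow> real" where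
  "signed_dist \<Omega> x = infdist x \<Omega> - infdist x (- \<Omega>)"

definition sdist_nbhd :: "(real ^ 'n) set \<Rightarrow> real \<Rightarrow> (real ^ 'n) set" where
  "sdist_nbhd \<Omega> \<delta> = {x. signed_dist \<Omega> x < \<delta>}"

definition L1_norm :: "(real ^ 'n) set \<Rightarrow> (real ^ 'n \<Rightarrow> real) \<Rightarrow> ennreal" where
  "L1_norm \<Omega> u = (\<integral>\<^sup>+x\<in>\<Omega>. ennreal \<bar>u x\<bar> \<partial>lebesgue)"

definition Linf_norm :: "(real ^ 'n) set \<Rightarrow> (real ^ 'n \<Rightarrow> real) \<Rightarrow> ennreal" where
  "Linf_norm A \<psi> = esssup (lebesgue_on A) (\<lambda>x. ennreal \<bar>\<psi> x\<bar>)"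

text \<open>Only the values on \<open>A\<close> matter.\<close>

definition Linf :: "(real ^ 'n) set \<Rightarrow> (real ^ 'n \<Rightarrow> real) set" where
  "Linf A = {\<psi>. \<psi> \<in> borel_measurable (lebesgue_on A) \<and> Linf_norm A \<psi> < \<infinity>}"

definition Tail :: "real \<Rightarrow> (real ^ 'n \<Rightarrow> real) \<Rightarrow> (real ^ 'n) set \<Rightarrow> real ^ 'n \<Rightarrow> ennreal" where
  "Tail s u V x =
     (\<integral>\<^sup>+y\<in>V. ennreal (\<bar>u y\<bar> / norm (x - y) powr (real CARD('n) + s)) \<partial>lebesgue)"

text \<open>
  The \<open>L\<^sup>1(\<Omega>)\<close>-norm of the tail. For Lebesgue measurable \<open>u\<close> and \<open>V\<close> the tail is a
  nonnegative measurable function, so it belongs to \<open>L\<^sup>1(\<Omega>)\<close> iff this value is finite.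
\<close>

definition Tail_L1 :: "real \<Rightarrow> (real ^ 'n \<Rightarrow> real) \<Rightarrow> (real ^ 'n) set \<Rightarrow> (real ^ 'n) set \<Rightarrow> ennreal" where
  "Tail_L1 s u V \<Omega> = (\<integral>\<^sup>+x\<in>\<Omega>. Tail s u V x \<partial>lebesgue)"

definition Ws1_norm :: "real \<Rightarrow> (real ^ 'n) set \<Rightarrow> (real ^ 'n \<Rightarrow> real) \<Rightarrow> ennreal" where
  "Ws1_norm s \<Omega> u = L1_norm \<Omega> u +
     (\<integral>\<^sup>+x\<in>\<Omega>. (\<integral>\<^sup>+y\<in>\<Omega>.
        ennreal (\<bar>u x - u y\<bar> / norm (x - y) powr (real CARD('n) + s)) \<partial>lebesgue) \<partial>lebesgue)"

definition Ws :: "real \<Rightarrow> (real ^ 'n) set \<Rightarrow> (real ^ 'n \<Rightarrow> real) set" where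
  "Ws s \<Omega> = {u. u \<in> borel_measurable lebesgue \<and> Ws1_norm s \<Omega> u < \<infinity>}"

definition Ws_obst :: "real \<Rightarrow> (real ^ 'n) set \<Rightarrow> (real ^ 'n) set
    \<Rightarrow> (real ^ 'n \<Rightarrow> real) \<Rightarrow> (real ^ 'n \<Rightarrow> real) \<Rightarrow> (real ^ 'n \<Rightarrow> real) set" where
  "Ws_obst s \<Omega> A \<phi> \<psi> = {u \<in> Ws s \<Omega>.
     (AE x in lebesgue. x \<notin> \<Omega> \<longrightarrow> u x = \<phi> x) \<and>
     (AE x in lebesgue. x \<in> A \<longrightarrow> u x \<ge> \<psi> x)}"

text \<open>The first argument of the next three functions is the dimension \<open>n\<close>.\<close>

definition gs :: "nat \<Rightarrow> real \<Rightarrow> real \<Rightarrow> real" where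
  "gs n s t = (1 + t\<^sup>2) powr (- (real n + 1 + s) / 2)"

definition Gs :: "nat \<Rightarrow> real \<Rightarrow> real \<Rightarrow> real" where
  "Gs n s t = (LBINT \<tau>=0..t. gs n s \<tau>)"

definition GGs :: "nat \<Rightarrow> real \<Rightarrow> real \<Rightarrow> real" where
  "GGs n s t = (LBINT \<tau>=0..t. Gs n s \<tau>)"

definition Q_set :: "(real ^ 'n) set \<Rightarrow> ((real ^ 'n) \<times> (real ^ 'n)) set" where
  "Q_set \<Omega> = UNIV - (UNIV - \<Omega>) \<times> (UNIV - \<Omega>)"

definition energy_diff :: "real \<Rightarrow> (real ^ 'n \<Rightarrow> real) \<Rightarrow> (real ^ 'n \<Rightarrow> real)
    \<Rightarrow> (real ^ 'n) \<times> (real ^ 'n) \<Rightarrow> real" where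
  "energy_diff s u v = (\<lambda>(x, y).
     (GGs CARD('n) s ((u x - u y) / norm (x - y)) - GGs CARD('n) s ((v x - v y) / norm (x - y)))
     / norm (x - y) powr (real CARD('n) - 1 + s))"

text \<open>
  Integrability is demanded explicitly because the Bochner integral of a non-integrable function
  is 0 by convention, which would make the inequality hold vacuously.
\<close>

definition solves_obstacle :: "real \<Rightarrow> (real ^ 'n) set \<Rightarrow> (real ^ 'n) set
    \<Rightarrow> (real ^ 'n \<Rightarrow> real) \<Rightarrow> (real ^ 'n \<Rightarrow> real) \<Rightarrow> (real ^ 'n \<Rightarrow> real) \<Rightarrow> bool" where
  "solves_obstacle s \<Omega> A \<phi> \<psi> u \<longleftrightarrow>
     u \<in> Ws_obst s \<Omega> A \<phi> \<psi> \<and>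
     (\<forall>v \<in> Ws_obst s \<Omega> A \<phi> \<psi>.
        set_integrable (lebesgue \<Otimes>\<^sub>M lebesgue) (Q_set \<Omega>) (energy_diff s u v) \<and>
        (LINT p:Q_set \<Omega>|lebesgue \<Otimes>\<^sub>M lebesgue. energy_diff s u v p) \<le> 0)"

end

theory Submission
  imports Defs
begin

text \<open>
  The energy density \<open>\<G>(t)\<close>, the function \<open>GGs\<close>, is even, strictly convex, and grows linearly:
  it is Lipschitz with constant 2 and lies above \<open>a (|t| - 1)\<close>, where \<open>a > 0\<close> is its slope at 1. The
  nonlocal energy of a function may be infinite because nothing is assumed about the exterior datum
  far away from \<open>\<Omega>\<close>; only differences of energies make sense. Apart from pairs inside \<open>\<Omega>\<close>,
  which the seminorms control, such a difference is dominated by \<open>|u(x) - v(x)|\<close> integrated against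
  \<open>|x - y|\<^bsup>-n-s\<^esup>\<close> over \<open>x \<in> \<Omega>\<close>, \<open>y \<notin> \<Omega>\<close>, so everything rests on a fractional
  Hardy inequality (\<open>fractional_hardy\<close>): on a bounded Lipschitz domain and for \<open>s < 1\<close> this
  integral is at most a constant times the \<open>W\<^bsup>s,1\<^esup>\<close>-norm. It is proved by comparing
  the mass of a boundary layer of thickness \<open>h\<close> with \<open>N\<close> disjoint translates of it deeper inside;
  the translates gain a factor \<open>1 / N\<close>, against a loss of order \<open>N\<^bsup>s\<^esup>\<close> from the weights, and the
  resulting recursion over geometric scales sums up.

  All energies are measured against the competitor \<open>base\<close> that is the constant \<open>c\<close>, the supremum norm
  of the obstacle, in \<open>\<Omega>\<close>.
  The functional \<open>J\<close> is coercive for the following reason. Near \<open>\<Omega>\<close> the lower linear growth of the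
  density produces a positive multiple of \<open>|v(x)|\<close>, at the cost of the tail of the exterior datum.
  Far away the Lipschitz bound costs a multiple of \<open>|v(x)|\<close>, which decays like \<open>R\<^bsup>-s\<^esup>\<close> with the radius
  \<open>R\<close> and is therefore beaten if the near region extends to \<open>\<Upsilon>\<close> diameters, with \<open>\<Upsilon>\<close> depending
  only on \<open>n\<close> and \<open>s\<close>. To obtain coercivity and lower semicontinuity at once, a kernel
  whose integral in \<open>y\<close> vanishes for each \<open>x\<close> moves mass from the near region to the far region
  without changing \<open>J\<close>; afterwards the integrand is bounded below by an integrable function that does
  not depend on \<open>v\<close> (\<open>corrected_lower\<close>), and Fatou's lemma applies (\<open>adm_limit\<close>).

  Compactness of the embedding into \<open>L\<^sup>1\<close> is avoided. Since the density is convex, \<open>J\<close> is submodular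
  (\<open>max_min_adm\<close>), so maxima of a fast minimizing sequence are still nearly minimizing. Running
  maxima increase, their limits decrease, and monotone sequences with bounded energy converge almost
  everywhere (\<open>minimizer_exists\<close>). Uniqueness follows from strict convexity together with the fact
  that admissible functions agree outside \<open>\<Omega>\<close>, and the norm estimate from coercivity and
  \<open>J u \<le> J base = 0\<close>.
\<close>

section \<open>The energy density\<close>

lemma gs_pos: "0 < gs n s t"
proof -
  have "1 + t\<^sup>2 > 0" by (smt (verit) zero_le_power2)
  then show ?thesis unfolding gs_def by simp
qed

lemma continuous_on_gs: "continuous_on S (gs n s)"
proof -
  have "1 + t\<^sup>2 \<noteq> 0" for t :: real by (smt (verit) zero_le_power2)
  then show ?thesis unfolding gs_def by (intro continuous_intros) auto
qed

lemma gs_le_inverse: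
  assumes "1 \<le> n" "0 < s" shows "gs n s t \<le> inverse (1 + t\<^sup>2)"
proof -
  have 1: "1 \<le> 1 + t\<^sup>2" by simp
  have "gs n s t \<le> (1 + t\<^sup>2) powr (-1)"
    unfolding gs_def using assms by (intro powr_mono 1) auto
  also have "\<dots> = inverse (1 + t\<^sup>2)" using 1 by (simp add: powr_minus)
  finally show ?thesis .
qed

text \<open>
  The fundamental theorem of calculus for the oriented integral, at points on both sides of 0.
\<close>

lemma LBINT_has_real_derivative:
  fixes f :: "real \<Rightarrow> real"
  assumes "\<And>S. continuous_on S f"
  shows "((\<lambda>t. LBINT \<tau>=0..ereal t. f \<tau>) has_real_derivative f t) (at t)"
proof -
  define a where "a = - \<bar>t\<bar> - 1"
  define b where "b = \<bar>t\<bar> + 1"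
  have "((\<lambda>u. LBINT y=ereal 0..ereal u. f y) has_vector_derivative f t) (at t within {a..b})"
    by (rule interval_integral_FTC2) (auto simp: a_def b_def assms)
  moreover have "at t within {a..b} = at t"
    by (rule at_within_interior) (auto simp: a_def b_def)
  ultimately show ?thesis
    by (simp add: has_real_derivative_iff_has_vector_derivative zero_ereal_def)
qed

lemma Gs_has_real_derivative: "(Gs n s has_real_derivative gs n s t) (at t)"
  using LBINT_has_real_derivative[OF continuous_on_gs] unfolding Gs_def[abs_def] by blast

lemma GGs_has_real_derivative: "(GGs n s has_real_derivative Gs n s t) (at t)"
proof -
  have "continuous_on S (Gs n s)" for S
    using DERIV_continuous_on[OF DERIV_subset[OF Gs_has_real_derivative]] by blast
  from LBINT_has_real_derivative[OF this] show ?thesis unfolding GGs_def[abs_def] by blast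
qed

lemma Gs_0 [simp]: "Gs n s 0 = 0"
  unfolding Gs_def by (simp flip: zero_ereal_def)

lemma GGs_0 [simp]: "GGs n s 0 = 0"
  unfolding GGs_def by (simp flip: zero_ereal_def)

lemma Gs_strict_mono: assumes "a < b" shows "Gs n s a < Gs n s b"
  by (rule DERIV_pos_imp_increasing[OF assms]) (use Gs_has_real_derivative gs_pos in blast)

lemma Gs_minus: "Gs n s (- t) = - Gs n s t"
proof -
  have "((\<lambda>t. Gs n s (- t) + Gs n s t) has_real_derivative 0) (at t)" for t
    by (rule derivative_eq_intros DERIV_chain2[of "Gs n s" _ "\<lambda>t. -t"] Gs_has_real_derivative refl)+
       (simp add: gs_def)
  then have "Gs n s (- t) + Gs n s t = Gs n s (- 0) + Gs n s 0"
    by (rule DERIV_isconst_all[rule_format]) 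
  then show ?thesis by simp
qed

lemma GGs_minus: "GGs n s (- t) = GGs n s t"
proof -
  have "((\<lambda>t. GGs n s (- t) - GGs n s t) has_real_derivative 0) (at t)" for t
    by (rule derivative_eq_intros DERIV_chain2[of "GGs n s" _ "\<lambda>t. -t"] GGs_has_real_derivative refl)+
       (simp add: Gs_minus)
  then have "GGs n s (- t) - GGs n s t = GGs n s (- 0) - GGs n s 0"
    by (rule DERIV_isconst_all[rule_format]) 
  then show ?thesis by simp
qed

text \<open>
  Comparison with \<open>arctan\<close>, which stays below \<open>\<pi> / 2 < 2\<close>.
\<close>

lemma abs_Gs_le:
  assumes "1 \<le> n" "0 < s" shows "\<bar>Gs n s t\<bar> \<le> 2"
proof -
  have pos: "Gs n s t \<le> 2" if "0 \<le> t" for t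
  proof -
    have "arctan 0 - Gs n s 0 \<le> arctan t - Gs n s t"
    proof (rule DERIV_nonneg_imp_nondecreasing[OF that], intro exI conjI)
      fix x
      show "((\<lambda>t. arctan t - Gs n s t) has_real_derivative inverse (1 + x\<^sup>2) - gs n s x) (at x)"
        by (intro DERIV_diff DERIV_arctan Gs_has_real_derivative)
      show "0 \<le> inverse (1 + x\<^sup>2) - gs n s x" using gs_le_inverse[OF assms, of x] by simp
    qed
    moreover have "arctan t < 2" using arctan_ubound[of t] pi_less_4 by linarith
    ultimately show ?thesis by simp
  qed
  show ?thesis
    using pos[of t] pos[of "-t"] Gs_strict_mono[of 0 t n s] Gs_strict_mono[of t 0 n s] Gs_minus[of n s t]
    by (cases t "0::real" rule: linorder_cases) auto
qed

text \<open>
  This bound makes differences of energies integrable, even if neither energy is finite.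
\<close>

lemma GGs_lipschitz:
  assumes "1 \<le> n" "0 < s" shows "\<bar>GGs n s a - GGs n s b\<bar> \<le> 2 * \<bar>a - b\<bar>"
proof -
  have "norm (GGs n s a - GGs n s b) \<le> 2 * norm (a - b)"
  proof (rule field_differentiable_bound[of UNIV "GGs n s" "Gs n s"])
    show "(GGs n s has_field_derivative Gs n s z) (at z within UNIV)" for z
      using GGs_has_real_derivative by simp
    show "norm (Gs n s z) \<le> 2" for z using abs_Gs_le[OF assms] by simp
  qed auto
  then show ?thesis by simp
qed

lemma GGs_convex: "convex_on UNIV (GGs n s)"
proof (rule f''_ge0_imp_convex[of UNIV "GGs n s" "Gs n s" "gs n s"])
  show "0 \<le> gs n s x" for x using gs_pos[of n s x] by simp
qed (auto simp: GGs_has_real_derivative Gs_has_real_derivative)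

lemma GGs_above_tangent:
  "GGs n s b \<ge> GGs n s a + Gs n s a * (b - a)"
    and GGs_above_tangent_strict: "a \<noteq> b \<Longrightarrow> GGs n s b > GGs n s a + Gs n s a * (b - a)"
proof -
  show *: "GGs n s b > GGs n s a + Gs n s a * (b - a)" if "a \<noteq> b" for a b
  proof (cases "a < b")
    case True
    from MVT2[OF this, of "GGs n s" "Gs n s"] obtain z
      where "a < z" "z < b" and e: "GGs n s b - GGs n s a = (b - a) * Gs n s z"
      using GGs_has_real_derivative by auto
    have "(b - a) * Gs n s a < (b - a) * Gs n s z"
      using Gs_strict_mono[OF \<open>a < z\<close>] True by (intro mult_strict_left_mono) auto
    with e show ?thesis by (simp add: mult.commute)
  next
    case False
    with that have "b < a" by simp
    from MVT2[OF this, of "GGs n s" "Gs n s"] obtain z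
      where "b < z" "z < a" and e: "GGs n s a - GGs n s b = (a - b) * Gs n s z"
      using GGs_has_real_derivative by auto
    have "(a - b) * Gs n s z < (a - b) * Gs n s a"
      using Gs_strict_mono[OF \<open>z < a\<close>] \<open>b < a\<close> by (intro mult_strict_left_mono) auto
    with e show ?thesis by (simp add: algebra_simps)
  qed
  show "GGs n s b \<ge> GGs n s a + Gs n s a * (b - a)" using *[of a b] by (cases "a = b") auto
qed

lemma GGs_nonneg: "0 \<le> GGs n s t"
  using GGs_above_tangent[where a=0 and b=t and n=n and s=s] by simp

text \<open>
  The tangent at 1 has positive slope. Together with the Lipschitz bound this traps the density
  between two linear functions of \<open>|t|\<close> with different slopes.
\<close>

lemma GGs_lower: "GGs n s t \<ge> Gs n s 1 * (\<bar>t\<bar> - 1)"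
proof -
  have "GGs n s t = GGs n s \<bar>t\<bar>" using GGs_minus[of n s t] by (cases "t \<ge> 0") auto
  then show ?thesis
    using GGs_above_tangent[where a=1 and b="\<bar>t\<bar>" and n=n and s=s] GGs_nonneg[of n s 1] by simp
qed

text \<open>
  The tangent at the midpoint lies below the graph, strictly so away from the midpoint.
\<close>

lemma GGs_midpoint_le: "GGs n s ((a + b) / 2) \<le> (GGs n s a + GGs n s b) / 2"
    and GGs_midpoint_less: "a \<noteq> b \<Longrightarrow> GGs n s ((a + b) / 2) < (GGs n s a + GGs n s b) / 2"
proof -
  show *: "GGs n s ((a + b) / 2) < (GGs n s a + GGs n s b) / 2" if "a \<noteq> b" for a b
  proof -
    define m where "m = (a + b) / 2"
    have "m \<noteq> a" "m \<noteq> b" using that by (auto simp: m_def field_simps)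
    from this[THEN GGs_above_tangent_strict, of n s]
    have "GGs n s a + GGs n s b > 2 * GGs n s m + Gs n s m * ((a - m) + (b - m))"
      by (simp add: algebra_simps)
    moreover have "(a - m) + (b - m) = 0" by (simp add: m_def field_simps)
    ultimately show ?thesis by (simp add: m_def)
  qed
  show "GGs n s ((a + b) / 2) \<le> (GGs n s a + GGs n s b) / 2"
    using *[of a b] by (cases "a = b") auto
qed

text \<open>
  Submodularity of convex functions of differences. If \<open>a, b\<close> and \<open>c, d\<close> are ordered alike, both sides
  agree. Otherwise the two arguments on the left lie between the two on the right and have the same sum.
\<close>

lemma convex_max_min_diff:
  fixes f :: "real \<Rightarrow> real"
  assumes f: "convex_on UNIV f" and r: "0 \<le> r"
  shows "f ((max a b - max c d) / r) + f ((min a b - min c d) / r) \<le> f ((a - c) / r) + f ((b - d) / r)"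
proof -
  have key: "f y + f (p + q - y) \<le> f p + f q" if "p \<le> y" "y \<le> q" for p q y
  proof (cases "p = q")
    case True then show ?thesis using that by simp
  next
    case False
    define t where "t = (y - p) / (q - p)"
    have t: "0 \<le> t" "t \<le> 1" using that False by (auto simp: t_def field_simps)
    have "t * (q - p) = y - p" using False by (simp add: t_def)
    then have y: "y = (1 - t) * p + t * q" by (simp add: algebra_simps)
    have 1: "f y \<le> (1 - t) * f p + t * f q"
      using convex_onD[OF f, of t p q] t by (simp add: y)
    have "p + q - y = t * p + (1 - t) * q" by (simp add: y algebra_simps)
    then have "f (p + q - y) \<le> t * f p + (1 - t) * f q"
      using convex_onD[OF f, of "1 - t" p q] t by simp
    with 1 show ?thesis by (simp add: algebra_simps)
  qed
  have mixed: "f ((a - d) / r) + f ((b - c) / r) \<le> f ((a - c) / r) + f ((b - d) / r)"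
    if "b \<le> a \<and> c \<le> d \<or> a \<le> b \<and> d \<le> c" for a b c d
  proof -
    have "(a - c) / r + (b - d) / r - (a - d) / r = (b - c) / r"
      by (simp add: diff_divide_distrib)
    moreover have "(b - d) / r + (a - c) / r - (a - d) / r = (b - c) / r"
      by (simp add: diff_divide_distrib)
    moreover have "(a - c) / r \<le> (a - d) / r \<and> (a - d) / r \<le> (b - d) / r
        \<or> (b - d) / r \<le> (a - d) / r \<and> (a - d) / r \<le> (a - c) / r"
      using that r by (auto intro!: divide_right_mono)
    ultimately show ?thesis
      using key[of "(a - c) / r" "(a - d) / r" "(b - d) / r"]
        key[of "(b - d) / r" "(a - d) / r" "(a - c) / r"] by (metis add.commute)
  qed
  consider "b \<le> a" "d \<le> c" | "b \<le> a" "c \<le> d" | "a \<le> b" "d \<le> c" | "a \<le> b" "c \<le> d" by linarith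
  then show ?thesis
    using mixed[of b a c d] mixed[of a b c d] by cases (auto simp: max_def min_def)
qed

section \<open>Radial integrals\<close>

lemma sigma_finite_lebesgue: "sigma_finite_measure (lebesgue :: 'a::euclidean_space measure)"
proof
  have "(\<Union>n. ball (0::'a) (real n)) = UNIV"
    by (auto simp: reals_Archimedean2)
  then show "\<exists>A::'a set set. countable A \<and> A \<subseteq> sets lebesgue \<and> \<Union> A = space lebesgue \<and> (\<forall>a\<in>A. emeasure lebesgue a \<noteq> \<infinity>)"
    by (intro exI[of _ "range (\<lambda>n. ball (0::'a) (real n))"]) (use emeasure_lborel_ball_finite[where ?'a='a] in \<open>auto simp: less_top\<close>)
qed

interpretation lebesgue_pair: pair_sigma_finite
  "lebesgue :: 'a::euclidean_space measure" "lebesgue :: 'b::euclidean_space measure"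
  by (intro pair_sigma_finite.intro sigma_finite_lebesgue)

text \<open>
  Functions of the form \<open>\<lambda>y. norm (x - y)\<close> are Borel; this lets them be used under Lebesgue measure.
\<close>

lemma borel_measurable_lebesgueI [measurable (raw)]:
  "f \<in> borel_measurable borel \<Longrightarrow> f \<in> borel_measurable lebesgue"
  by (simp add: measurable_completion)

lemma nn_integral_lborel_affine:
  fixes f :: "'a::euclidean_space \<Rightarrow> ennreal"
  assumes [measurable]: "f \<in> borel_measurable borel" and c: "c > 0"
  shows "(\<integral>\<^sup>+x. f x \<partial>lborel) = ennreal (c ^ DIM('a)) * (\<integral>\<^sup>+x. f (a + c *\<^sub>R x) \<partial>lborel)"
proof -
  have "(\<integral>\<^sup>+x. f x \<partial>lborel) = (\<integral>\<^sup>+x. f x \<partial>density (distr lborel borel (\<lambda>x. a + c *\<^sub>R x)) (\<lambda>_. ennreal (\<bar>c\<bar> ^ DIM('a))))"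
    using c by (subst lborel_affine[of c a]) auto
  also have "\<dots> = ennreal (c ^ DIM('a)) * (\<integral>\<^sup>+x. f (a + c *\<^sub>R x) \<partial>lborel)"
    using c by (simp add: nn_integral_density nn_integral_distr nn_integral_cmult)
  finally show ?thesis .
qed

lemma nn_integral_lborel_translate:
  fixes f :: "'a::euclidean_space \<Rightarrow> ennreal"
  assumes "f \<in> borel_measurable borel"
  shows "(\<integral>\<^sup>+x. f (x + a) \<partial>lborel) = (\<integral>\<^sup>+x. f x \<partial>lborel)"
  using nn_integral_lborel_affine[OF assms, of 1 a] by (simp add: add.commute)

text \<open>
  Integrals of \<open>|z|\<^bsup>-p\<^esup>\<close> over the points with \<open>|z| \<in> R\<close>. Instead of polar coordinates, only
  the scaling law and finiteness on annuli are used. The first argument carries the dimension.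
\<close>

definition shell_integral :: "'a::euclidean_space itself \<Rightarrow> real \<Rightarrow> real set \<Rightarrow> ennreal" where
  "shell_integral _ p R =
     (\<integral>\<^sup>+(z::'a). ennreal (norm z powr - p) * indicator R (norm z) \<partial>lborel)"

lemma shell_integral_measurable [measurable]:
  assumes [measurable]: "R \<in> sets borel"
  shows "(\<lambda>z::'a::euclidean_space. ennreal (norm z powr - p) * indicator R (norm z)) \<in> borel_measurable borel"
  by measurable

lemma shell_integral_centre:
  fixes x :: "'a::euclidean_space"
  assumes [measurable]: "R \<in> sets borel"
  shows "(\<integral>\<^sup>+y. ennreal (norm (x - y) powr - p) * indicator R (norm (x - y)) \<partial>lborel)
    = shell_integral TYPE('a) p R"
  using nn_integral_lborel_translate[OF shell_integral_measurable[OF assms, of p], of "-x"]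
  unfolding shell_integral_def by (simp add: norm_minus_commute)

lemma shell_integral_scale:
  assumes [measurable]: "R \<in> sets borel" "R' \<in> sets borel" and c: "c > 0"
    and R': "\<And>r. c * r \<in> R' \<longleftrightarrow> r \<in> R"
  shows "shell_integral TYPE('a::euclidean_space) p R'
    = ennreal (c powr (real DIM('a) - p)) * shell_integral TYPE('a) p R"
proof -
  have "shell_integral TYPE('a) p R' = ennreal (c ^ DIM('a)) *
     (\<integral>\<^sup>+(z::'a). ennreal (norm (c *\<^sub>R z) powr - p) * indicator R' (norm (c *\<^sub>R z)) \<partial>lborel)"
    unfolding shell_integral_def
    by (subst nn_integral_lborel_affine[OF shell_integral_measurable c, of R' p 0]) (auto simp: assms)
  also have "(\<integral>\<^sup>+(z::'a). ennreal (norm (c *\<^sub>R z) powr - p) * indicator R' (norm (c *\<^sub>R z)) \<partial>lborel)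
     = (\<integral>\<^sup>+(z::'a). ennreal (c powr - p) * (ennreal (norm z powr - p) * indicator R (norm z)) \<partial>lborel)"
    using c R' by (intro nn_integral_cong)
      (auto simp: powr_mult ennreal_mult indicator_def mult.assoc)
  also have "\<dots> = ennreal (c powr - p) * shell_integral TYPE('a) p R"
    unfolding shell_integral_def by (rule nn_integral_cmult) measurable
  finally show ?thesis
    using c by (simp add: powr_diff powr_realpow powr_minus_divide ennreal_mult[symmetric] mult.assoc[symmetric])
qed

lemma shell_integral_annulus_finite:
  assumes "0 < a"
  shows "shell_integral TYPE('a::euclidean_space) p {a..<b} < \<infinity>"
proof -
  have "shell_integral TYPE('a) p {a..<b} \<le> (\<integral>\<^sup>+(z::'a). ennreal (a powr - p + b powr - p) * indicator (ball 0 b) z \<partial>lborel)"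
    unfolding shell_integral_def
  proof (intro nn_integral_mono)
    fix z :: 'a
    show "ennreal (norm z powr - p) * indicator {a..<b} (norm z) \<le> ennreal (a powr - p + b powr - p) * indicator (ball 0 b) z"
    proof (cases "norm z \<in> {a..<b}")
      case True
      have "norm z powr - p \<le> a powr - p + b powr - p"
      proof (cases "p \<ge> 0")
        case p: True
        have "norm z powr - p \<le> a powr - p" using True assms p by (intro powr_mono2') auto
        then show ?thesis by (simp add: add_increasing2)
      next
        case False
        have "norm z powr - p \<le> b powr - p" using True assms False by (intro powr_mono2) auto
        then show ?thesis by (simp add: add_increasing)
      qed
      with True show ?thesis by (auto intro!: ennreal_leI simp del: ennreal_plus)
    qed (auto simp: indicator_def)
  qed
  also have "\<dots> = ennreal (a powr - p + b powr - p) * emeasure lborel (ball (0::'a) b)"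
    by (rule nn_integral_cmult_indicator) auto
  also have "\<dots> < \<infinity>"
    using emeasure_lborel_ball_finite[of "0::'a" b] by (simp add: ennreal_mult_less_top)
  finally show ?thesis .
qed

lemma shell_integral_annulus_pos:
  assumes "0 < a" "a < b"
  shows "0 < shell_integral TYPE('a::euclidean_space) p {a..<b}"
proof (rule ccontr)
  assume "\<not> ?thesis"
  then have "shell_integral TYPE('a) p {a..<b} = 0" by simp
  then have "AE (z::'a) in lborel. ennreal (norm z powr - p) * indicator {a..<b} (norm z) = 0"
    unfolding shell_integral_def by (subst (asm) nn_integral_0_iff_AE) auto
  then have "AE (z::'a) in lborel. z \<notin> ball 0 b - cball 0 a"
    proof eventually_elim
    case (elim z)
    show ?case
    proof
      assume "z \<in> ball 0 b - cball 0 a"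
      then have "norm z \<in> {a..<b}" "norm z \<noteq> 0" using assms by auto
      with elim show False by auto
    qed
  qed
  then have "emeasure lborel (ball 0 b - cball (0::'a) a) = 0"
    by (subst (asm) AE_iff_measurable[OF _ refl]) (auto simp: set_diff_eq)
  moreover obtain e :: 'a where "e \<in> Basis" using nonempty_Basis by blast
  then have "((a + b) / 2) *\<^sub>R e \<in> ball 0 b - cball (0::'a) a"
    using assms by auto
  then have "ball 0 b - cball (0::'a) a \<noteq> {}" by blast
  moreover have "open (ball 0 b - cball (0::'a) a)" by (intro open_Diff) auto
  ultimately show False
    using open_not_negligible[of "ball 0 b - cball (0::'a) a"]
    by (metis null_setsI null_sets_completionI negligible_iff_null_sets open_Diff open_ball closed_cball
        borel_open sets_lborel)
qed

lemma shell_integral_infinite_union: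
  assumes "\<And>j. R j \<in> sets borel" "disjoint_family R"
  shows "shell_integral TYPE('a::euclidean_space) p (\<Union>j. R j) = (\<Sum>j. shell_integral TYPE('a) p (R j))"
proof -
  have "shell_integral TYPE('a) p (\<Union>j. R j)
     = (\<integral>\<^sup>+(z::'a). (\<Sum>j. ennreal (norm z powr - p) * indicator (R j) (norm z)) \<partial>lborel)"
    unfolding shell_integral_def
    by (intro nn_integral_cong) (simp add: ennreal_suminf_cmult suminf_indicator[OF assms(2)])
  also have "\<dots> = (\<Sum>j. shell_integral TYPE('a) p (R j))"
    unfolding shell_integral_def using assms(1) by (intro nn_integral_suminf) auto
  finally show ?thesis .
qed

lemma suminf_geometric_ennreal_finite:
  assumes "0 \<le> q" "q < 1" "K < \<infinity>"
  shows "(\<Sum>j. ennreal (q ^ j) * K) < \<infinity>"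
proof -
  have "(\<Sum>j. ennreal (q ^ j)) = ennreal (1 / (1 - q))"
    using assms by (intro suminf_ennreal_eq geometric_sums) auto
  then show ?thesis using assms by (simp add: ennreal_mult_less_top)
qed

lemma exists_geometric_interval:
  fixes t :: real
  assumes "1 < M" "1 \<le> t"
  shows "\<exists>j. M ^ j \<le> t \<and> t < M ^ Suc j"
proof -
  obtain k where "t < M ^ k" using real_arch_pow[OF assms(1)] by blast
  then have L: "t < M ^ (LEAST k. t < M ^ k)" by (rule LeastI)
  obtain j where j: "(LEAST k. t < M ^ k) = Suc j"
    using L assms by (cases "LEAST k. t < M ^ k") auto
  have "\<not> t < M ^ j" using not_less_Least[of j "\<lambda>k. t < M ^ k"] j by simp
  then show ?thesis using L j by (auto intro!: exI[of _ j])
qed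

lemma geometric_intervals_disjoint:
  fixes M :: real
  assumes "1 < M" "0 < c"
  shows "disjoint_family (\<lambda>j. {c * M ^ j..<c * M ^ Suc j})"
proof -
  have *: False if "m < j" "c * M ^ j \<le> t" "t < c * M ^ Suc m" for m j t
  proof -
    have "M ^ Suc m \<le> M ^ j" using that assms by (intro power_increasing) auto
    with assms have "c * M ^ Suc m \<le> c * M ^ j" by simp
    with that show False by linarith
  qed
  show ?thesis
    unfolding disjoint_family_on_def
    by (metis (no_types, lifting) * Int_iff atLeastLessThan_iff equals0I linorder_neqE_nat)
qed

text \<open>
  The annuli \<open>2\<^sup>j \<le> |z| < 2\<^bsup>j+1\<^esup>\<close> are scaled copies of the first one and contribute
  a geometric series of ratio \<open>2\<^bsup>d-p\<^esup>\<close>, where \<open>d\<close> is the dimension.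
\<close>

lemma shell_integral_at_infinity:
  assumes "real DIM('a::euclidean_space) < p"
  shows "shell_integral TYPE('a) p {1..} < \<infinity>"
proof -
  define q where "q = 2 powr (real DIM('a) - p)"
  have q: "0 \<le> q" "q < 1" using assms powr_less_cancel_iff[of 2 "real DIM('a) - p" 0] by (auto simp: q_def)
  have U: "{1..} = (\<Union>j. {1 * 2 ^ j..<1 * 2 ^ Suc j :: real})"
    using exists_geometric_interval[of 2] 
    by (auto intro: order_trans[OF one_le_power[of 2]])
  have S: "shell_integral TYPE('a) p {1 * 2 ^ j..<1 * 2 ^ Suc j} = ennreal (q ^ j) * shell_integral TYPE('a) p {1..<2}" for j
  proof -
    have "(2 ^ j) powr (real DIM('a) - p) = q ^ j"
      by (simp add: q_def powr_power flip: powr_realpow) (simp add: powr_powr mult.commute)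
    then show ?thesis by (subst shell_integral_scale[of "{1..<2}" _ "2 ^ j"]) auto
  qed
  show ?thesis
    unfolding U 
    by (subst shell_integral_infinite_union)
       (use geometric_intervals_disjoint[of 2 1] suminf_geometric_ennreal_finite[OF q shell_integral_annulus_finite[where 'a='a, of 1 p 2]]
          in \<open>simp_all add: S[unfolded mult_1] del: power_Suc\<close>)
qed

text \<open>
  The same argument with annuli shrinking to the origin.
\<close>

lemma shell_integral_at_zero:
  assumes "p < real DIM('a::euclidean_space)"
  shows "shell_integral TYPE('a) p {0<..<1} < \<infinity>"
proof -
  define q where "q = (1/2) powr (real DIM('a) - p)"
  have q: "0 \<le> q" "q < 1" using assms powr_less_mono2[of "real DIM('a) - p" "1/2" 1] by (auto simp: q_def)
  have sub: "{0<..<1} \<subseteq> (\<Union>j. {(1/2) ^ Suc j..<2 * (1/2) ^ Suc j :: real})"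
  proof
    fix t :: real assume t: "t \<in> {0<..<1}"
    then obtain j where j: "2 ^ j \<le> inverse t" "inverse t < 2 ^ Suc j"
      using exists_geometric_interval[of 2 "inverse t"] by (auto simp: one_le_inverse_iff)
    have "(1/2) ^ Suc j \<le> t \<and> t \<le> (1/2)^j"
      using j t by (auto simp: field_simps power_one_over)
    show "t \<in> (\<Union>j. {(1/2) ^ Suc j..<2 * (1/2) ^ Suc j})"
    proof (cases "t = (1/2)^j")
      case True
      with t obtain i where "j = Suc i" by (cases j) auto
      with True t show ?thesis by (auto intro!: exI[of _ i])
    next
      case False
      with \<open>(1/2) ^ Suc j \<le> t \<and> t \<le> (1/2)^j\<close> show ?thesis by (auto intro!: exI[of _ j])
    qed
  qed
  have S: "shell_integral TYPE('a) p {(1/2) ^ Suc j..<2 * (1/2) ^ Suc j}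
      = ennreal (q ^ Suc j) * shell_integral TYPE('a) p {1..<2}" for j
  proof -
    have "((1/2) ^ Suc j) powr (real DIM('a) - p) = q ^ Suc j"
      unfolding q_def by (simp add: powr_power powr_realpow[symmetric] powr_powr mult.commute del: power_Suc)
    then show ?thesis
      by (subst shell_integral_scale[of "{1..<2}" _ "(1/2) ^ Suc j"]) (auto simp: field_simps)
  qed
  have "shell_integral TYPE('a) p {0<..<1}
     \<le> (\<integral>\<^sup>+(z::'a). (\<Sum>j. ennreal (norm z powr - p) * indicator {(1/2) ^ Suc j..<2 * (1/2) ^ Suc j} (norm z)) \<partial>lborel)"
    unfolding shell_integral_def
  proof (intro nn_integral_mono)
    fix z :: 'a
    show "ennreal (norm z powr - p) * indicator {0<..<1} (norm z)
      \<le> (\<Sum>j. ennreal (norm z powr - p) * indicator {(1/2) ^ Suc j..<2 * (1/2) ^ Suc j} (norm z))"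
    proof (cases "norm z \<in> {0<..<1}")
      case True
      then obtain j where "norm z \<in> {(1/2) ^ Suc j..<2 * (1/2) ^ Suc j}" using sub by blast
      then have "ennreal (norm z powr - p) * indicator {0<..<1} (norm z)
          \<le> ennreal (norm z powr - p) * indicator {(1/2) ^ Suc j..<2 * (1/2) ^ Suc j} (norm z)"
        using True by simp
      also have "\<dots> \<le> (\<Sum>j. ennreal (norm z powr - p) * indicator {(1/2) ^ Suc j..<2 * (1/2) ^ Suc j} (norm z))"
        by (rule order_trans[OF _ sum_le_suminf[OF summableI, of "{j}"]])
             (simp_all only: sum.empty sum.insert finite.emptyI finite.insertI empty_iff
               not_False_eq_True add_0_right order_refl zero_le ball_triv)
      finally show ?thesis .
    qed auto
  qed
  also have "\<dots> = (\<Sum>j. shell_integral TYPE('a) p {(1/2) ^ Suc j..<2 * (1/2) ^ Suc j})"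
    unfolding shell_integral_def by (intro nn_integral_suminf) auto
  also have "\<dots> = (\<Sum>j. ennreal (q ^ j) * (ennreal q * shell_integral TYPE('a) p {1..<2}))"
    unfolding S using q by (simp add: ennreal_mult' ennreal_mult mult_ac)
  also have "\<dots> < \<infinity>"
    using shell_integral_annulus_finite[where 'a='a, of 1 p 2]
    by (intro suminf_geometric_ennreal_finite q) (auto simp: ennreal_mult_less_top)
  finally show ?thesis .
qed

section \<open>The fractional Hardy inequality near a boundary point\<close>

definition gagliardo :: "real \<Rightarrow> 'a::euclidean_space set \<Rightarrow> ('a \<Rightarrow> real) \<Rightarrow> ennreal" where
  "gagliardo p \<Omega> u = (\<integral>\<^sup>+x\<in>\<Omega>. (\<integral>\<^sup>+y\<in>\<Omega>. ennreal (\<bar>u x - u y\<bar> / norm (x - y) powr p) \<partial>lborel) \<partial>lborel)"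

lemma ball_measurable [measurable]: "ball (x::'a::euclidean_space) r \<in> sets borel"
  by simp

lemma decseq_intervals_disjoint:
  fixes a :: "nat \<Rightarrow> 'a::linorder"
  assumes "decseq a"
  shows "disjoint_family (\<lambda>j. {a (Suc j)..<a j})"
proof -
  have *: False if "m < j" "t < a j" "a (Suc m) \<le> t" for m j t
    using decseqD[OF assms, of "Suc m" j] that by auto
  show ?thesis
    unfolding disjoint_family_on_def
    by (metis (no_types, lifting) * Int_iff atLeastLessThan_iff equals0I linorder_neqE_nat)
qed

text \<open>
  The exterior of \<open>\<Omega>\<close> lies outside the ball of radius \<open>\<delta>\<close> about \<open>x\<close>; the bound is the kernel integral there.
\<close>

lemma exterior_kernel_le:
  fixes x :: "'a::euclidean_space"
  assumes "0 < \<delta>" and "\<And>y. y \<notin> \<Omega> \<Longrightarrow> \<delta> \<le> norm (x - y)"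
  shows "(\<integral>\<^sup>+y\<in>-\<Omega>. ennreal (norm (x - y) powr - (real DIM('a) + s)) \<partial>lborel)
    \<le> ennreal (\<delta> powr - s) * shell_integral TYPE('a) (real DIM('a) + s) {1..}"
proof -
  have "(\<integral>\<^sup>+y\<in>-\<Omega>. ennreal (norm (x - y) powr - (real DIM('a) + s)) \<partial>lborel)
    \<le> (\<integral>\<^sup>+y. ennreal (norm (x - y) powr - (real DIM('a) + s)) * indicator {\<delta>..} (norm (x - y)) \<partial>lborel)"
    using assms by (intro nn_integral_mono) (auto simp: indicator_def)
  also have "\<dots> = shell_integral TYPE('a) (real DIM('a) + s) {\<delta>..}"
    by (rule shell_integral_centre) simp
  also have "\<dots> = ennreal (\<delta> powr - s) * shell_integral TYPE('a) (real DIM('a) + s) {1..}"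
    using assms by (subst shell_integral_scale[of "{1..}" _ \<delta>]) auto
  finally show ?thesis .
qed

text \<open>
  Inside \<open>ball p r\<close> the set \<open>\<Omega>\<close> is where the depth \<open>t\<close> below a Lipschitz graph is positive;
  \<open>e\<close> points out of \<open>\<Omega>\<close>, and moving along \<open>- e\<close> increases the depth at unit speed. The number \<open>N\<close> counts
  the inward translates of a boundary layer that are compared with it. The last assumption says that a
  factor \<open>1 / N\<close> beats the growth of the weight \<open>h\<^bsup>-s\<^esup>\<close> between the scales \<open>M h\<close> and \<open>h\<close>,
  where \<open>M\<close> is the number defined below.
\<close>

locale lipschitz_patch =
  fixes \<Omega> :: "'a::euclidean_space set" and p e :: 'a and r L s :: real and N :: nat and t :: "'a \<Rightarrow> real"
  assumes r: "0 < r" and L: "1 \<le> L" and s: "0 < s"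
    and lip: "L-lipschitz_on UNIV t" and vert: "\<And>x c. t (x + c *\<^sub>R e) = t x - c"
    and e: "norm e = 1" and open_\<Omega>: "open \<Omega>"
    and inside: "\<And>x. x \<in> ball p r \<Longrightarrow> x \<in> \<Omega> \<longleftrightarrow> 0 < t x"
    and N1: "1 \<le> N" and N: "(1 + L + real N * (L + 1)) powr s \<le> real N / 2"
begin

definition M :: real where "M = 1 + L + real N * (L + 1)"

text \<open>
  The ball grows with \<open>h\<close>, so that a displacement of length comparable to \<open>h\<close> does not lead out of
  the layer of thickness \<open>M h\<close>.
\<close>

definition layer :: "real \<Rightarrow> 'a set" where
  "layer h = {x \<in> ball p (r / 2 + h). 0 < t x \<and> t x \<le> h}"

text \<open>
  The displacement consists of a vector of length below \<open>h\<close> and of \<open>i\<close> vertical steps of length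
  \<open>h (L + 1)\<close>. One such step exceeds the oscillation \<open>h L\<close> of the depth caused by the first part, and it
  exceeds the thickness \<open>h\<close> of the layer.
\<close>

definition inward_step :: "real \<Rightarrow> nat \<Rightarrow> 'a \<Rightarrow> 'a" where
  "inward_step h i v = h *\<^sub>R v - (h * (real i * (L + 1))) *\<^sub>R e"

lemma t_measurable [measurable]: "t \<in> borel_measurable borel"
  using lipschitz_on_continuous_on[OF lip] by (rule borel_measurable_continuous_onI)

lemma \<Omega>_measurable [measurable]: "\<Omega> \<in> sets borel"
  using open_\<Omega> by simp

lemma layer_measurable [measurable]: "layer h \<in> sets borel"
proof -
  have "layer h = ball p (r / 2 + h) \<inter> (t -` {0<..h} \<inter> space borel)" by (auto simp: layer_def)
  also have "\<dots> \<in> sets borel" by (intro sets.Int measurable_sets[OF t_measurable]) auto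
  finally show ?thesis .
qed

lemma M_gt_1: "1 < M"
  using L N1 by (simp add: M_def add_pos_nonneg)

lemma t_diff_le: "t x - t y \<le> L * norm (x - y)"
  using lipschitz_onD[OF lip, of x y] by (simp add: dist_norm)

lemma t_inward_step:
  assumes "v \<in> ball 0 1" "0 < h"
  shows "t (x + inward_step h i v) \<le> t x + h * L + h * (real i * (L + 1))"
    and "t x - h * L + h * (real i * (L + 1)) \<le> t (x + inward_step h i v)"
proof -
  have "x + inward_step h i v = (x + h *\<^sub>R v) + (- (h * (real i * (L + 1)))) *\<^sub>R e"
    by (simp add: inward_step_def)
  then have "t (x + inward_step h i v) = t ((x + h *\<^sub>R v) + (- (h * (real i * (L + 1)))) *\<^sub>R e)"
    by (rule arg_cong)
  also have "\<dots> = t (x + h *\<^sub>R v) + h * (real i * (L + 1))" by (subst vert) simp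
  finally have eq: "t (x + inward_step h i v) = t (x + h *\<^sub>R v) + h * (real i * (L + 1))" .
  have "norm (h *\<^sub>R v) \<le> h" using assms by simp
  then have "L * norm (h *\<^sub>R v) \<le> L * h" using L by (intro mult_left_mono) auto
  then have "L * norm (h *\<^sub>R v) \<le> h * L" by (simp only: mult.commute)
  with t_diff_le[of "x + h *\<^sub>R v" x] t_diff_le[of x "x + h *\<^sub>R v"] eq
  show "t (x + inward_step h i v) \<le> t x + h * L + h * (real i * (L + 1))"
    and "t x - h * L + h * (real i * (L + 1)) \<le> t (x + inward_step h i v)"
    by auto
qed

text \<open>
  Lengths between \<open>h\<close> and \<open>M h\<close>: at the scales \<open>h = c / M\<^sup>j\<close> these ranges are disjoint, so that no pair
  of points is counted at two scales.
\<close>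

lemma norm_inward_step:
  assumes "v \<in> ball 0 1" "0 < h" "1 \<le> i" "i \<le> N"
  shows "h \<le> norm (inward_step h i v)" "norm (inward_step h i v) < M * h"
    and "norm (inward_step h i v) \<le> (M - 1) * h"
proof -
  have i: "1 \<le> real i" "real i \<le> real N" using assms by auto
  have nv: "norm (h *\<^sub>R v) \<le> h" using assms by simp
  have ne: "norm ((h * (real i * (L + 1))) *\<^sub>R e) = h * (real i * (L + 1))"
    using assms L by (simp add: e)
  have "1 * (1 + 1) \<le> real i * (L + 1)" using i L by (intro mult_mono) auto
  then have "h * 2 \<le> h * (real i * (L + 1))" using assms by simp
  moreover have "norm ((h * (real i * (L + 1))) *\<^sub>R e) - norm (h *\<^sub>R v) \<le> norm (inward_step h i v)"
    unfolding inward_step_def by (metis norm_minus_commute norm_triangle_ineq2)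
  ultimately show "h \<le> norm (inward_step h i v)" using nv ne by linarith
  have "real i * (L + 1) \<le> real N * (L + 1)" using i L by (intro mult_right_mono) auto
  then have "h * (real i * (L + 1)) \<le> h * (real N * (L + 1))" using assms by simp
  moreover have "norm (inward_step h i v) \<le> norm (h *\<^sub>R v) + norm ((h * (real i * (L + 1))) *\<^sub>R e)"
    unfolding inward_step_def by (rule norm_triangle_ineq4)
  moreover have "h \<le> h * L" using L assms by simp
  ultimately show *: "norm (inward_step h i v) \<le> (M - 1) * h" using nv ne
    unfolding M_def by (simp add: algebra_simps)
  show "norm (inward_step h i v) < M * h" using * assms by (simp add: algebra_simps)
qed

lemma inward_step_in_layer:
  assumes "x \<in> layer h" "v \<in> ball 0 1" "0 < h" "1 \<le> i" "i \<le> N"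
  shows "x + inward_step h i v \<in> layer (M * h)"
proof -
  have i: "1 \<le> real i" "real i \<le> real N" using assms by auto
  have "1 * (L + 1) \<le> real i * (L + 1)" "real i * (L + 1) \<le> real N * (L + 1)"
    using i L by (intro mult_right_mono; simp)+
  then have "h * (L + 1) \<le> h * (real i * (L + 1))" "h * (real i * (L + 1)) \<le> h * (real N * (L + 1))"
    using assms(3) by auto
  with t_inward_step[OF assms(2,3), of x i] have "0 < t (x + inward_step h i v)" "t (x + inward_step h i v) \<le> M * h"
    using assms(1,3) by (auto simp: layer_def M_def algebra_simps)
  moreover have "dist p (x + inward_step h i v) \<le> dist p x + norm (inward_step h i v)"
    using dist_triangle[of p "x + inward_step h i v" x] by (simp add: dist_norm)
  then have "dist p (x + inward_step h i v) < r / 2 + M * h"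
    using norm_inward_step(3)[OF assms(2-5)] assms(1) by (auto simp: layer_def algebra_simps)
  ultimately show ?thesis by (simp add: layer_def)
qed

lemma layer_subset:
  assumes "h \<le> r / 2" shows "layer h \<subseteq> \<Omega>"
  using assms inside by (force simp: layer_def)

text \<open>
  A point \<open>z\<close> is reached from the layer for at most one \<open>i\<close>, because consecutive vertical steps
  exceed the thickness of the layer. This is the source of the factor \<open>1 / N\<close>.
\<close>

lemma sum_indicator_layer_le:
  assumes "v \<in> ball 0 1" "0 < h"
  shows "(\<Sum>i=1..N. indicator (layer h) (z - inward_step h i v)) \<le> (indicator (layer (M * h)) z :: ennreal)"
proof (cases "\<exists>i\<in>{1..N}. z - inward_step h i v \<in> layer h")
  case False
  then have "(\<Sum>i=1..N. indicator (layer h) (z - inward_step h i v)) = (0::ennreal)"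
    by (intro sum.neutral) auto
  then show ?thesis by simp
next
  case True
  then obtain i where i: "i \<in> {1..N}" "z - inward_step h i v \<in> layer h" by blast
  have t_eq: "t (z - inward_step h j v) = t (z - h *\<^sub>R v) - h * (real j * (L + 1))" for j
    using vert[of "z - h *\<^sub>R v" "h * (real j * (L + 1))"] by (simp add: inward_step_def algebra_simps)
  have uniq: "j = i" if "z - inward_step h j v \<in> layer h" for j
  proof (rule ccontr)
    assume "j \<noteq> i"
    then have "1 \<le> \<bar>real j - real i\<bar>" by linarith
    then have "1 * h \<le> \<bar>real j - real i\<bar> * (h * (L + 1))"
      using assms L by (intro mult_mono) auto
    also have "\<dots> = \<bar>h * (real j * (L + 1)) - h * (real i * (L + 1))\<bar>"
      using assms L by (simp add: abs_mult flip: right_diff_distrib left_diff_distrib) 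
    finally show False using that i(2) by (auto simp: layer_def t_eq)
  qed
  have "indicator (layer h) (z - inward_step h j v) = (if j = i then 1 else (0::ennreal))" for j
  proof (cases "j = i")
    case True
    then show ?thesis using i(2) by simp
  next
    case False
    then have "z - inward_step h j v \<notin> layer h" using uniq by blast
    then show ?thesis using False by simp
  qed
  then have "(\<Sum>j=1..N. indicator (layer h) (z - inward_step h j v)) = (\<Sum>j=1..N. if j = i then 1 else (0::ennreal))"
    by (simp only:)
  also have "\<dots> = 1" using i(1) by simp
  also have "1 = (indicator (layer (M * h)) z :: ennreal)"
    using inward_step_in_layer[OF i(2) assms, of i] i(1) by simp
  finally show ?thesis by simp
qed

definition band :: "('a \<Rightarrow> real) \<Rightarrow> real \<Rightarrow> ennreal" where
  "band u h = (\<integral>\<^sup>+x\<in>\<Omega>. (\<integral>\<^sup>+y\<in>\<Omega>. ennreal (\<bar>u x - u y\<bar> / norm (x - y) powr (real DIM('a) + s))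
      * indicator {h..<M * h} (norm (x - y)) \<partial>lborel) \<partial>lborel)"

text \<open>
  Substitution of \<open>y = x + inward_step h i v\<close> for \<open>v\<close>. Where \<open>|x - y| < M h\<close>, the constant \<open>h\<^bsup>-n-s\<^esup>\<close>
  is at most \<open>M\<^bsup>n+s\<^esup>\<close> times the kernel.
\<close>

lemma average_difference_le:
  assumes [measurable]: "u \<in> borel_measurable borel"
    and h: "0 < h" "M * h \<le> r / 2" and i: "1 \<le> i" "i \<le> N" and x: "x \<in> layer h"
  shows "ennreal (h powr - s) * (\<integral>\<^sup>+v\<in>ball 0 1. ennreal \<bar>u x - u (x + inward_step h i v)\<bar> \<partial>lborel)
    \<le> ennreal (M powr (real DIM('a) + s)) * (\<integral>\<^sup>+y\<in>\<Omega>. ennreal (\<bar>u x - u y\<bar> / norm (x - y) powr (real DIM('a) + s))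
      * indicator {h..<M * h} (norm (x - y)) \<partial>lborel)"
proof -
  define q where "q = real DIM('a) + s"
  define a where "a = x - (h * (real i * (L + 1))) *\<^sub>R e"
  define f where "f z = ennreal \<bar>u x - u z\<bar> * indicator (ball 0 1) ((1 / h) *\<^sub>R (z - a))" for z
  have [measurable]: "f \<in> borel_measurable borel" unfolding f_def by measurable
  have "(\<integral>\<^sup>+v\<in>ball 0 1. ennreal \<bar>u x - u (x + inward_step h i v)\<bar> \<partial>lborel) = (\<integral>\<^sup>+v. f (a + h *\<^sub>R v) \<partial>lborel)"
    using h by (intro nn_integral_cong) (simp add: f_def a_def inward_step_def algebra_simps)
  then have "ennreal (h powr - s) * (\<integral>\<^sup>+v\<in>ball 0 1. ennreal \<bar>u x - u (x + inward_step h i v)\<bar> \<partial>lborel)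
     = ennreal (h powr - q) * (ennreal (h ^ DIM('a)) * (\<integral>\<^sup>+v. f (a + h *\<^sub>R v) \<partial>lborel))"
    using h by (simp add: q_def powr_add powr_minus_divide powr_diff powr_realpow mult.assoc[symmetric] flip: ennreal_mult)
  also have "\<dots> = ennreal (h powr - q) * (\<integral>\<^sup>+z. f z \<partial>lborel)"
    using h by (subst (2) nn_integral_lborel_affine[of _ h a]) auto
  also have "\<dots> = (\<integral>\<^sup>+z. ennreal (h powr - q) * f z \<partial>lborel)"
    by (rule nn_integral_cmult[symmetric]) simp
  also have "\<dots> \<le> (\<integral>\<^sup>+y. ennreal (M powr q) * (ennreal (\<bar>u x - u y\<bar> / norm (x - y) powr q)
      * indicator {h..<M * h} (norm (x - y)) * indicator \<Omega> y) \<partial>lborel)"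
  proof (intro nn_integral_mono)
    fix z
    show "ennreal (h powr - q) * f z \<le> ennreal (M powr q) * (ennreal (\<bar>u x - u z\<bar> / norm (x - z) powr q)
      * indicator {h..<M * h} (norm (x - z)) * indicator \<Omega> z)"
    proof (cases "(1 / h) *\<^sub>R (z - a) \<in> ball 0 1")
      case True
      define v where "v = (1 / h) *\<^sub>R (z - a)"
      have z: "z = x + inward_step h i v" using h by (simp add: v_def inward_step_def a_def)
      have v: "v \<in> ball 0 1" using True by (simp add: v_def)
      have "norm (x - z) = norm (inward_step h i v)" by (simp add: z)
      with norm_inward_step[OF v h(1) i] have n: "h \<le> norm (x - z)" "norm (x - z) < M * h" by auto
      have "z \<in> \<Omega>" using inward_step_in_layer[OF x v h(1) i] layer_subset[OF h(2)] z by blast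
      have "norm (x - z) powr q \<le> (M * h) powr q"
        using n s by (intro powr_mono2) (auto simp: q_def)
      moreover have npos: "0 < norm (x - z) powr q" using n h by auto
      ultimately have "h powr - q \<le> M powr q / norm (x - z) powr q"
        using n h M_gt_1 npos by (simp add: powr_mult powr_minus_divide field_simps)
      then have "h powr - q * \<bar>u x - u z\<bar> \<le> M powr q / norm (x - z) powr q * \<bar>u x - u z\<bar>"
        by (intro mult_right_mono) auto
      with \<open>z \<in> \<Omega>\<close> show ?thesis using n True
        by (simp add: f_def flip: ennreal_mult)
    qed (simp add: f_def)
  qed
  also have "\<dots> = ennreal (M powr q) * (\<integral>\<^sup>+y\<in>\<Omega>. ennreal (\<bar>u x - u y\<bar> / norm (x - y) powr q)
      * indicator {h..<M * h} (norm (x - y)) \<partial>lborel)"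
    by (rule nn_integral_cmult) measurable
  finally show ?thesis by (simp add: q_def)
qed

text \<open>
  For fixed \<open>v\<close> the translates of the layer are disjoint parts of the thicker layer.
\<close>

lemma sum_translates_le:
  assumes [measurable]: "u \<in> borel_measurable borel" and h: "0 < h"
  shows "(\<Sum>i=1..N. \<integral>\<^sup>+x\<in>layer h. (\<integral>\<^sup>+v\<in>ball 0 1. ennreal \<bar>u (x + inward_step h i v)\<bar> \<partial>lborel) \<partial>lborel)
    \<le> emeasure lborel (ball (0::'a) 1) * (\<integral>\<^sup>+x\<in>layer (M * h). ennreal \<bar>u x\<bar> \<partial>lborel)"
proof -
  have [measurable]: "(\<lambda>v. inward_step h i v) \<in> borel_measurable borel" for i
    unfolding inward_step_def by measurable
  have "(\<Sum>i=1..N. \<integral>\<^sup>+x\<in>layer h. (\<integral>\<^sup>+v\<in>ball 0 1. ennreal \<bar>u (x + inward_step h i v)\<bar> \<partial>lborel) \<partial>lborel)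
     = (\<Sum>i=1..N. \<integral>\<^sup>+v. \<integral>\<^sup>+z. ennreal \<bar>u z\<bar> * indicator (layer h) (z - inward_step h i v) * indicator (ball 0 1) v \<partial>lborel \<partial>lborel)"
  proof (intro sum.cong refl)
    fix i
    have "(\<integral>\<^sup>+x\<in>layer h. (\<integral>\<^sup>+v\<in>ball 0 1. ennreal \<bar>u (x + inward_step h i v)\<bar> \<partial>lborel) \<partial>lborel)
       = (\<integral>\<^sup>+x. \<integral>\<^sup>+v. ennreal \<bar>u (x + inward_step h i v)\<bar> * indicator (layer h) x * indicator (ball 0 1) v \<partial>lborel \<partial>lborel)"
      by (intro nn_integral_cong) (subst nn_integral_multc[symmetric], auto simp: mult_ac)
    also have "\<dots> = (\<integral>\<^sup>+v. \<integral>\<^sup>+x. ennreal \<bar>u (x + inward_step h i v)\<bar> * indicator (layer h) x * indicator (ball 0 1) v \<partial>lborel \<partial>lborel)"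
      by (rule lborel_pair.Fubini') measurable
    also have "\<dots> = (\<integral>\<^sup>+v. \<integral>\<^sup>+z. ennreal \<bar>u z\<bar> * indicator (layer h) (z - inward_step h i v) * indicator (ball 0 1) v \<partial>lborel \<partial>lborel)"
      using nn_integral_lborel_translate[of "\<lambda>z. ennreal \<bar>u z\<bar> * indicator (layer h) (z - inward_step h i v) * indicator (ball 0 1) v" "inward_step h i v" for v]
      by simp
    finally show "(\<integral>\<^sup>+x\<in>layer h. (\<integral>\<^sup>+v\<in>ball 0 1. ennreal \<bar>u (x + inward_step h i v)\<bar> \<partial>lborel) \<partial>lborel) = \<dots>" .
  qed
  also have "\<dots> = (\<integral>\<^sup>+v. \<integral>\<^sup>+z. (\<Sum>i=1..N. ennreal \<bar>u z\<bar> * indicator (layer h) (z - inward_step h i v) * indicator (ball 0 1) v) \<partial>lborel \<partial>lborel)"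
    by (subst nn_integral_sum[symmetric], measurable, intro nn_integral_cong nn_integral_sum[symmetric], measurable)
  also have "\<dots> \<le> (\<integral>\<^sup>+v. \<integral>\<^sup>+z. ennreal \<bar>u z\<bar> * indicator (layer (M * h)) z * indicator (ball (0::'a) 1) v \<partial>lborel \<partial>lborel)"
  proof (intro nn_integral_mono)
    fix v z :: 'a
    show "(\<Sum>i=1..N. ennreal \<bar>u z\<bar> * indicator (layer h) (z - inward_step h i v) * indicator (ball 0 1) v)
       \<le> ennreal \<bar>u z\<bar> * indicator (layer (M * h)) z * indicator (ball 0 1) v"
      using sum_indicator_layer_le[of v h z] h
      by (cases "v \<in> ball 0 1") (auto simp: sum_distrib_left[symmetric] intro!: mult_left_mono)
  qed
  also have "\<dots> = (\<integral>\<^sup>+v. (\<integral>\<^sup>+x\<in>layer (M * h). ennreal \<bar>u x\<bar> \<partial>lborel) * indicator (ball (0::'a) 1) v \<partial>lborel)"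
    by (intro nn_integral_cong nn_integral_multc) measurable
  also have "\<dots> = emeasure lborel (ball (0::'a) 1) * (\<integral>\<^sup>+x\<in>layer (M * h). ennreal \<bar>u x\<bar> \<partial>lborel)"
    by (subst nn_integral_cmult_indicator) (auto simp: mult.commute)
  finally show ?thesis .
qed

text \<open>
  The volume of the unit ball is kept as a factor to avoid dividing extended reals.
\<close>

definition weighted_layer :: "('a \<Rightarrow> real) \<Rightarrow> real \<Rightarrow> ennreal" where
  "weighted_layer u h = emeasure lborel (ball (0::'a) 1) * (ennreal (h powr - s) * (\<integral>\<^sup>+x\<in>layer h. ennreal \<bar>u x\<bar> \<partial>lborel))"

text \<open>
  The triangle inequality \<open>|u(x)| \<le> |u(x) - u(z)| + |u(z)|\<close> for \<open>z = x + inward_step h i v\<close>, averaged over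
  \<open>v\<close> and \<open>i\<close>. By the choice of \<open>N\<close> the second part is at most half the weighted mass at scale \<open>M h\<close>.
\<close>

lemma weighted_layer_step:
  assumes [measurable]: "u \<in> borel_measurable borel" and h: "0 < h" "M * h \<le> r / 2"
  shows "2 * weighted_layer u h \<le> ennreal (2 * M powr (real DIM('a) + s)) * band u h + weighted_layer u (M * h)"
proof -
  define \<omega> where "\<omega> = emeasure lborel (ball (0::'a) 1)"
  define U where "U h = (\<integral>\<^sup>+x\<in>layer h. ennreal \<bar>u x\<bar> \<partial>lborel)" for h
  define q where "q = real DIM('a) + s"
  have [measurable]: "(\<lambda>v. inward_step h i v) \<in> borel_measurable borel" for i
    unfolding inward_step_def by measurable
  define D where "D i = (\<integral>\<^sup>+x\<in>layer h. (\<integral>\<^sup>+v\<in>ball 0 1. ennreal \<bar>u x - u (x + inward_step h i v)\<bar> \<partial>lborel) \<partial>lborel)" for i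
  define T where "T i = (\<integral>\<^sup>+x\<in>layer h. (\<integral>\<^sup>+v\<in>ball 0 1. ennreal \<bar>u (x + inward_step h i v)\<bar> \<partial>lborel) \<partial>lborel)" for i
  have 1: "\<omega> * U h \<le> D i + T i" for i
  proof -
    have "\<omega> * U h = (\<integral>\<^sup>+x\<in>layer h. (\<integral>\<^sup>+v\<in>ball (0::'a) 1. ennreal \<bar>u x\<bar> \<partial>lborel) \<partial>lborel)"
      by (simp add: U_def \<omega>_def nn_integral_cmult_indicator nn_integral_cmult[symmetric] mult_ac)
    also have "\<dots> \<le> (\<integral>\<^sup>+x\<in>layer h. ((\<integral>\<^sup>+v\<in>ball 0 1. ennreal \<bar>u x - u (x + inward_step h i v)\<bar> \<partial>lborel)
         + (\<integral>\<^sup>+v\<in>ball 0 1. ennreal \<bar>u (x + inward_step h i v)\<bar> \<partial>lborel)) \<partial>lborel)"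
    proof (intro nn_integral_mono mult_right_mono)
      fix x
      show "(\<integral>\<^sup>+v\<in>ball (0::'a) 1. ennreal \<bar>u x\<bar> \<partial>lborel) \<le> (\<integral>\<^sup>+v\<in>ball 0 1. ennreal \<bar>u x - u (x + inward_step h i v)\<bar> \<partial>lborel)
         + (\<integral>\<^sup>+v\<in>ball 0 1. ennreal \<bar>u (x + inward_step h i v)\<bar> \<partial>lborel)"
        by (subst nn_integral_add[symmetric])
           (auto intro!: nn_integral_mono simp: indicator_def ennreal_plus[symmetric] simp del: ennreal_plus intro!: ennreal_leI)
    qed simp
    also have "\<dots> = D i + T i"
      unfolding D_def T_def by (simp add: distrib_right nn_integral_add)
    finally show ?thesis .
  qed
  have 2: "ennreal (h powr - s) * D i \<le> ennreal (M powr q) * band u h" if i: "i \<in> {1..N}" for i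
  proof -
    have "ennreal (h powr - s) * D i
       = (\<integral>\<^sup>+x\<in>layer h. (ennreal (h powr - s) * (\<integral>\<^sup>+v\<in>ball 0 1. ennreal \<bar>u x - u (x + inward_step h i v)\<bar> \<partial>lborel)) \<partial>lborel)"
      unfolding D_def by (subst nn_integral_cmult[symmetric]) (auto simp: mult_ac)
    also have "\<dots> \<le> (\<integral>\<^sup>+x\<in>\<Omega>. (ennreal (M powr q) * (\<integral>\<^sup>+y\<in>\<Omega>. ennreal (\<bar>u x - u y\<bar> / norm (x - y) powr q)
      * indicator {h..<M * h} (norm (x - y)) \<partial>lborel)) \<partial>lborel)"
    proof (intro nn_integral_mono)
      fix x
      have "1 * h \<le> M * h" using h M_gt_1 by (intro mult_right_mono) auto
      then have "layer h \<subseteq> \<Omega>" using h by (intro layer_subset) linarith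
      then show "ennreal (h powr - s) * (\<integral>\<^sup>+v\<in>ball 0 1. ennreal \<bar>u x - u (x + inward_step h i v)\<bar> \<partial>lborel) * indicator (layer h) x
        \<le> ennreal (M powr q) * (\<integral>\<^sup>+y\<in>\<Omega>. ennreal (\<bar>u x - u y\<bar> / norm (x - y) powr q)
      * indicator {h..<M * h} (norm (x - y)) \<partial>lborel) * indicator \<Omega> x"
        using average_difference_le[OF assms, of i x] i by (cases "x \<in> layer h") (auto simp: q_def)
    qed
    also have "\<dots> = ennreal (M powr q) * band u h"
      unfolding band_def q_def by (subst nn_integral_cmult[symmetric]) (auto simp: mult_ac)
    finally show ?thesis .
  qed
  have pos: "0 < real N" using N1 by simp
  have "ennreal (real N) * (ennreal (h powr - s) * (\<omega> * U h)) = (\<Sum>i=1..N. ennreal (h powr - s) * (\<omega> * U h))"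
    by (simp add: ennreal_of_nat_eq_real_of_nat)
  also have "\<dots> \<le> (\<Sum>i=1..N. ennreal (h powr - s) * (D i + T i))"
    by (intro sum_mono mult_left_mono 1) auto
  also have "\<dots> = (\<Sum>i=1..N. ennreal (h powr - s) * D i) + ennreal (h powr - s) * (\<Sum>i=1..N. T i)"
    by (simp add: distrib_left sum.distrib sum_distrib_left)
  also have "\<dots> \<le> (\<Sum>i=1..N. ennreal (M powr q) * band u h) + ennreal (h powr - s) * (\<omega> * U (M * h))"
    using 2 sum_translates_le[OF assms(1) h(1)]
    by (intro add_mono sum_mono mult_left_mono) (auto simp: T_def U_def \<omega>_def)
  also have "ennreal (h powr - s) * (\<omega> * U (M * h)) = ennreal (M powr s) * weighted_layer u (M * h)"
  proof -
    have "ennreal (h powr - s) = ennreal (M powr s) * ennreal ((M * h) powr - s)"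
      using h M_gt_1 by (simp add: powr_mult powr_minus_divide flip: ennreal_mult)
    then show ?thesis by (simp add: weighted_layer_def U_def \<omega>_def mult_ac)
  qed
  also have "\<dots> \<le> ennreal (real N / 2) * weighted_layer u (M * h)"
    using N by (intro mult_right_mono ennreal_leI) (auto simp: M_def)
  also have "(\<Sum>i=1..N. ennreal (M powr q) * band u h) = ennreal (real N) * (ennreal (M powr q) * band u h)"
    by (simp add: ennreal_of_nat_eq_real_of_nat)
  finally have "ennreal (2 / real N) * (ennreal (real N) * (ennreal (h powr - s) * (\<omega> * U h)))
     \<le> ennreal (2 / real N) * (ennreal (real N) * (ennreal (M powr q) * band u h) + ennreal (real N / 2) * weighted_layer u (M * h))"
    by (intro mult_left_mono) auto
  moreover have "ennreal (2 / real N) * (ennreal (real N) * X) = 2 * X" for X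
    using pos by (simp add: mult.assoc[symmetric] flip: ennreal_mult)
  moreover have "ennreal (2 / real N) * (ennreal (real N / 2) * X) = X" for X
    using pos by (simp add: mult.assoc[symmetric] flip: ennreal_mult)
  moreover have "2 * (ennreal (M powr q) * band u h) = ennreal (2 * M powr q) * band u h"
    by (simp add: ennreal_mult mult.assoc)
  moreover have "ennreal (h powr - s) * (\<omega> * U h) = weighted_layer u h"
    by (simp only: weighted_layer_def U_def \<omega>_def mult.left_commute)
  ultimately show ?thesis by (simp only: distrib_left q_def)
qed

definition scale :: "nat \<Rightarrow> real" where
  "scale j = r / 2 / M ^ j"

lemma scale_pos: "0 < scale j"
  using r M_gt_1 by (simp add: scale_def)

lemma scale_Suc: "M * scale (Suc j) = scale j"
  using M_gt_1 by (simp add: scale_def)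

lemma scale_decseq: "decseq scale"
proof (rule decseq_SucI)
  fix j
  have "1 * scale (Suc j) \<le> M * scale (Suc j)"
    using scale_pos[of "Suc j"] M_gt_1 by (intro mult_right_mono) auto
  then show "scale (Suc j) \<le> scale j" by (simp add: scale_Suc)
qed

lemma scale_le: "scale j \<le> r / 2"
  using decseqD[OF scale_decseq, of 0 j] by (simp add: scale_def)

text \<open>
  The bands of admissible distances at different scales are disjoint.
\<close>

lemma sum_band_le_gagliardo:
  assumes [measurable]: "u \<in> borel_measurable borel"
  shows "(\<Sum>j<J. band u (scale (Suc j))) \<le> gagliardo (real DIM('a) + s) \<Omega> u"
proof -
  define G where "G x y = ennreal (\<bar>u x - u y\<bar> / norm (x - y) powr (real DIM('a) + s))" for x y
  define I where "I j = {scale (Suc j)..<scale j}" for j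
  have [measurable]: "(\<lambda>(x, y). G x y) \<in> borel_measurable (borel \<Otimes>\<^sub>M borel)" "I j \<in> sets borel" for j
    unfolding G_def I_def by measurable
  have "(\<Sum>j<J. band u (scale (Suc j)))
     = (\<Sum>j<J. \<integral>\<^sup>+x. (\<integral>\<^sup>+y. G x y * indicator (I j) (norm (x - y)) * indicator \<Omega> y \<partial>lborel) * indicator \<Omega> x \<partial>lborel)"
    by (simp add: band_def scale_Suc G_def I_def)
  also have "\<dots> = (\<integral>\<^sup>+x. (\<Sum>j<J. (\<integral>\<^sup>+y. G x y * indicator (I j) (norm (x - y)) * indicator \<Omega> y \<partial>lborel) * indicator \<Omega> x) \<partial>lborel)"
    by (rule nn_integral_sum[symmetric]) measurable
  also have "\<dots> = (\<integral>\<^sup>+x\<in>\<Omega>. (\<integral>\<^sup>+y. (\<Sum>j<J. G x y * indicator (I j) (norm (x - y)) * indicator \<Omega> y) \<partial>lborel) \<partial>lborel)"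
    by (intro nn_integral_cong, subst nn_integral_sum) (measurable, simp add: sum_distrib_right)
  also have "\<dots> \<le> (\<integral>\<^sup>+x\<in>\<Omega>. (\<integral>\<^sup>+y\<in>\<Omega>. G x y \<partial>lborel) \<partial>lborel)"
  proof (intro nn_integral_mono mult_right_mono)
    fix x y :: 'a
    have "disjoint_family_on I {..<J}"
      unfolding I_def by (rule disjoint_family_on_mono[OF subset_UNIV decseq_intervals_disjoint[OF scale_decseq]])
    then have "(\<Sum>j<J. indicator (I j) (norm (x - y))) = (indicator (\<Union>j<J. I j) (norm (x - y)) :: ennreal)"
      by (intro indicator_UN_disjoint[symmetric]) auto
    also have "\<dots> \<le> 1" by (simp add: indicator_def)
    finally have "G x y * (\<Sum>j<J. indicator (I j) (norm (x - y))) * indicator \<Omega> y \<le> G x y * 1 * indicator \<Omega> y"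
      by (intro mult_left_mono mult_right_mono) auto
    then show "(\<Sum>j<J. G x y * indicator (I j) (norm (x - y)) * indicator \<Omega> y) \<le> G x y * indicator \<Omega> y"
      by (simp only: sum_distrib_left sum_distrib_right mult_1_right)
  qed simp
  finally show ?thesis by (simp only: gagliardo_def G_def)
qed

text \<open>
  The recursion \<open>2 b\<^bsub>j+1\<^esub> \<le> b\<^sub>j + \<dots>\<close> is summed. Adding the last term once more to the partial sum
  makes the induction close without subtraction in the extended reals.
\<close>

lemma suminf_weighted_layer_le:
  assumes u: "u \<in> borel_measurable borel"
  shows "(\<Sum>j. weighted_layer u (scale j))
    \<le> 2 * weighted_layer u (scale 0) + ennreal (2 * M powr (real DIM('a) + s)) * gagliardo (real DIM('a) + s) \<Omega> u"
proof -
  define b where "b j = weighted_layer u (scale j)" for j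
  define C where "C = ennreal (2 * M powr (real DIM('a) + s))"
  have step: "2 * b (Suc j) \<le> C * band u (scale (Suc j)) + b j" for j
    using weighted_layer_step[OF u scale_pos, of "Suc j"] scale_le[of j] by (simp add: b_def C_def scale_Suc)
  have ind: "(\<Sum>j\<le>J. b j) + b J \<le> 2 * b 0 + C * (\<Sum>j<J. band u (scale (Suc j)))" for J
  proof (induction J)
    case 0 show ?case by (simp add: mult_2)
  next
    case (Suc J)
    have "(\<Sum>j\<le>Suc J. b j) + b (Suc J) = (\<Sum>j\<le>J. b j) + 2 * b (Suc J)"
      by (simp add: mult_2 add.assoc)
    also have "\<dots> \<le> (\<Sum>j\<le>J. b j) + (C * band u (scale (Suc J)) + b J)"
      by (intro add_mono step) auto
    also have "\<dots> = ((\<Sum>j\<le>J. b j) + b J) + C * band u (scale (Suc J))"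
      by (simp add: add_ac)
    also have "\<dots> \<le> (2 * b 0 + C * (\<Sum>j<J. band u (scale (Suc j)))) + C * band u (scale (Suc J))"
      by (intro add_mono Suc) auto
    also have "\<dots> = 2 * b 0 + C * (\<Sum>j<Suc J. band u (scale (Suc j)))"
      by (simp add: distrib_left add.assoc)
    finally show ?case .
  qed
  have "(\<Sum>j. b j) \<le> 2 * b 0 + C * gagliardo (real DIM('a) + s) \<Omega> u"
  proof (rule suminf_le_const[OF summableI])
    fix J
    have "(\<Sum>j<J. b j) \<le> (\<Sum>j\<le>J. b j)" by (intro sum_mono2) auto
    also have "\<dots> \<le> (\<Sum>j\<le>J. b j) + b J" by simp
    also note ind[of J]
    also have "2 * b 0 + C * (\<Sum>j<J. band u (scale (Suc j))) \<le> 2 * b 0 + C * gagliardo (real DIM('a) + s) \<Omega> u"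
      by (intro add_mono mult_left_mono sum_band_le_gagliardo u) auto
    finally show "(\<Sum>j<J. b j) \<le> 2 * b 0 + C * gagliardo (real DIM('a) + s) \<Omega> u" .
  qed
  then show ?thesis by (simp add: b_def C_def)
qed

text \<open>
  The distance of \<open>x\<close> to the exterior is at least \<open>t x / L\<close>, or half the radius of the patch, so the
  exterior kernel is of order \<open>(t x)\<^bsup>-s\<^esup>\<close>; the layer whose thickness is comparable to \<open>t x\<close>
  alone accounts for it.
\<close>

lemma exterior_kernel_le_layers:
  assumes x: "x \<in> \<Omega>" "x \<in> ball p (r / 2)"
  shows "(\<integral>\<^sup>+y\<in>-\<Omega>. ennreal (norm (x - y) powr - (real DIM('a) + s)) \<partial>lborel)
    \<le> ennreal ((L * M) powr s) * shell_integral TYPE('a) (real DIM('a) + s) {1..}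
      * (ennreal (scale 0 powr - s) + (\<Sum>j. ennreal (scale j powr - s) * indicator (layer (scale j)) x))"
proof -
  define F where "F = shell_integral TYPE('a) (real DIM('a) + s) {1..}"
  define T where "T = ennreal (scale 0 powr - s) + (\<Sum>j. ennreal (scale j powr - s) * indicator (layer (scale j)) x)"
  have M1: "1 < M" by (rule M_gt_1)
  have xr: "x \<in> ball p r" using x r by simp
  then have tx: "0 < t x" using x inside by blast
  have dist: "min (r / 2) (t x / L) \<le> norm (x - y)" if y: "y \<notin> \<Omega>" for y
  proof (cases "y \<in> ball p r")
    case True
    with y inside have "t y \<le> 0" by force
    then have "t x \<le> L * norm (x - y)" using t_diff_le[of x y] by simp
    then have "t x / L \<le> norm (x - y)" using L by (simp add: field_simps)
    then show ?thesis by simp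
  next
    case False
    then have "r \<le> dist p y" by simp
    also have "dist p y \<le> dist p x + norm (x - y)" using dist_triangle[of p y x] by (simp add: dist_norm)
    finally show ?thesis using x(2) by simp
  qed
  have le: "(\<integral>\<^sup>+y\<in>-\<Omega>. ennreal (norm (x - y) powr - (real DIM('a) + s)) \<partial>lborel)
      \<le> ennreal ((L * M) powr s) * F * ennreal (scale j powr - s)"
    if j: "scale (Suc j) \<le> t x" for j
  proof -
    have "scale (Suc j) / L \<le> scale (Suc j)"
      using scale_pos[of "Suc j"] L by (simp add: divide_le_eq)
    then have "scale (Suc j) / L \<le> r / 2" using scale_le[of "Suc j"] by linarith
    moreover have "scale (Suc j) / L \<le> t x / L" using j L by (intro divide_right_mono) auto
    ultimately have "scale (Suc j) / L \<le> min (r / 2) (t x / L)" by simp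
    then have "(\<integral>\<^sup>+y\<in>-\<Omega>. ennreal (norm (x - y) powr - (real DIM('a) + s)) \<partial>lborel)
      \<le> ennreal ((scale (Suc j) / L) powr - s) * F"
      unfolding F_def using scale_pos[of "Suc j"] L order_trans[OF _ dist]
      by (intro exterior_kernel_le) auto
    also have "(scale (Suc j) / L) powr - s = (L * M) powr s * scale j powr - s"
    proof -
      have "scale (Suc j) / L = scale j / (L * M)" using M1 by (simp add: scale_def)
      also have "\<dots> powr - s = (L * M) powr s * scale j powr - s"
        using L M1 scale_pos[of j] by (simp add: powr_divide powr_minus_divide)
      finally show ?thesis .
    qed
    finally show ?thesis by (simp add: ennreal_mult mult_ac)
  qed
  have "\<exists>j. scale (Suc j) \<le> t x \<and> ennreal (scale j powr - s) \<le> T"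
  proof (cases "t x \<ge> scale 0")
    case True
    then have "scale (Suc 0) \<le> t x" using decseqD[OF scale_decseq, of 0 1] by simp
    then show ?thesis by (auto simp: T_def intro!: exI[of _ 0])
  next
    case False
    then have "1 \<le> scale 0 / t x" using tx by simp
    from exists_geometric_interval[OF M1 this] obtain j
      where j: "M ^ j \<le> scale 0 / t x" "scale 0 / t x < M ^ Suc j" by blast
    have "scale (Suc j) \<le> t x" "t x \<le> scale j"
      using j tx M1 by (auto simp: scale_def field_simps)
    moreover from this have "x \<in> layer (scale j)"
      using tx x scale_pos[of j] by (auto simp: layer_def)
    then have "ennreal (scale j powr - s) \<le> (\<Sum>j. ennreal (scale j powr - s) * indicator (layer (scale j)) x)"
      by (intro order_trans[OF _ sum_le_suminf[OF summableI, of "{j}"]]) auto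
    then have "ennreal (scale j powr - s) \<le> T"
      unfolding T_def by (rule order_trans) simp
    ultimately show ?thesis by blast
  qed
  then obtain j where j: "scale (Suc j) \<le> t x" "ennreal (scale j powr - s) \<le> T" by blast
  have "(\<integral>\<^sup>+y\<in>-\<Omega>. ennreal (norm (x - y) powr - (real DIM('a) + s)) \<partial>lborel)
      \<le> ennreal ((L * M) powr s) * F * ennreal (scale j powr - s)"
    by (rule le[OF j(1)])
  also have "\<dots> \<le> ennreal ((L * M) powr s) * F * T"
    using j(2) by (intro mult_left_mono) auto
  finally show ?thesis by (simp add: F_def T_def)
qed

text \<open>
  The layers turn the exterior kernel into the weighted layer masses, whose sum is controlled by
  the recursion.
\<close>

lemma hardy_patch:
  shows "\<exists>C<\<infinity>. \<forall>u\<in>borel_measurable borel.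
    (\<integral>\<^sup>+x\<in>\<Omega> \<inter> ball p (r / 2). ennreal \<bar>u x\<bar> * (\<integral>\<^sup>+y\<in>-\<Omega>. ennreal (norm (x - y) powr - (real DIM('a) + s)) \<partial>lborel) \<partial>lborel)
    \<le> C * ((\<integral>\<^sup>+x\<in>\<Omega>. ennreal \<bar>u x\<bar> \<partial>lborel) + gagliardo (real DIM('a) + s) \<Omega> u)"
proof -
  define A where "A = ennreal ((L * M) powr s) * shell_integral TYPE('a) (real DIM('a) + s) {1..}"
  define \<omega> where "\<omega> = emeasure lborel (ball (0::'a) 1)"
  define C where "C = ennreal (2 * M powr (real DIM('a) + s))"
  define S where "S = ennreal (scale 0 powr - s)"
  have A: "A < \<infinity>" unfolding A_def
    using shell_integral_at_infinity[where 'a='a, of "real DIM('a) + s"] s by (simp add: ennreal_mult_less_top)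
  have \<omega>: "\<omega> < \<infinity>" "\<omega> \<noteq> 0"
  proof -
    show "\<omega> < \<infinity>" unfolding \<omega>_def by (rule emeasure_lborel_ball_finite)
    show "\<omega> \<noteq> 0"
      unfolding \<omega>_def by (metis null_setsI null_sets_completionI negligible_iff_null_sets open_ball borel_open
          sets_lborel open_not_negligible ball_eq_empty not_one_le_zero zero_neq_one linorder_not_le zero_less_one)
  qed
  define D where "D = A / \<omega> * (3 * \<omega> * S + C)"
  have "A / \<omega> < \<infinity>" "3 * \<omega> * S + C < \<infinity>"
    using A \<omega> unfolding C_def S_def
    by (auto simp: divide_ennreal_def ennreal_mult_less_top ennreal_inverse_eq_top_iff less_top[symmetric] ennreal_mult_eq_top_iff)
  then have fin: "D < \<infinity>" unfolding D_def by (simp add: ennreal_mult_less_top)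
  show ?thesis
  proof (intro exI[of _ D] conjI fin ballI)
    fix u :: "'a \<Rightarrow> real" assume u [measurable]: "u \<in> borel_measurable borel"
    define U where "U = (\<integral>\<^sup>+x\<in>\<Omega>. ennreal \<bar>u x\<bar> \<partial>lborel)"
    define G where "G = gagliardo (real DIM('a) + s) \<Omega> u"
    define lhs where "lhs = (\<integral>\<^sup>+x\<in>\<Omega> \<inter> ball p (r / 2). ennreal \<bar>u x\<bar> * (\<integral>\<^sup>+y\<in>-\<Omega>. ennreal (norm (x - y) powr - (real DIM('a) + s)) \<partial>lborel) \<partial>lborel)"
    have "lhs \<le> (\<integral>\<^sup>+x. A * (S * (ennreal \<bar>u x\<bar> * indicator \<Omega> x) + (\<Sum>j. ennreal (scale j powr - s) * (ennreal \<bar>u x\<bar> * indicator (layer (scale j)) x))) \<partial>lborel)"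
      unfolding lhs_def
    proof (intro nn_integral_mono)
      fix x
      show "ennreal \<bar>u x\<bar> * (\<integral>\<^sup>+y\<in>-\<Omega>. ennreal (norm (x - y) powr - (real DIM('a) + s)) \<partial>lborel) * indicator (\<Omega> \<inter> ball p (r / 2)) x
        \<le> A * (S * (ennreal \<bar>u x\<bar> * indicator \<Omega> x) + (\<Sum>j. ennreal (scale j powr - s) * (ennreal \<bar>u x\<bar> * indicator (layer (scale j)) x)))"
      proof (cases "x \<in> \<Omega> \<inter> ball p (r / 2)")
        case True
        then have "ennreal \<bar>u x\<bar> * (\<integral>\<^sup>+y\<in>-\<Omega>. ennreal (norm (x - y) powr - (real DIM('a) + s)) \<partial>lborel)
          \<le> ennreal \<bar>u x\<bar> * (A * (S + (\<Sum>j. ennreal (scale j powr - s) * indicator (layer (scale j)) x)))"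
          using exterior_kernel_le_layers[of x] unfolding A_def S_def by (intro mult_left_mono) auto
        also have "\<dots> = A * (S * ennreal \<bar>u x\<bar> + ennreal \<bar>u x\<bar> * (\<Sum>j. ennreal (scale j powr - s) * indicator (layer (scale j)) x))"
          by (simp add: distrib_left mult_ac)
        also have "ennreal \<bar>u x\<bar> * (\<Sum>j. ennreal (scale j powr - s) * indicator (layer (scale j)) x)
           = (\<Sum>j. ennreal (scale j powr - s) * (ennreal \<bar>u x\<bar> * indicator (layer (scale j)) x))"
          by (subst ennreal_suminf_cmult[symmetric]) (simp add: mult_ac)
        finally show ?thesis using True by simp
      qed simp
    qed
    also have "\<dots> = A * (S * U + (\<Sum>j. ennreal (scale j powr - s) * (\<integral>\<^sup>+x\<in>layer (scale j). ennreal \<bar>u x\<bar> \<partial>lborel)))"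
      unfolding U_def by (simp add: nn_integral_cmult nn_integral_add nn_integral_suminf)
    finally have "\<omega> * lhs \<le> \<omega> * (A * (S * U + (\<Sum>j. ennreal (scale j powr - s) * (\<integral>\<^sup>+x\<in>layer (scale j). ennreal \<bar>u x\<bar> \<partial>lborel))))"
      by (rule mult_left_mono) simp
    also have "\<dots> = A * (\<omega> * S * U + (\<Sum>j. weighted_layer u (scale j)))"
      unfolding weighted_layer_def \<omega>_def by (simp add: distrib_left mult_ac ennreal_suminf_cmult)
    also have "\<dots> \<le> A * (\<omega> * S * U + (2 * (\<omega> * (S * U)) + C * G))"
    proof -
      have "weighted_layer u (scale 0) \<le> \<omega> * (S * U)"
        unfolding weighted_layer_def \<omega>_def S_def U_def using layer_subset[OF scale_le[of 0]]
        by (intro mult_left_mono nn_integral_mono) (auto simp: indicator_def)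
      then have "2 * weighted_layer u (scale 0) + C * G \<le> 2 * (\<omega> * (S * U)) + C * G"
        by (intro add_mono mult_left_mono) auto
      with suminf_weighted_layer_le[OF u]
      have "(\<Sum>j. weighted_layer u (scale j)) \<le> 2 * (\<omega> * (S * U)) + C * G"
        unfolding C_def G_def by (rule order_trans)
      then show ?thesis by (intro mult_left_mono add_mono) auto
    qed
    also have "\<dots> = A * (3 * \<omega> * S * U + C * G)"
      using distrib_right[of 1 2 "\<omega> * (S * U)"] by (simp add: mult.assoc flip: add.assoc)
    also have "\<dots> \<le> A * ((3 * \<omega> * S + C) * (U + G))"
      by (intro mult_left_mono) (auto simp: distrib_left distrib_right add_increasing2 add_mono intro!: add_mono)
    finally have "lhs * \<omega> / \<omega> \<le> A * ((3 * \<omega> * S + C) * (U + G)) / \<omega>"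
      by (intro divide_right_mono_ennreal) (simp add: mult.commute)
    moreover have "lhs * \<omega> / \<omega> = lhs"
      using \<omega> by (intro ennreal_mult_divide_eq) auto
    moreover have "A * ((3 * \<omega> * S + C) * (U + G)) / \<omega> = D * (U + G)"
      unfolding D_def by (simp add: divide_ennreal_def mult_ac)
    ultimately show "lhs \<le> D * (U + G)" by simp
  qed
qed

end

section \<open>The fractional Hardy inequality on Lipschitz domains\<close>

text \<open>
  The left side grows like \<open>N\<^sup>s\<close>. This is the only use of \<open>s < 1\<close> in the Hardy inequality.
\<close>

lemma exists_large_count:
  fixes a s :: real
  assumes "0 < s" "s < 1" "1 \<le> a"
  shows "\<exists>N\<ge>1. (a + real N * a) powr s \<le> real N / 2"
proof -
  obtain N :: nat where N: "(2 * (2 * a) powr s) powr (1 / (1 - s)) + 1 < real N"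
    using reals_Archimedean2 by blast
  have N1: "1 < real N" using N powr_ge_zero[of "2 * (2 * a) powr s" "1 / (1 - s)"] by linarith
  have "2 * (2 * a) powr s = ((2 * (2 * a) powr s) powr (1 / (1 - s))) powr (1 - s)"
    using assms by (simp add: powr_powr)
  also have "\<dots> \<le> real N powr (1 - s)" using N assms by (intro powr_mono2) auto
  finally have *: "2 * (2 * a) powr s \<le> real N powr (1 - s)" .
  have "a + real N * a \<le> (2 * a) * real N" using N1 assms by (simp add: mult_left_le)
  then have "(a + real N * a) powr s \<le> ((2 * a) * real N) powr s"
    using assms by (intro powr_mono2) auto
  also have "\<dots> = (2 * a) powr s * real N powr s" using assms by (simp add: powr_mult)
  also have "\<dots> \<le> real N powr (1 - s) / 2 * real N powr s" using * by (intro mult_right_mono) auto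
  also have "\<dots> = real N / 2" using N1 by (simp flip: powr_add)
  finally show ?thesis using N1 by (intro exI[of _ N]) auto
qed

text \<open>
  The depth is the value of the graph at the projection along \<open>e\<close> minus the height.
\<close>

lemma lipschitz_patch_exists:
  fixes \<Omega> :: "(real ^ 'n) set"
  assumes \<Omega>: "open \<Omega>" "lipschitz_boundary \<Omega>" and p: "p \<in> frontier \<Omega>" and s: "0 < s" "s < 1"
  shows "\<exists>e r L N t. lipschitz_patch \<Omega> p e r L s N t"
proof -
  obtain r e L0 and \<gamma> :: "real ^ 'n \<Rightarrow> real" where r: "0 < r" and e: "norm e = 1"
    and \<gamma>: "L0-lipschitz_on {y. y \<bullet> e = 0} \<gamma>"
    and loc: "\<Omega> \<inter> ball p r = {x \<in> ball p r. x \<bullet> e < \<gamma> (x - (x \<bullet> e) *\<^sub>R e)}"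
    using \<Omega>(2) p unfolding lipschitz_boundary_def by blast
  define P where "P x = x - (x \<bullet> e) *\<^sub>R e" for x :: "real ^ 'n"
  define t where "t x = \<gamma> (P x) - x \<bullet> e" for x
  have ee: "e \<bullet> e = 1" using e by (simp add: dot_square_norm)
  have Pe: "P x \<bullet> e = 0" for x by (simp add: P_def inner_diff_left ee)
  have nP: "norm (P x) \<le> norm x" for x
  proof -
    have "(norm (P x))\<^sup>2 = (norm x)\<^sup>2 - (x \<bullet> e)\<^sup>2"
      unfolding power2_norm_eq_inner by (simp add: P_def inner_diff_left inner_diff_right ee inner_commute power2_eq_square)
    then have "(norm (P x))\<^sup>2 \<le> (norm x)\<^sup>2" using zero_le_power2[of "x \<bullet> e"] by linarith
    then show ?thesis by (rule power2_le_imp_le) (rule norm_ge_zero)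
  qed
  have L0: "0 \<le> L0" using \<gamma> by (rule lipschitz_on_nonneg)
  have "(L0 + 1)-lipschitz_on UNIV t"
  proof (rule lipschitz_onI)
    fix x y :: "real ^ 'n"
    have "\<bar>\<gamma> (P x) - \<gamma> (P y)\<bar> \<le> L0 * norm (P x - P y)"
      using lipschitz_onD[OF \<gamma>, of "P x" "P y"] Pe by (simp add: dist_norm)
    also have "P x - P y = P (x - y)" by (simp add: P_def inner_diff_left scaleR_diff_left)
    also have "L0 * norm (P (x - y)) \<le> L0 * norm (x - y)" using nP L0 by (intro mult_left_mono)
    finally have "\<bar>\<gamma> (P x) - \<gamma> (P y)\<bar> \<le> L0 * norm (x - y)" .
    moreover have "\<bar>x \<bullet> e - y \<bullet> e\<bar> \<le> norm (x - y)"
      using Cauchy_Schwarz_ineq2[of "x - y" e] e by (simp add: inner_diff_left)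
    ultimately show "dist (t x) (t y) \<le> (L0 + 1) * dist x y"
      unfolding t_def dist_norm by (simp add: distrib_right)
  qed (use L0 in simp)
  moreover have "t (x + c *\<^sub>R e) = t x - c" for x c
  proof -
    have "P (x + c *\<^sub>R e) = P x" by (simp add: P_def inner_add_left ee algebra_simps)
    then show ?thesis by (simp add: t_def inner_add_left ee)
  qed
  moreover have "x \<in> \<Omega> \<longleftrightarrow> 0 < t x" if "x \<in> ball p r" for x
  proof -
    have "x \<in> \<Omega> \<longleftrightarrow> x \<in> \<Omega> \<inter> ball p r" using that by simp
    also have "\<dots> \<longleftrightarrow> 0 < t x" unfolding loc t_def P_def using that by simp
    finally show ?thesis .
  qed
  moreover obtain N :: nat where N: "1 \<le> N" "(L0 + 2 + real N * (L0 + 2)) powr s \<le> real N / 2"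
    using exists_large_count[OF s, of "L0 + 2"] L0 by auto
  then have "(1 + (L0 + 1) + real N * ((L0 + 1) + 1)) powr s \<le> real N / 2"
    by (simp add: add_ac)
  ultimately have "lipschitz_patch \<Omega> p e r (L0 + 1) s N t"
    using r L0 s e \<Omega>(1) N(1) by unfold_locales auto
  then show ?thesis by blast
qed

text \<open>
  Finitely many patches cover the compact boundary. The rest of \<open>\<Omega>\<close> has positive distance to the
  exterior, so the exterior kernel is bounded there.
\<close>

lemma fractional_hardy_borel:
  fixes \<Omega> :: "(real ^ 'n) set"
  assumes \<Omega>: "bounded \<Omega>" "open \<Omega>" "lipschitz_boundary \<Omega>" and s: "0 < s" "s < 1"
  shows "\<exists>C<\<infinity>. \<forall>u\<in>borel_measurable borel.
    (\<integral>\<^sup>+x\<in>\<Omega>. ennreal \<bar>u x\<bar> * (\<integral>\<^sup>+y\<in>-\<Omega>. ennreal (norm (x - y) powr - (real CARD('n) + s)) \<partial>lborel) \<partial>lborel)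
    \<le> C * ((\<integral>\<^sup>+x\<in>\<Omega>. ennreal \<bar>u x\<bar> \<partial>lborel) + gagliardo (real CARD('n) + s) \<Omega> u)"
proof -
  define K where "K x = (\<integral>\<^sup>+y\<in>-\<Omega>. ennreal (norm (x - y) powr - (real CARD('n) + s)) \<partial>lborel)" for x :: "real ^ 'n"
  have [measurable]: "\<Omega> \<in> sets borel" using \<Omega>(2) by simp
  have [measurable]: "K \<in> borel_measurable borel" unfolding K_def by measurable
  define V where "V u = (\<integral>\<^sup>+x\<in>\<Omega>. ennreal \<bar>u x\<bar> \<partial>lborel) + gagliardo (real CARD('n) + s) \<Omega> u" for u
  have "\<forall>p\<in>frontier \<Omega>. \<exists>z. 0 < fst z \<and> snd z < \<infinity> \<and> (\<forall>u\<in>borel_measurable borel.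
     (\<integral>\<^sup>+x\<in>\<Omega> \<inter> ball p (fst z). ennreal \<bar>u x\<bar> * K x \<partial>lborel) \<le> snd z * V u)"
  proof
    fix p assume p: "p \<in> frontier \<Omega>"
    from lipschitz_patch_exists[OF \<Omega>(2,3) p s] obtain e r L N t
      where "lipschitz_patch \<Omega> p e r L s N t" by blast
    then interpret lipschitz_patch \<Omega> p e r L s N t .
    obtain C where "C < \<infinity>" "\<forall>u\<in>borel_measurable borel.
       (\<integral>\<^sup>+x\<in>\<Omega> \<inter> ball p (r / 2). ennreal \<bar>u x\<bar> * K x \<partial>lborel) \<le> C * V u"
      using hardy_patch unfolding K_def V_def by auto
    then show "\<exists>z. 0 < fst z \<and> snd z < \<infinity> \<and> (\<forall>u\<in>borel_measurable borel.
     (\<integral>\<^sup>+x\<in>\<Omega> \<inter> ball p (fst z). ennreal \<bar>u x\<bar> * K x \<partial>lborel) \<le> snd z * V u)"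
      using r by (intro exI[of _ "(r / 2, C)"]) simp
  qed
  from bchoice[OF this] obtain f where f: "\<forall>p\<in>frontier \<Omega>. 0 < fst (f p) \<and> snd (f p) < \<infinity> \<and> (\<forall>u\<in>borel_measurable borel.
     (\<integral>\<^sup>+x\<in>\<Omega> \<inter> ball p (fst (f p)). ennreal \<bar>u x\<bar> * K x \<partial>lborel) \<le> snd (f p) * V u)" by blast
  define \<rho> where "\<rho> p = fst (f p)" for p
  define C where "C p = snd (f p)" for p
  have \<rho>: "\<And>p. p \<in> frontier \<Omega> \<Longrightarrow> 0 < \<rho> p"
    and C: "\<And>p. p \<in> frontier \<Omega> \<Longrightarrow> C p < \<infinity>"
    and le: "\<And>p u. p \<in> frontier \<Omega> \<Longrightarrow> u \<in> borel_measurable borel \<Longrightarrow>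
       (\<integral>\<^sup>+x\<in>\<Omega> \<inter> ball p (\<rho> p). ennreal \<bar>u x\<bar> * K x \<partial>lborel) \<le> C p * V u"
    using f by (auto simp: \<rho>_def C_def)
  have c1: "compact (frontier \<Omega>)" using \<Omega>(1) by (rule compact_frontier_bounded)
  have c2: "frontier \<Omega> \<subseteq> (\<Union>p\<in>frontier \<Omega>. ball p (\<rho> p))" using \<rho> by force
  obtain P where P: "P \<subseteq> frontier \<Omega>" "finite P" "frontier \<Omega> \<subseteq> (\<Union>p\<in>P. ball p (\<rho> p))"
    by (rule compactE_image[OF c1 open_ball c2])
  define R where "R = \<Omega> - (\<Union>p\<in>P. ball p (\<rho> p))"
  have "R = closure \<Omega> - (\<Union>p\<in>P. ball p (\<rho> p))"
    using P(3) closure_Un_frontier[of \<Omega>] by (auto simp: R_def)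
  then have "compact R"
    using \<Omega>(1) by (auto intro!: compact_diff)
  moreover have "closed (- \<Omega>)" using \<Omega>(2) by (simp add: closed_Compl)
  moreover have "R \<inter> - \<Omega> = {}" by (auto simp: R_def)
  ultimately obtain \<delta> where \<delta>: "0 < \<delta>" "\<And>x y. x \<in> R \<Longrightarrow> y \<in> - \<Omega> \<Longrightarrow> \<delta> \<le> dist x y"
    using separate_compact_closed by metis
  define F where "F = ennreal (\<delta> powr - s) * shell_integral TYPE(real ^ 'n) (real CARD('n) + s) {1..}"
  have F: "F < \<infinity>"
    unfolding F_def using shell_integral_at_infinity[where 'a="real ^ 'n", of "real CARD('n) + s"] s
    by (simp add: ennreal_mult_less_top)
  have KF: "K x \<le> F" if x: "x \<in> R" for x
    unfolding K_def F_def using exterior_kernel_le[OF \<delta>(1), of \<Omega> x s] \<delta>(2)[OF x] by (simp add: dist_norm)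
  show ?thesis
  proof (intro exI[of _ "(\<Sum>p\<in>P. C p) + F"] conjI ballI)
    show "(\<Sum>p\<in>P. C p) + F < \<infinity>" using C P F by (auto simp: subset_iff)
    fix u :: "real ^ 'n \<Rightarrow> real" assume [measurable]: "u \<in> borel_measurable borel"
    have [measurable]: "R \<in> sets borel" unfolding R_def using P(2) by (intro sets.Diff sets.finite_UN) auto
    have "(\<integral>\<^sup>+x\<in>\<Omega>. ennreal \<bar>u x\<bar> * K x \<partial>lborel)
       \<le> (\<integral>\<^sup>+x. (\<Sum>p\<in>P. ennreal \<bar>u x\<bar> * K x * indicator (\<Omega> \<inter> ball p (\<rho> p)) x) + F * (ennreal \<bar>u x\<bar> * indicator \<Omega> x) \<partial>lborel)"
    proof (intro nn_integral_mono)
      fix x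
      consider "x \<notin> \<Omega>" | p where "x \<in> \<Omega>" "p \<in> P" "x \<in> ball p (\<rho> p)" | "x \<in> \<Omega>" "x \<in> R"
        by (auto simp: R_def)
      then show "ennreal \<bar>u x\<bar> * K x * indicator \<Omega> x
        \<le> (\<Sum>p\<in>P. ennreal \<bar>u x\<bar> * K x * indicator (\<Omega> \<inter> ball p (\<rho> p)) x) + F * (ennreal \<bar>u x\<bar> * indicator \<Omega> x)"
      proof cases
        case 2
        then have "ennreal \<bar>u x\<bar> * K x * indicator \<Omega> x = ennreal \<bar>u x\<bar> * K x * indicator (\<Omega> \<inter> ball p (\<rho> p)) x"
          by simp
        also have "\<dots> \<le> (\<Sum>p\<in>P. ennreal \<bar>u x\<bar> * K x * indicator (\<Omega> \<inter> ball p (\<rho> p)) x)"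
          using P(2) 2(2) by (intro member_le_sum) auto
        finally show ?thesis by (rule order_trans) simp
      next
        case 3
        then have "ennreal \<bar>u x\<bar> * K x * indicator \<Omega> x \<le> ennreal \<bar>u x\<bar> * F * indicator \<Omega> x"
          using KF by (intro mult_right_mono mult_left_mono) auto
        also have "\<dots> = F * (ennreal \<bar>u x\<bar> * indicator \<Omega> x)" by (simp only: mult_ac)
        finally show ?thesis by (rule order_trans) simp
      qed simp
    qed
    also have "\<dots> = (\<Sum>p\<in>P. \<integral>\<^sup>+x\<in>\<Omega> \<inter> ball p (\<rho> p). ennreal \<bar>u x\<bar> * K x \<partial>lborel) + F * (\<integral>\<^sup>+x\<in>\<Omega>. ennreal \<bar>u x\<bar> \<partial>lborel)"
      by (subst nn_integral_add, measurable, subst nn_integral_sum, measurable, subst nn_integral_cmult, measurable)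
    also have "\<dots> \<le> (\<Sum>p\<in>P. C p * V u) + F * V u"
      using P(1) le by (intro add_mono sum_mono mult_left_mono) (auto simp: V_def)
    also have "\<dots> = ((\<Sum>p\<in>P. C p) + F) * V u" by (simp add: distrib_right sum_distrib_right)
    finally show "(\<integral>\<^sup>+x\<in>\<Omega>. ennreal \<bar>u x\<bar> * (\<integral>\<^sup>+y\<in>-\<Omega>. ennreal (norm (x - y) powr - (real CARD('n) + s)) \<partial>lborel) \<partial>lborel)
       \<le> ((\<Sum>p\<in>P. C p) + F) * ((\<integral>\<^sup>+x\<in>\<Omega>. ennreal \<bar>u x\<bar> \<partial>lborel) + gagliardo (real CARD('n) + s) \<Omega> u)"
      by (simp only: K_def V_def)
  qed
qed

lemma divide_powr_eq: "a / (x::real) powr q = a * x powr - q"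
  by (simp add: powr_minus divide_inverse)

text \<open>
  For functions that are only Lebesgue measurable the result is transferred through a Borel
  representative: the translations used above act on the product of Borel sigma-algebras, not on
  the uncompleted product of the Lebesgue ones.
\<close>

theorem fractional_hardy:
  fixes \<Omega> :: "(real ^ 'n) set"
  assumes \<Omega>: "bounded \<Omega>" "open \<Omega>" "lipschitz_boundary \<Omega>" and s: "0 < s" "s < 1"
  shows "\<exists>C<\<infinity>. \<forall>u\<in>borel_measurable lebesgue.
    (\<integral>\<^sup>+x\<in>\<Omega>. (\<integral>\<^sup>+y\<in>-\<Omega>. ennreal (\<bar>u x\<bar> / norm (x - y) powr (real CARD('n) + s)) \<partial>lebesgue) \<partial>lebesgue)
    \<le> C * Ws1_norm s \<Omega> u"
proof -
  obtain C where C: "C < \<infinity>" and le: "\<And>u. u \<in> borel_measurable borel \<Longrightarrow>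
    (\<integral>\<^sup>+x\<in>\<Omega>. ennreal \<bar>u x\<bar> * (\<integral>\<^sup>+y\<in>-\<Omega>. ennreal (norm (x - y) powr - (real CARD('n) + s)) \<partial>lborel) \<partial>lborel)
    \<le> C * ((\<integral>\<^sup>+x\<in>\<Omega>. ennreal \<bar>u x\<bar> \<partial>lborel) + gagliardo (real CARD('n) + s) \<Omega> u)"
    using fractional_hardy_borel[OF \<Omega> s] by blast
  have [measurable]: "\<Omega> \<in> sets borel" using \<Omega>(2) by simp
  show ?thesis
  proof (intro exI[of _ C] conjI C ballI)
    fix u :: "real ^ 'n \<Rightarrow> real" assume "u \<in> borel_measurable lebesgue"
    then obtain v where v: "v \<in> borel_measurable lborel" and uv0: "AE x in lborel. u x = v x"
      using completion_ex_borel_measurable_real by blast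
    then have uv: "AE x in lebesgue. u x = v x" by (simp add: AE_completion)
    have [measurable]: "v \<in> borel_measurable borel" using v by simp
    have "(\<integral>\<^sup>+x\<in>\<Omega>. (\<integral>\<^sup>+y\<in>-\<Omega>. ennreal (\<bar>u x\<bar> / norm (x - y) powr (real CARD('n) + s)) \<partial>lebesgue) \<partial>lebesgue)
       = (\<integral>\<^sup>+x\<in>\<Omega>. (\<integral>\<^sup>+y\<in>-\<Omega>. ennreal (\<bar>v x\<bar> / norm (x - y) powr (real CARD('n) + s)) \<partial>lebesgue) \<partial>lebesgue)"
      by (intro nn_integral_cong_AE) (use uv in \<open>eventually_elim, simp\<close>)
    also have "\<dots> = (\<integral>\<^sup>+x\<in>\<Omega>. ennreal \<bar>v x\<bar> * (\<integral>\<^sup>+y\<in>-\<Omega>. ennreal (norm (x - y) powr - (real CARD('n) + s)) \<partial>lborel) \<partial>lborel)"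
      unfolding nn_integral_completion
      by (intro nn_integral_cong) (simp add: nn_integral_cmult[symmetric] ennreal_mult divide_powr_eq mult.assoc)
    also have "\<dots> \<le> C * ((\<integral>\<^sup>+x\<in>\<Omega>. ennreal \<bar>v x\<bar> \<partial>lborel) + gagliardo (real CARD('n) + s) \<Omega> v)"
      by (rule le) simp
    also have "(\<integral>\<^sup>+x\<in>\<Omega>. ennreal \<bar>v x\<bar> \<partial>lborel) = L1_norm \<Omega> u"
      unfolding L1_norm_def nn_integral_completion
      by (intro nn_integral_cong_AE) (use uv0 in \<open>eventually_elim, simp\<close>)
    also have "gagliardo (real CARD('n) + s) \<Omega> v = (\<integral>\<^sup>+x\<in>\<Omega>. (\<integral>\<^sup>+y\<in>\<Omega>.
        ennreal (\<bar>u x - u y\<bar> / norm (x - y) powr (real CARD('n) + s)) \<partial>lebesgue) \<partial>lebesgue)"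
      unfolding gagliardo_def nn_integral_completion
    proof (intro nn_integral_cong_AE, use uv0 in eventually_elim)
      case (elim x)
      have "(\<integral>\<^sup>+y\<in>\<Omega>. ennreal (\<bar>v x - v y\<bar> / norm (x - y) powr (real CARD('n) + s)) \<partial>lborel)
        = (\<integral>\<^sup>+y\<in>\<Omega>. ennreal (\<bar>u x - u y\<bar> / norm (x - y) powr (real CARD('n) + s)) \<partial>lborel)"
        by (intro nn_integral_cong_AE) (use uv0 elim in \<open>auto elim!: eventually_mono\<close>)
      then show ?case by simp
    qed
    finally show "(\<integral>\<^sup>+x\<in>\<Omega>. (\<integral>\<^sup>+y\<in>-\<Omega>. ennreal (\<bar>u x\<bar> / norm (x - y) powr (real CARD('n) + s)) \<partial>lebesgue) \<partial>lebesgue)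
      \<le> C * Ws1_norm s \<Omega> u"
      by (simp only: Ws1_norm_def)
  qed
qed

section \<open>Energies relative to a fixed competitor\<close>

lemma lebesgue_fst_borel [measurable]: "fst \<in> borel_measurable (lebesgue \<Otimes>\<^sub>M M)"
  by (rule measurable_compose[OF measurable_fst borel_measurable_lebesgueI]) simp

lemma lebesgue_snd_borel [measurable]: "snd \<in> borel_measurable (M \<Otimes>\<^sub>M lebesgue)"
  by (rule measurable_compose[OF measurable_snd borel_measurable_lebesgueI]) simp

lemma nn_integral_lebesgue_pair:
  assumes "f \<in> borel_measurable (lebesgue \<Otimes>\<^sub>M (lebesgue :: 'b::euclidean_space measure))"
  shows "(\<integral>\<^sup>+p. f p \<partial>(lebesgue \<Otimes>\<^sub>M lebesgue)) = (\<integral>\<^sup>+x. \<integral>\<^sup>+y. f (x, y) \<partial>lebesgue \<partial>lebesgue)"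
  using sigma_finite_measure.nn_integral_fst[OF sigma_finite_lebesgue assms] by simp

lemma AE_lebesgue_pairI:
  assumes "AE x in lebesgue. R (x :: 'a::euclidean_space)"
  shows "AE p in lebesgue \<Otimes>\<^sub>M lebesgue. R (fst p) \<and> R (snd p)"
proof -
  from assms obtain N where N: "{x. \<not> R x} \<subseteq> N" "emeasure lebesgue N = 0" "N \<in> sets lebesgue"
    by (auto elim: AE_E)
  have e1: "emeasure (lebesgue \<Otimes>\<^sub>M (lebesgue :: 'a measure)) (N \<times> UNIV) = 0"
    by (subst sigma_finite_measure.emeasure_pair_measure_Times[OF sigma_finite_lebesgue N(3)])
       (simp, simp only: N(2) mult_zero_left)
  have e2: "emeasure (lebesgue \<Otimes>\<^sub>M (lebesgue :: 'a measure)) (UNIV \<times> N) = 0"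
    by (subst sigma_finite_measure.emeasure_pair_measure_Times[OF sigma_finite_lebesgue _ N(3)])
       (simp, simp only: N(2) mult_zero_right)
  have "N \<times> UNIV \<in> null_sets (lebesgue \<Otimes>\<^sub>M (lebesgue :: 'a measure))"
    using N(3) by (intro null_setsI pair_measureI) (auto simp: e1)
  moreover have "UNIV \<times> N \<in> null_sets (lebesgue \<Otimes>\<^sub>M (lebesgue :: 'a measure))"
    using N(3) by (intro null_setsI pair_measureI) (auto simp: e2)
  ultimately have "N \<times> UNIV \<union> UNIV \<times> N \<in> null_sets (lebesgue \<Otimes>\<^sub>M (lebesgue :: 'a measure))"
    by (rule null_sets.Un)
  then show ?thesis by (rule AE_I') (use N(1) in auto)
qed

lemma GGs_measurable [measurable]: "GGs n s \<in> borel_measurable borel"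
  using DERIV_continuous_on[OF DERIV_subset[OF GGs_has_real_derivative]]
  by (intro borel_measurable_continuous_onI) blast

definition riesz :: "real \<Rightarrow> 'a::real_normed_vector \<times> 'a \<Rightarrow> real" where
  "riesz a p = norm (fst p - snd p) powr - a"

lemma riesz_measurable [measurable]:
  "riesz a \<in> borel_measurable (lebesgue \<Otimes>\<^sub>M (lebesgue :: 'a::euclidean_space measure))"
  unfolding riesz_def by measurable

lemma riesz_nonneg [simp]: "0 \<le> riesz a p"
  by (simp add: riesz_def)

lemma riesz_swap: "riesz a (prod.swap p) = riesz a p"
  by (simp add: riesz_def norm_minus_commute)

lemma riesz_pred:
  "riesz (a - 1) p = norm (fst p - snd p) * riesz a p"
proof (cases "fst p = snd p")
  case False
  then have "norm (fst p - snd p) powr - (a - 1) = norm (fst p - snd p) powr (1 + - a)" by simp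
  also have "\<dots> = norm (fst p - snd p) * norm (fst p - snd p) powr - a"
    using False by (subst powr_add) simp
  finally show ?thesis by (simp add: riesz_def)
qed (simp add: riesz_def)

lemma energy_diff_eq:
  fixes u v :: "real ^ 'n \<Rightarrow> real"
  shows "energy_diff s u v p =
    (GGs CARD('n) s ((u (fst p) - u (snd p)) / norm (fst p - snd p))
      - GGs CARD('n) s ((v (fst p) - v (snd p)) / norm (fst p - snd p))) * riesz (real CARD('n) + s - 1) p"
  by (simp add: energy_diff_def split_beta riesz_def divide_powr_eq algebra_simps)

lemma energy_diff_measurable [measurable]:
  assumes [measurable]: "u \<in> borel_measurable lebesgue" "v \<in> borel_measurable lebesgue"
  shows "energy_diff s u v \<in> borel_measurable (lebesgue \<Otimes>\<^sub>M lebesgue)"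
  unfolding energy_diff_eq[abs_def] by measurable

lemma energy_diff_swap:
  fixes u v :: "real ^ 'n \<Rightarrow> real"
  shows "energy_diff s u v (prod.swap p) = energy_diff s u v p"
proof -
  have "(u (snd p) - u (fst p)) / norm (snd p - fst p) = - ((u (fst p) - u (snd p)) / norm (fst p - snd p))" for u :: "real ^ 'n \<Rightarrow> real"
    by (simp add: norm_minus_commute minus_divide_left)
  then show ?thesis
    unfolding energy_diff_eq by (simp add: riesz_swap GGs_minus)
qed

text \<open>
  Lipschitz continuity of the density cancels one power of \<open>|x - y|\<close>.
\<close>

lemma abs_energy_diff_le:
  fixes u v :: "real ^ 'n \<Rightarrow> real"
  assumes "0 < s"
  shows "\<bar>energy_diff s u v p\<bar> \<le> 2 * \<bar>(u (fst p) - v (fst p)) - (u (snd p) - v (snd p))\<bar> * riesz (real CARD('n) + s) p"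
proof (cases "fst p = snd p")
  case False
  define r where "r = norm (fst p - snd p)"
  have r: "0 < r" using False by (simp add: r_def)
  define d where "d = (u (fst p) - v (fst p)) - (u (snd p) - v (snd p))"
  have "\<bar>energy_diff s u v p\<bar> = \<bar>GGs CARD('n) s ((u (fst p) - u (snd p)) / r) - GGs CARD('n) s ((v (fst p) - v (snd p)) / r)\<bar>
      * riesz (real CARD('n) + s - 1) p"
    by (simp add: energy_diff_eq abs_mult r_def)
  also have "\<dots> \<le> 2 * \<bar>(u (fst p) - u (snd p)) / r - (v (fst p) - v (snd p)) / r\<bar> * riesz (real CARD('n) + s - 1) p"
    using GGs_lipschitz[OF _ assms, of "CARD('n)"] by (intro mult_right_mono) auto
  also have "(u (fst p) - u (snd p)) / r - (v (fst p) - v (snd p)) / r = d / r"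
    by (simp add: d_def flip: diff_divide_distrib)
  also have "2 * \<bar>d / r\<bar> * riesz (real CARD('n) + s - 1) p = 2 * \<bar>d\<bar> * riesz (real CARD('n) + s) p"
    using r by (simp add: riesz_pred r_def[symmetric] abs_divide)
  finally show ?thesis by (simp add: d_def)
qed (simp add: energy_diff_eq riesz_def)

text \<open>
  The lower linear bound is used for \<open>u\<close> and the upper one for \<open>v\<close>; the additive constant in the lower
  bound leaves a weaker, locally integrable kernel.
\<close>

lemma energy_diff_lower:
  fixes u v :: "real ^ 'n \<Rightarrow> real"
  assumes "0 < s"
  shows "energy_diff s u v p \<ge> (Gs CARD('n) s 1 * \<bar>u (fst p) - u (snd p)\<bar> - 2 * \<bar>v (fst p) - v (snd p)\<bar>) * riesz (real CARD('n) + s) p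
     - Gs CARD('n) s 1 * riesz (real CARD('n) + s - 1) p"
proof (cases "fst p = snd p")
  case False
  define r where "r = norm (fst p - snd p)"
  have r: "0 < r" using False by (simp add: r_def)
  define a where "a = u (fst p) - u (snd p)"
  define b where "b = v (fst p) - v (snd p)"
  have 1: "GGs CARD('n) s (a / r) \<ge> Gs CARD('n) s 1 * (\<bar>a\<bar> / r - 1)"
    using GGs_lower[of "CARD('n)" s "a / r"] r by (simp add: abs_divide)
  have 2: "GGs CARD('n) s (b / r) \<le> 2 * (\<bar>b\<bar> / r)"
    using GGs_lipschitz[OF _ assms, of "CARD('n)" "b / r" 0] GGs_nonneg[of "CARD('n)" s "b / r"] r by (simp add: abs_divide)
  have "(Gs CARD('n) s 1 * (\<bar>a\<bar> / r - 1) - 2 * (\<bar>b\<bar> / r)) * riesz (real CARD('n) + s - 1) p \<le> energy_diff s u v p"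
    unfolding energy_diff_eq a_def[symmetric] b_def[symmetric] r_def[symmetric]
    using 1 2 by (intro mult_right_mono) auto
  also have "(Gs CARD('n) s 1 * (\<bar>a\<bar> / r - 1) - 2 * (\<bar>b\<bar> / r)) * riesz (real CARD('n) + s - 1) p
    = (Gs CARD('n) s 1 * \<bar>a\<bar> - 2 * \<bar>b\<bar>) * riesz (real CARD('n) + s) p
     - Gs CARD('n) s 1 * riesz (real CARD('n) + s - 1) p"
    using r by (simp add: riesz_pred r_def[symmetric] field_simps)
  finally show ?thesis by (simp add: a_def b_def)
qed (simp add: energy_diff_eq riesz_def)

text \<open>
  Submodularity of the energy holds pointwise.
\<close>

lemma energy_diff_max_min:
  fixes u v w :: "real ^ 'n \<Rightarrow> real"
  shows "energy_diff s (\<lambda>x. max (u x) (v x)) w p + energy_diff s (\<lambda>x. min (u x) (v x)) w p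
    \<le> energy_diff s u w p + energy_diff s v w p"
  unfolding energy_diff_eq
  using convex_max_min_diff[OF GGs_convex[of "CARD('n)" s], of "norm (fst p - snd p)" "u (fst p)" "v (fst p)" "u (snd p)" "v (snd p)"]
  by (simp flip: distrib_right add: mult_right_mono)

lemma Ws1_norm_cong:
  assumes "\<And>x. x \<in> \<Omega> \<Longrightarrow> u x = v x"
  shows "Ws1_norm s \<Omega> u = Ws1_norm s \<Omega> v"
  unfolding Ws1_norm_def L1_norm_def
  by (intro arg_cong2[where f="(+)"] nn_integral_cong) (auto simp: indicator_def assms intro!: nn_integral_cong)

text \<open>
  The number \<open>c\<close> is an upper bound of the obstacle and \<open>H\<close> a constant in the Hardy inequality. As \<open>\<rho>1\<close>
  exceeds all distances in \<open>\<Omega>\<close>, the annulus \<open>\<rho>1 \<le> |x - y| < \<rho>2\<close> around a point of \<open>\<Omega>\<close> lies outside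
  \<open>\<Omega>\<close>. The balance says that the gain in the annulus, where the density has slope at least \<open>slope\<close>,
  pays for the loss beyond radius \<open>\<rho>2\<close>, where only the Lipschitz constant 2 is available; both pairs
  \<open>(x, y)\<close> and \<open>(y, x)\<close> count, whence the factor 4. The exterior datum needs to be integrable
  only within distance \<open>\<rho>2\<close>.
\<close>

locale obstacle_problem =
  fixes \<Omega> A :: "(real ^ 'n) set" and s q slope c \<rho>1 \<rho>2 :: real and \<phi> \<psi> :: "real ^ 'n \<Rightarrow> real" and H :: ennreal
  assumes s: "0 < s" "s < 1" and q_def: "q = real CARD('n) + s" and slope_def: "slope = Gs CARD('n) s 1"
    and \<Omega>: "bounded \<Omega>" "open \<Omega>" and A: "A \<subseteq> \<Omega>"
    and \<phi> [measurable]: "\<phi> \<in> borel_measurable lebesgue"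
    and c: "0 \<le> c" "AE x in lebesgue. x \<in> A \<longrightarrow> \<psi> x \<le> c"
    and H: "H < \<infinity>" "\<And>u. u \<in> borel_measurable lebesgue \<Longrightarrow>
      (\<integral>\<^sup>+x\<in>\<Omega>. (\<integral>\<^sup>+y\<in>-\<Omega>. ennreal (\<bar>u x\<bar> / norm (x - y) powr q) \<partial>lebesgue) \<partial>lebesgue)
        \<le> H * Ws1_norm s \<Omega> u"
    and \<rho>: "0 < \<rho>1" "\<rho>1 < \<rho>2" "\<And>x y. x \<in> \<Omega> \<Longrightarrow> y \<in> \<Omega> \<Longrightarrow> norm (x - y) < \<rho>1"
    and balance: "4 * shell_integral TYPE(real ^ 'n) q {\<rho>2..}
      = ennreal slope * shell_integral TYPE(real ^ 'n) q {\<rho>1..<\<rho>2}"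
    and near_tail: "(\<integral>\<^sup>+x\<in>\<Omega>. (\<integral>\<^sup>+y\<in>-\<Omega>. ennreal (\<bar>\<phi> y\<bar> / norm (x - y) powr q)
      * indicator {..<\<rho>2} (norm (x - y)) \<partial>lebesgue) \<partial>lebesgue) < \<infinity>"
begin

abbreviation (input) P :: "((real ^ 'n) \<times> (real ^ 'n)) measure" where "P \<equiv> lebesgue \<Otimes>\<^sub>M lebesgue"

lemma slope_pos: "0 < slope"
  using Gs_strict_mono[of 0 1 "CARD('n)" s] by (simp add: slope_def)

lemma \<Omega>_sets [measurable]: "\<Omega> \<in> sets lebesgue" "- \<Omega> \<in> sets lebesgue"
  using \<Omega>(2) by (auto simp: Compl_in_sets_lebesgue)

lemma indicator_Times_measurable [measurable]:
  "(indicator (\<Omega> \<times> \<Omega>) :: _ \<Rightarrow> real) \<in> borel_measurable P"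
  "(indicator (\<Omega> \<times> (- \<Omega>)) :: _ \<Rightarrow> real) \<in> borel_measurable P"
  "(indicator (\<Omega> \<times> UNIV) :: _ \<Rightarrow> real) \<in> borel_measurable P"
  by (intro borel_measurable_indicator pair_measureI \<Omega>_sets; simp)+

lemma \<Omega>_finite: "emeasure lebesgue \<Omega> < \<infinity>"
  using \<Omega> emeasure_bounded_finite[of \<Omega>] by simp

definition interior_diff :: "(real ^ 'n \<Rightarrow> real) \<Rightarrow> (real ^ 'n) \<times> (real ^ 'n) \<Rightarrow> real" where
  "interior_diff v p = indicator (\<Omega> \<times> \<Omega>) p * \<bar>v (fst p) - v (snd p)\<bar> * riesz q p"

definition boundary_trace :: "(real ^ 'n \<Rightarrow> real) \<Rightarrow> (real ^ 'n) \<times> (real ^ 'n) \<Rightarrow> real" where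
  "boundary_trace v p = indicator (\<Omega> \<times> (- \<Omega>)) p * \<bar>v (fst p)\<bar> * riesz q p"

definition gap :: "(real ^ 'n) \<times> (real ^ 'n) \<Rightarrow> real" where "gap p = norm (fst p - snd p)"

lemma gap_measurable [measurable]: "gap \<in> borel_measurable P"
  unfolding gap_def by measurable

definition near_exterior :: "(real ^ 'n) \<times> (real ^ 'n) \<Rightarrow> real" where
  "near_exterior p = indicator (\<Omega> \<times> (- \<Omega>)) p * indicator {..<\<rho>2} (gap p) * \<bar>\<phi> (snd p)\<bar> * riesz q p"

definition near_weak :: "(real ^ 'n) \<times> (real ^ 'n) \<Rightarrow> real" where
  "near_weak p = indicator (\<Omega> \<times> UNIV) p * indicator {..<\<rho>2} (gap p) * riesz (q - 1) p"

lemma interior_diff_measurable [measurable]: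
  assumes [measurable]: "v \<in> borel_measurable lebesgue" shows "interior_diff v \<in> borel_measurable P"
  unfolding interior_diff_def by (intro borel_measurable_times indicator_Times_measurable; measurable)

lemma boundary_trace_measurable [measurable]:
  assumes [measurable]: "v \<in> borel_measurable lebesgue" shows "boundary_trace v \<in> borel_measurable P"
  unfolding boundary_trace_def by (intro borel_measurable_times indicator_Times_measurable; measurable)

lemma near_exterior_measurable [measurable]: "near_exterior \<in> borel_measurable P"
  unfolding near_exterior_def by (intro borel_measurable_times indicator_Times_measurable; measurable)

lemma near_weak_measurable [measurable]: "near_weak \<in> borel_measurable P"
  unfolding near_weak_def by (intro borel_measurable_times indicator_Times_measurable; measurable)

lemma Ws_measurable: "v \<in> Ws s \<Omega> \<Longrightarrow> v \<in> borel_measurable lebesgue"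
  by (simp add: Ws_def)

lemma nn_integral_interior_diff:
  assumes [measurable]: "v \<in> borel_measurable lebesgue"
  shows "(\<integral>\<^sup>+p. ennreal (interior_diff v p) \<partial>P) = (\<integral>\<^sup>+x\<in>\<Omega>. (\<integral>\<^sup>+y\<in>\<Omega>. ennreal (\<bar>v x - v y\<bar> / norm (x - y) powr q) \<partial>lebesgue) \<partial>lebesgue)"
  by (subst nn_integral_lebesgue_pair, measurable, intro nn_integral_cong)
     (auto simp: interior_diff_def indicator_def riesz_def divide_powr_eq intro!: nn_integral_cong)

lemma nn_integral_boundary_trace:
  assumes [measurable]: "v \<in> borel_measurable lebesgue"
  shows "(\<integral>\<^sup>+p. ennreal (boundary_trace v p) \<partial>P) = (\<integral>\<^sup>+x\<in>\<Omega>. (\<integral>\<^sup>+y\<in>-\<Omega>. ennreal (\<bar>v x\<bar> / norm (x - y) powr q) \<partial>lebesgue) \<partial>lebesgue)"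
  by (subst nn_integral_lebesgue_pair, measurable, intro nn_integral_cong)
     (auto simp: boundary_trace_def indicator_def riesz_def divide_powr_eq intro!: nn_integral_cong)

lemma nn_integral_near_exterior:
  "(\<integral>\<^sup>+p. ennreal (near_exterior p) \<partial>P) = (\<integral>\<^sup>+x\<in>\<Omega>. (\<integral>\<^sup>+y\<in>-\<Omega>. ennreal (\<bar>\<phi> y\<bar> / norm (x - y) powr q)
      * indicator {..<\<rho>2} (norm (x - y)) \<partial>lebesgue) \<partial>lebesgue)"
  by (subst nn_integral_lebesgue_pair, measurable, intro nn_integral_cong)
     (auto simp: near_exterior_def gap_def indicator_def riesz_def divide_powr_eq intro!: nn_integral_cong)

lemma nn_integral_near_weak:
  "(\<integral>\<^sup>+p. ennreal (near_weak p) \<partial>P) = emeasure lebesgue \<Omega> * shell_integral TYPE(real ^ 'n) (q - 1) {..<\<rho>2}"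
proof -
  have inner: "(\<integral>\<^sup>+y. ennreal (norm (x - y) powr - (q - 1)) * indicator {..<\<rho>2} (norm (x - y)) \<partial>lebesgue)
      = shell_integral TYPE(real ^ 'n) (q - 1) {..<\<rho>2}" for x :: "real ^ 'n"
    unfolding nn_integral_completion by (rule shell_integral_centre) simp
  have "(\<integral>\<^sup>+p. ennreal (near_weak p) \<partial>P) = (\<integral>\<^sup>+x\<in>\<Omega>. (\<integral>\<^sup>+y. ennreal (norm (x - y) powr - (q - 1)) * indicator {..<\<rho>2} (norm (x - y)) \<partial>lebesgue) \<partial>lebesgue)"
    by (subst nn_integral_lebesgue_pair, measurable, intro nn_integral_cong)
       (auto simp: near_weak_def gap_def indicator_def riesz_def intro!: nn_integral_cong)
  also have "\<dots> = (\<integral>\<^sup>+x. shell_integral TYPE(real ^ 'n) (q - 1) {..<\<rho>2} * indicator \<Omega> x \<partial>lebesgue)"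
    by (simp only: inner)
  also have "\<dots> = emeasure lebesgue \<Omega> * shell_integral TYPE(real ^ 'n) (q - 1) {..<\<rho>2}"
    by (subst nn_integral_cmult_indicator) (auto simp: mult.commute)
  finally show ?thesis .
qed

lemma near_weak_shell_finite: "shell_integral TYPE(real ^ 'n) (q - 1) {..<\<rho>2} < \<infinity>"
proof -
  have "shell_integral TYPE(real ^ 'n) (q - 1) {..<\<rho>2} = shell_integral TYPE(real ^ 'n) (q - 1) {0<..<\<rho>2}"
    unfolding shell_integral_def by (intro nn_integral_cong) (auto simp: indicator_def)
  also have "\<dots> = ennreal (\<rho>2 powr (real CARD('n) - (q - 1))) * shell_integral TYPE(real ^ 'n) (q - 1) {0<..<1}"
    using \<rho> by (subst shell_integral_scale[of "{0<..<1}" _ \<rho>2]) (auto simp: zero_less_mult_iff)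
  also have "\<dots> < \<infinity>"
    using shell_integral_at_zero[where 'a="real ^ 'n", of "q - 1"] s q_def by (simp add: ennreal_mult_less_top)
  finally show ?thesis .
qed

lemma Ws1_norm_eq:
  assumes "v \<in> borel_measurable lebesgue"
  shows "Ws1_norm s \<Omega> v = L1_norm \<Omega> v + (\<integral>\<^sup>+p. ennreal (interior_diff v p) \<partial>P)"
  unfolding nn_integral_interior_diff[OF assms] Ws1_norm_def by (simp only: q_def)

lemma integrable_interior_diff:
  assumes v: "v \<in> Ws s \<Omega>" shows "integrable P (interior_diff v)"
proof (rule integrableI_nonneg)
  have [measurable]: "v \<in> borel_measurable lebesgue" using v by (rule Ws_measurable)
  show "interior_diff v \<in> borel_measurable P" by measurable
  show "AE p in P. 0 \<le> interior_diff v p" by (simp add: interior_diff_def)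
  show "(\<integral>\<^sup>+p. ennreal (interior_diff v p) \<partial>P) < \<infinity>"
    using v Ws1_norm_eq[of v] by (simp add: Ws_def)
qed

lemma integrable_boundary_trace:
  assumes v: "v \<in> Ws s \<Omega>" shows "integrable P (boundary_trace v)"
proof (rule integrableI_nonneg)
  have [measurable]: "v \<in> borel_measurable lebesgue" using v by (rule Ws_measurable)
  show "boundary_trace v \<in> borel_measurable P" by measurable
  show "AE p in P. 0 \<le> boundary_trace v p" by (simp add: boundary_trace_def)
  have "(\<integral>\<^sup>+p. ennreal (boundary_trace v p) \<partial>P) \<le> H * Ws1_norm s \<Omega> v"
    by (subst nn_integral_boundary_trace) (auto intro: H)
  also have "\<dots> < \<infinity>" using v H(1) by (simp add: Ws_def ennreal_mult_less_top)
  finally show "(\<integral>\<^sup>+p. ennreal (boundary_trace v p) \<partial>P) < \<infinity>" .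
qed

lemma integrable_near_exterior: "integrable P near_exterior"
  using near_tail by (intro integrableI_nonneg) (auto simp: nn_integral_near_exterior, auto simp: near_exterior_def)

lemma integrable_near_weak: "integrable P near_weak"
  using \<Omega>_finite near_weak_shell_finite
  by (intro integrableI_nonneg) (auto simp: nn_integral_near_weak ennreal_mult_less_top, auto simp: near_weak_def)

lemma const_Ws: "(\<lambda>_. a) \<in> Ws s \<Omega>"
proof -
  have "L1_norm \<Omega> (\<lambda>_. a) = ennreal \<bar>a\<bar> * emeasure lebesgue \<Omega>"
    unfolding L1_norm_def by (rule nn_integral_cmult_indicator) simp
  then show ?thesis
    using \<Omega>_finite by (simp add: Ws_def Ws1_norm_def ennreal_mult_less_top)
qed

abbreviation adm :: "(real ^ 'n \<Rightarrow> real) set" where "adm \<equiv> Ws_obst s \<Omega> A \<phi> \<psi>"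

lemma admD:
  assumes "u \<in> adm"
  shows "u \<in> Ws s \<Omega>" "u \<in> borel_measurable lebesgue" "AE x in lebesgue. x \<notin> \<Omega> \<longrightarrow> u x = \<phi> x"
    "AE x in lebesgue. x \<in> A \<longrightarrow> u x \<ge> \<psi> x"
  using assms by (auto simp: Ws_obst_def Ws_def)

text \<open>
  Absolute energies may be infinite; this competitor serves as their origin. It is constant in \<open>\<Omega>\<close>
  and therefore causes no energy from pairs inside \<open>\<Omega>\<close>.
\<close>

definition base :: "real ^ 'n \<Rightarrow> real" where
  "base x = (if x \<in> \<Omega> then c else \<phi> x)"

lemma base_measurable [measurable]: "base \<in> borel_measurable lebesgue"
  unfolding base_def[abs_def] by measurable

lemma base_adm: "base \<in> adm"
proof -
  have "Ws1_norm s \<Omega> base = Ws1_norm s \<Omega> (\<lambda>_. c)"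
    by (rule Ws1_norm_cong) (simp add: base_def)
  then have "base \<in> Ws s \<Omega>" using const_Ws[of c] by (simp add: Ws_def)
  moreover have "AE x in lebesgue. x \<in> A \<longrightarrow> base x \<ge> \<psi> x"
    using c(2) by eventually_elim (use A in \<open>auto simp: base_def\<close>)
  ultimately show ?thesis by (auto simp: Ws_obst_def base_def)
qed

lemma Q_set_eq: "Q_set \<Omega> = \<Omega> \<times> \<Omega> \<union> \<Omega> \<times> (- \<Omega>) \<union> (- \<Omega>) \<times> \<Omega>"
  by (auto simp: Q_set_def)

lemma Q_set_sets [measurable]: "Q_set \<Omega> \<in> sets P"
  unfolding Q_set_eq by measurable

text \<open>
  Pairs inside \<open>\<Omega>\<close> are controlled by the seminorms. For mixed pairs the exterior data cancel up to
  null sets and the Hardy inequality applies.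
\<close>

lemma energy_diff_integrable:
  assumes u: "u \<in> adm" and v: "v \<in> adm"
  shows "set_integrable P (Q_set \<Omega>) (energy_diff s u v)"
proof -
  have [measurable]: "u \<in> borel_measurable lebesgue" "v \<in> borel_measurable lebesgue"
    using u v by (auto dest: admD(2))
  define g where "g p = 2 * (interior_diff u p + interior_diff v p + (boundary_trace u p + boundary_trace v p)
      + (boundary_trace u (prod.swap p) + boundary_trace v (prod.swap p)))" for p
  have swap: "integrable P (\<lambda>p. boundary_trace w (prod.swap p))" if "w \<in> adm" for w
    using lebesgue_pair.integrable_product_swap[OF integrable_boundary_trace[OF admD(1)[OF that]]]
    by (simp add: case_prod_unfold prod.swap_def)
  have g: "integrable P g"
    unfolding g_def using u v swap
    by (intro integrable_mult_right Bochner_Integration.integrable_add integrable_interior_diff integrable_boundary_trace)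
       (auto dest: admD(1))
  have bound: "AE p in P. norm (indicator (Q_set \<Omega>) p *\<^sub>R energy_diff s u v p) \<le> norm (g p)"
    using AE_lebesgue_pairI[OF admD(3)[OF u]] AE_lebesgue_pairI[OF admD(3)[OF v]]
  proof eventually_elim
    case (elim p)
    have nonneg: "0 \<le> g p"
      by (auto simp: g_def interior_diff_def boundary_trace_def intro!: add_nonneg_nonneg)
    have le: "\<bar>energy_diff s u v p\<bar> \<le> 2 * \<bar>(u (fst p) - v (fst p)) - (u (snd p) - v (snd p))\<bar> * riesz q p"
      unfolding q_def using abs_energy_diff_le s by blast
    consider "p \<in> \<Omega> \<times> \<Omega>" | "p \<in> \<Omega> \<times> (- \<Omega>)" | "p \<in> (- \<Omega>) \<times> \<Omega>" | "p \<notin> Q_set \<Omega>"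
      unfolding Q_set_eq by blast
    then have "\<bar>indicator (Q_set \<Omega>) p * energy_diff s u v p\<bar> \<le> g p"
    proof cases
      case 1
      have "\<bar>(u (fst p) - v (fst p)) - (u (snd p) - v (snd p))\<bar> \<le> \<bar>u (fst p) - u (snd p)\<bar> + \<bar>v (fst p) - v (snd p)\<bar>" by simp
      from mult_right_mono[OF this riesz_nonneg[of q p]] 1 le show ?thesis
        by (auto simp: g_def interior_diff_def boundary_trace_def Q_set_eq distrib_right)
    next
      case 2
      then have "\<bar>(u (fst p) - v (fst p)) - (u (snd p) - v (snd p))\<bar> \<le> \<bar>u (fst p)\<bar> + \<bar>v (fst p)\<bar>" using elim by auto
      from mult_right_mono[OF this riesz_nonneg[of q p]] 2 le show ?thesis
        by (auto simp: g_def interior_diff_def boundary_trace_def Q_set_eq distrib_right)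
    next
      case 3
      then have "\<bar>(u (fst p) - v (fst p)) - (u (snd p) - v (snd p))\<bar> \<le> \<bar>u (snd p)\<bar> + \<bar>v (snd p)\<bar>" using elim by auto
      from mult_right_mono[OF this riesz_nonneg[of q p]] 3 le show ?thesis
        by (auto simp: g_def interior_diff_def boundary_trace_def Q_set_eq distrib_right riesz_swap)
    next
      case 4
      then show ?thesis using nonneg by simp
    qed
    then show ?case by simp
  qed
  show ?thesis
    unfolding set_integrable_def by (rule Bochner_Integration.integrable_bound[OF g _ bound]) measurable
qed

definition J :: "(real ^ 'n \<Rightarrow> real) \<Rightarrow> real" where
  "J v = (LINT p:Q_set \<Omega>|P. energy_diff s v base p)"

lemma integral_energy_diff:
  assumes u: "u \<in> adm" and v: "v \<in> adm"
  shows "(LINT p:Q_set \<Omega>|P. energy_diff s u v p) = J u - J v"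
proof -
  have "(LINT p:Q_set \<Omega>|P. energy_diff s u v p) = (LINT p:Q_set \<Omega>|P. energy_diff s u base p - energy_diff s v base p)"
    by (simp add: energy_diff_eq algebra_simps)
  also have "\<dots> = J u - J v"
    unfolding J_def by (rule set_integral_diff(2)) (intro energy_diff_integrable u v base_adm)+
  finally show ?thesis .
qed

text \<open>
  By symmetry, the integral over all pairs that meet \<open>\<Omega>\<close> equals the one over pairs with first point in \<open>\<Omega>\<close>,
  where mixed pairs count twice.
\<close>

definition weight :: "(real ^ 'n) \<times> (real ^ 'n) \<Rightarrow> real" where
  "weight p = indicator \<Omega> (fst p) * (2 - indicator \<Omega> (snd p))"

lemma weight_measurable [measurable]: "weight \<in> borel_measurable P"
  unfolding weight_def by measurable

lemma J_weight:
  assumes v: "v \<in> adm"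
  shows "integrable P (\<lambda>p. weight p * energy_diff s v base p)"
    and "J v = (\<integral>p. weight p * energy_diff s v base p \<partial>P)"
proof -
  have [measurable]: "v \<in> borel_measurable lebesgue" using v by (rule admD(2))
  define E where "E p = indicator (Q_set \<Omega>) p * energy_diff s v base p" for p
  have E: "integrable P E"
    using energy_diff_integrable[OF v base_adm] by (simp add: set_integrable_def E_def[abs_def])
  have [measurable]: "E \<in> borel_measurable P" using E by (rule borel_measurable_integrable)
  have E_swap: "E (prod.swap p) = E p" for p
    using energy_diff_swap[of s v base p] by (cases p) (simp add: E_def Q_set_def indicator_def)
  define F where "F p = indicator \<Omega> (fst p) * E p" for p
  define G where "G p = indicator (- \<Omega>) (fst p) * E p" for p
  have F: "integrable P F" unfolding F_def
    by (rule Bochner_Integration.integrable_bound[OF E]) (measurable, auto simp: indicator_def)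
  have G: "integrable P G" unfolding G_def
    by (rule Bochner_Integration.integrable_bound[OF E]) (measurable, auto simp: indicator_def)
  have G': "integrable P (\<lambda>p. G (prod.swap p))"
    using lebesgue_pair.integrable_product_swap[OF G] by (simp add: case_prod_unfold prod.swap_def)
  have eq: "weight p * energy_diff s v base p = F p + G (prod.swap p)" for p
    unfolding F_def G_def E_swap
    by (cases p) (auto simp: E_def weight_def Q_set_def indicator_def)
  show "integrable P (\<lambda>p. weight p * energy_diff s v base p)"
    unfolding eq using F G' by simp
  have "J v = (\<integral>p. E p \<partial>P)" by (simp add: J_def set_lebesgue_integral_def E_def)
  also have "\<dots> = (\<integral>p. F p + G p \<partial>P)"
    by (intro Bochner_Integration.integral_cong) (auto simp: F_def G_def indicator_def)
  also have "\<dots> = (\<integral>p. F p \<partial>P) + (\<integral>p. G p \<partial>P)" using F G by simp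
  also have "(\<integral>p. G p \<partial>P) = (\<integral>p. G (prod.swap p) \<partial>P)"
    using lebesgue_pair.integral_product_swap[of G] borel_measurable_integrable[OF G]
    by (simp add: case_prod_unfold prod.swap_def)
  also have "(\<integral>p. F p \<partial>P) + (\<integral>p. G (prod.swap p) \<partial>P) = (\<integral>p. weight p * energy_diff s v base p \<partial>P)"
    unfolding eq using F G' by simp
  finally show "J v = (\<integral>p. weight p * energy_diff s v base p \<partial>P)" .
qed

text \<open>
  Positive beyond radius \<open>\<rho>2\<close> and negative in the annulus, with total mass 0 in the second variable.
\<close>

definition null_kernel :: "(real ^ 'n) \<times> (real ^ 'n) \<Rightarrow> real" where
  "null_kernel p = (4 * indicator {\<rho>2..} (gap p) - slope * indicator {\<rho>1..<\<rho>2} (gap p)) * riesz q p"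

definition correction :: "(real ^ 'n \<Rightarrow> real) \<Rightarrow> (real ^ 'n) \<times> (real ^ 'n) \<Rightarrow> real" where
  "correction v p = (indicator \<Omega> (fst p) * \<bar>v (fst p)\<bar>) * null_kernel p"

lemma correction_measurable [measurable]:
  assumes [measurable]: "v \<in> borel_measurable lebesgue"
  shows "correction v \<in> borel_measurable P"
  unfolding correction_def null_kernel_def by measurable

text \<open>
  Exactly the balance of the two radial integrals.
\<close>

lemma integral_null_kernel: "(\<integral>y. null_kernel (x, y) \<partial>lebesgue) = 0"
proof -
  define a where "a y = 4 * (norm (x - y) powr - q * indicator {\<rho>2..} (norm (x - y)))" for y
  define b where "b y = slope * (norm (x - y) powr - q * indicator {\<rho>1..<\<rho>2} (norm (x - y)))" for y
  have [measurable]: "a \<in> borel_measurable borel" "b \<in> borel_measurable borel"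
    unfolding a_def b_def by measurable
  have na: "(\<integral>\<^sup>+y. ennreal (a y) \<partial>lebesgue) = 4 * shell_integral TYPE(real ^ 'n) q {\<rho>2..}"
    unfolding nn_integral_completion a_def shell_integral_centre[of "{\<rho>2..}" x q, simplified, symmetric]
    by (subst nn_integral_cmult[symmetric]) (auto simp: ennreal_mult ennreal_indicator intro!: nn_integral_cong)
  have nb: "(\<integral>\<^sup>+y. ennreal (b y) \<partial>lebesgue) = ennreal slope * shell_integral TYPE(real ^ 'n) q {\<rho>1..<\<rho>2}"
    unfolding nn_integral_completion b_def shell_integral_centre[of "{\<rho>1..<\<rho>2}" x q, simplified, symmetric]
    using slope_pos by (subst nn_integral_cmult[symmetric]) (auto simp: ennreal_mult ennreal_indicator intro!: nn_integral_cong)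
  have fin: "ennreal slope * shell_integral TYPE(real ^ 'n) q {\<rho>1..<\<rho>2} < \<infinity>"
    using shell_integral_annulus_finite[where 'a="real ^ 'n", OF \<rho>(1)] by (simp add: ennreal_mult_less_top)
  have eq: "(\<integral>\<^sup>+y. ennreal (a y) \<partial>lebesgue) = (\<integral>\<^sup>+y. ennreal (b y) \<partial>lebesgue)"
    unfolding na nb using balance .
  have nonneg: "0 \<le> a y" "0 \<le> b y" for y using slope_pos by (auto simp: a_def b_def)
  have a: "integrable lebesgue a"
    using fin nonneg by (intro integrableI_nonneg) (auto simp: eq nb)
  have b: "integrable lebesgue b"
    using fin nonneg by (intro integrableI_nonneg) (auto simp: nb)
  have "(\<integral>y. null_kernel (x, y) \<partial>lebesgue) = (\<integral>y. a y - b y \<partial>lebesgue)"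
    by (intro Bochner_Integration.integral_cong) (auto simp: null_kernel_def gap_def riesz_def a_def b_def algebra_simps)
  also have "\<dots> = (\<integral>y. a y \<partial>lebesgue) - (\<integral>y. b y \<partial>lebesgue)" using a b by simp
  also have "\<dots> = 0"
    using eq nonneg by (simp add: integral_eq_nn_integral)
  finally show ?thesis .
qed

lemma integrable_correction:
  assumes v: "v \<in> Ws s \<Omega>"
  shows "integrable P (correction v)"
proof -
  have [measurable]: "v \<in> borel_measurable lebesgue" using v by (rule Ws_measurable)
  have i: "integrable P (\<lambda>p. (4 + slope) * boundary_trace v p)"
    using integrable_boundary_trace[OF v] by simp
  show ?thesis
  proof (rule Bochner_Integration.integrable_bound[OF i])
    show "AE p in P. norm (correction v p) \<le> norm ((4 + slope) * boundary_trace v p)"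
    proof (rule AE_I2)
      fix p
      define k where "k = (4 * indicator {\<rho>2..} (gap p) - slope * indicator {\<rho>1..<\<rho>2} (gap p) :: real)"
      show "norm (correction v p) \<le> norm ((4 + slope) * boundary_trace v p)"
      proof (cases "fst p \<in> \<Omega> \<and> \<rho>1 \<le> gap p")
        case True
        then have "snd p \<notin> \<Omega>" using \<rho>(3)[of "fst p" "snd p"] by (auto simp: gap_def)
        moreover have "\<bar>k\<bar> \<le> 4 + slope" using slope_pos by (auto simp: k_def indicator_def)
        then have "\<bar>k\<bar> * (\<bar>v (fst p)\<bar> * riesz q p) \<le> (4 + slope) * (\<bar>v (fst p)\<bar> * riesz q p)"
          by (intro mult_right_mono) auto
        moreover from calculation have "indicator (\<Omega> \<times> (- \<Omega>)) p = (1 :: real)" using True by (simp add: mem_Times_iff)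
        ultimately show ?thesis using True slope_pos
          by (simp add: correction_def null_kernel_def boundary_trace_def k_def[symmetric] abs_mult mult_ac)
      next
        case False
        then have "correction v p = 0" using \<rho>(2) by (auto simp: correction_def null_kernel_def indicator_def)
        then show ?thesis by simp
      qed
    qed
  qed measurable
qed

lemma integral_correction:
  assumes v: "v \<in> Ws s \<Omega>"
  shows "(\<integral>p. correction v p \<partial>P) = 0"
proof -
  have "(\<integral>p. correction v p \<partial>P) = (\<integral>x. (\<integral>y. correction v (x, y) \<partial>lebesgue) \<partial>lebesgue)"
    using lebesgue_pair.integral_fst'[OF integrable_correction[OF v]] by simp
  also have "\<dots> = 0" by (simp add: correction_def integral_null_kernel)
  finally show ?thesis .
qed

text \<open>
  The correction integrates to 0, so this integrand has the same integral. It moves the coercive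
  contribution from the annulus to the far region, where it absorbs the negative part.
\<close>

definition corrected :: "(real ^ 'n \<Rightarrow> real) \<Rightarrow> (real ^ 'n) \<times> (real ^ 'n) \<Rightarrow> real" where
  "corrected v p = weight p * energy_diff s v base p + correction v p"

lemma corrected_measurable [measurable]:
  assumes [measurable]: "v \<in> borel_measurable lebesgue"
  shows "corrected v \<in> borel_measurable P"
  unfolding corrected_def by measurable

lemma integral_corrected:
  assumes "v \<in> adm"
  shows "integrable P (corrected v)" "(\<integral>p. corrected v p \<partial>P) = J v"
  unfolding corrected_def
  using J_weight[OF assms] integrable_correction[OF admD(1)[OF assms]] integral_correction[OF admD(1)[OF assms]]
  by simp_all

text \<open>
  The negative part of the corrected integrand that depends on the data alone: a locally integrable
  kernel, the near tail of the exterior datum, and the constant \<open>c\<close> against the exterior kernel.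
\<close>

definition data_bound :: "(real ^ 'n) \<times> (real ^ 'n) \<Rightarrow> real" where
  "data_bound p = 2 * slope * near_weak p + (2 * slope + 4) * near_exterior p + 4 * c * boundary_trace (\<lambda>_. 1) p"

lemma data_bound_nonneg: "0 \<le> data_bound p"
  using slope_pos c(1) by (auto simp: data_bound_def near_weak_def near_exterior_def boundary_trace_def)

lemma integrable_data_bound: "integrable P data_bound"
  unfolding data_bound_def[abs_def]
  by (intro Bochner_Integration.integrable_add integrable_mult_right integrable_near_weak integrable_near_exterior
      integrable_boundary_trace const_Ws)

definition data_mass :: real where "data_mass = (\<integral>p. data_bound p \<partial>P)"

lemma nn_integral_data_bound: "(\<integral>\<^sup>+p. ennreal (data_bound p) \<partial>P) = ennreal data_mass"
  unfolding data_mass_def by (intro nn_integral_eq_integral integrable_data_bound AE_I2 data_bound_nonneg)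

definition coercive_part :: "(real ^ 'n \<Rightarrow> real) \<Rightarrow> (real ^ 'n) \<times> (real ^ 'n) \<Rightarrow> real" where
  "coercive_part v p = interior_diff v p + indicator \<Omega> (fst p) * indicator {\<rho>1..<\<rho>2} (gap p) * \<bar>v (fst p)\<bar> * riesz q p"

text \<open>
  The key estimate. In the annulus the density yields \<open>2 * slope\<close> times \<open>|v(x)|\<close>, of which the correction
  uses up half; beyond \<open>\<rho>2\<close> the correction compensates the loss \<open>4 |v(x)|\<close> entirely.
\<close>

lemma corrected_lower:
  assumes "AE x in lebesgue. x \<notin> \<Omega> \<longrightarrow> v x = \<phi> x"
  shows "AE p in P. slope * coercive_part v p \<le> corrected v p + data_bound p"
  using AE_lebesgue_pairI[OF assms]
proof eventually_elim
  case (elim p)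
  obtain x y where p: "p = (x, y)" by (cases p)
  define k where "k = riesz q p"
  define k0 where "k0 = riesz (q - 1) p"
  have k: "0 \<le> k" "0 \<le> k0" by (simp_all add: k_def k0_def)
  note low = energy_diff_lower[OF s(1), where u=v and v=base and p=p, folded q_def slope_def, folded k_def k0_def]
  note up = abs_energy_diff_le[OF s(1), where u=v and v=base and p=p, folded q_def slope_def, folded k_def k0_def]
  note defs = coercive_part_def corrected_def correction_def null_kernel_def data_bound_def weight_def
      interior_diff_def boundary_trace_def near_exterior_def near_weak_def k_def[symmetric] k0_def[symmetric]
  consider "x \<notin> \<Omega>" | "x \<in> \<Omega>" "y \<in> \<Omega>" | "x \<in> \<Omega>" "y \<notin> \<Omega>" "gap p < \<rho>2" | "x \<in> \<Omega>" "y \<notin> \<Omega>" "\<rho>2 \<le> gap p"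
    by linarith
  then show ?case
  proof cases
    case 1
    then show ?thesis using data_bound_nonneg[of p]
      by (simp add: coercive_part_def corrected_def correction_def weight_def interior_diff_def p)
  next
    case 2
    then have g: "gap p < \<rho>1" "gap p < \<rho>2" using \<rho>(2) \<rho>(3)[of x y] by (auto simp: gap_def p)
    have "slope * \<bar>v x - v y\<bar> * k - slope * k0 \<le> energy_diff s v base p"
      using low 2 by (simp add: p base_def)
    moreover have "0 \<le> slope * k0" using slope_pos k by simp
    ultimately show ?thesis using 2 g k by (simp add: defs, simp add: p algebra_simps)
  next
    case 3
    then have vy: "v y = \<phi> y" using elim by (simp add: p)
    have "slope * (\<bar>v x\<bar> - \<bar>\<phi> y\<bar>) - 2 * (c + \<bar>\<phi> y\<bar>) \<le> slope * \<bar>v x - \<phi> y\<bar> - 2 * \<bar>c - \<phi> y\<bar>"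
      using slope_pos c(1) by (intro diff_mono mult_left_mono) auto
    then have "(slope * (\<bar>v x\<bar> - \<bar>\<phi> y\<bar>) - 2 * (c + \<bar>\<phi> y\<bar>)) * k \<le> (slope * \<bar>v x - \<phi> y\<bar> - 2 * \<bar>c - \<phi> y\<bar>) * k"
      using k(1) by (rule mult_right_mono)
    then have e: "(slope * (\<bar>v x\<bar> - \<bar>\<phi> y\<bar>) - 2 * (c + \<bar>\<phi> y\<bar>)) * k - slope * k0 \<le> energy_diff s v base p"
      using low 3 by (simp add: p base_def vy)
    have "0 \<le> slope * (\<bar>v x\<bar> * k)" using slope_pos k by simp
    with e 3 k show ?thesis
      by (cases "\<rho>1 \<le> gap p") (simp_all add: defs, simp_all add: p algebra_simps)
  next
    case 4
    then have vy: "v y = \<phi> y" using elim by (simp add: p)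
    have "2 * \<bar>v x - c\<bar> * k \<le> 2 * (\<bar>v x\<bar> + c) * k"
      using c(1) k by (intro mult_right_mono mult_left_mono) auto
    with up 4 have "- (2 * (\<bar>v x\<bar> + c) * k) \<le> energy_diff s v base p"
      by (simp add: p base_def vy)
    with 4 k show ?thesis
      by (simp add: defs, simp add: p algebra_simps)
  qed
qed

lemma coercive_part_nonneg: "0 \<le> coercive_part v p"
  by (simp add: coercive_part_def interior_diff_def)

lemma coercive_part_measurable [measurable]:
  assumes [measurable]: "v \<in> borel_measurable lebesgue"
  shows "coercive_part v \<in> borel_measurable P"
  unfolding coercive_part_def by measurable

definition shell_mass :: ennreal where
  "shell_mass = shell_integral TYPE(real ^ 'n) q {\<rho>1..<\<rho>2}"

lemma shell_mass: "0 < shell_mass" "shell_mass < \<infinity>"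
  unfolding shell_mass_def using shell_integral_annulus_pos[OF \<rho>(1,2)] shell_integral_annulus_finite[OF \<rho>(1)] by auto

lemma nn_integral_coercive_part:
  assumes [measurable]: "v \<in> borel_measurable lebesgue"
  shows "(\<integral>\<^sup>+p. ennreal (coercive_part v p) \<partial>P)
    = (\<integral>\<^sup>+p. ennreal (interior_diff v p) \<partial>P) + shell_mass * L1_norm \<Omega> v"
proof -
  have inner: "(\<integral>\<^sup>+y. ennreal (norm (x - y) powr - q) * indicator {\<rho>1..<\<rho>2} (norm (x - y)) \<partial>lebesgue) = shell_mass" for x :: "real ^ 'n"
    unfolding nn_integral_completion shell_mass_def by (rule shell_integral_centre) simp
  have "(\<integral>\<^sup>+p. ennreal (indicator \<Omega> (fst p) * indicator {\<rho>1..<\<rho>2} (gap p) * \<bar>v (fst p)\<bar> * riesz q p) \<partial>P)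
     = (\<integral>\<^sup>+x. \<integral>\<^sup>+y. (ennreal \<bar>v x\<bar> * indicator \<Omega> x) * (ennreal (norm (x - y) powr - q) * indicator {\<rho>1..<\<rho>2} (norm (x - y))) \<partial>lebesgue \<partial>lebesgue)"
    by (subst nn_integral_lebesgue_pair, measurable, intro nn_integral_cong)
       (auto simp: gap_def riesz_def indicator_def ennreal_mult)
  also have "\<dots> = (\<integral>\<^sup>+x. (ennreal \<bar>v x\<bar> * indicator \<Omega> x) * shell_mass \<partial>lebesgue)"
    by (subst nn_integral_cmult) (measurable, simp only: inner)
  also have "\<dots> = shell_mass * L1_norm \<Omega> v"
    unfolding L1_norm_def by (subst nn_integral_multc) (auto simp: mult.commute)
  finally have 1: "(\<integral>\<^sup>+p. ennreal (indicator \<Omega> (fst p) * indicator {\<rho>1..<\<rho>2} (gap p) * \<bar>v (fst p)\<bar> * riesz q p) \<partial>P) = shell_mass * L1_norm \<Omega> v" .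
  have "(\<integral>\<^sup>+p. ennreal (coercive_part v p) \<partial>P) = (\<integral>\<^sup>+p. ennreal (interior_diff v p)
     + ennreal (indicator \<Omega> (fst p) * indicator {\<rho>1..<\<rho>2} (gap p) * \<bar>v (fst p)\<bar> * riesz q p) \<partial>P)"
    unfolding coercive_part_def by (intro nn_integral_cong ennreal_plus) (auto simp: interior_diff_def)
  also have "\<dots> = (\<integral>\<^sup>+p. ennreal (interior_diff v p) \<partial>P) + shell_mass * L1_norm \<Omega> v"
    unfolding 1[symmetric] by (rule nn_integral_add) measurable
  finally show ?thesis .
qed

text \<open>
  Finiteness of the energy of \<open>v\<close> is not assumed. This allows the estimate to be used for limits of
  admissible functions before they are known to be admissible.
\<close>

lemma Ws1_norm_le_corrected:
  assumes [measurable]: "v \<in> borel_measurable lebesgue" and ext: "AE x in lebesgue. x \<notin> \<Omega> \<longrightarrow> v x = \<phi> x"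
  shows "ennreal slope * min 1 shell_mass * Ws1_norm s \<Omega> v \<le> (\<integral>\<^sup>+p. ennreal (corrected v p + data_bound p) \<partial>P)"
proof -
  have "ennreal slope * (min 1 shell_mass * Ws1_norm s \<Omega> v) \<le> ennreal slope * (\<integral>\<^sup>+p. ennreal (coercive_part v p) \<partial>P)"
  proof (intro mult_left_mono)
    have "min 1 shell_mass * Ws1_norm s \<Omega> v
      = min 1 shell_mass * (\<integral>\<^sup>+p. ennreal (interior_diff v p) \<partial>P) + min 1 shell_mass * L1_norm \<Omega> v"
      by (simp add: Ws1_norm_eq distrib_left add.commute)
    also have "\<dots> \<le> 1 * (\<integral>\<^sup>+p. ennreal (interior_diff v p) \<partial>P) + shell_mass * L1_norm \<Omega> v"
      by (intro add_mono mult_right_mono) auto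
    finally show "min 1 shell_mass * Ws1_norm s \<Omega> v \<le> (\<integral>\<^sup>+p. ennreal (coercive_part v p) \<partial>P)"
      by (simp add: nn_integral_coercive_part)
  qed simp
  also have "\<dots> = (\<integral>\<^sup>+p. ennreal (slope * coercive_part v p) \<partial>P)"
    using slope_pos by (subst nn_integral_cmult[symmetric]) (auto simp: ennreal_mult coercive_part_nonneg)
  also have "\<dots> \<le> (\<integral>\<^sup>+p. ennreal (corrected v p + data_bound p) \<partial>P)"
    by (intro nn_integral_mono_AE) (use corrected_lower[OF ext] in \<open>auto elim!: eventually_mono intro!: ennreal_leI simp del: ennreal_plus\<close>)
  finally show ?thesis by (simp only: mult.assoc)
qed

lemma nn_integral_corrected:
  assumes v: "v \<in> adm"
  shows "(\<integral>\<^sup>+p. ennreal (corrected v p + data_bound p) \<partial>P) = ennreal (J v + data_mass)" and "0 \<le> J v + data_mass"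
proof -
  have i: "integrable P (\<lambda>p. corrected v p + data_bound p)"
    using integral_corrected[OF v] integrable_data_bound by simp
  have n: "AE p in P. 0 \<le> corrected v p + data_bound p"
    using corrected_lower[OF admD(3)[OF v]]
    by eventually_elim (use slope_pos coercive_part_nonneg in \<open>meson mult_nonneg_nonneg order_trans less_imp_le\<close>)
  have I: "(\<integral>p. corrected v p + data_bound p \<partial>P) = J v + data_mass"
    using integral_corrected[OF v] integrable_data_bound by (simp add: data_mass_def)
  show "(\<integral>\<^sup>+p. ennreal (corrected v p + data_bound p) \<partial>P) = ennreal (J v + data_mass)"
    using nn_integral_eq_integral[OF i n] I by simp
  show "0 \<le> J v + data_mass" using integral_nonneg_AE[OF n] I by simp
qed

lemma coercivity:
  assumes "v \<in> adm"
  shows "ennreal slope * min 1 shell_mass * Ws1_norm s \<Omega> v \<le> ennreal (J v + data_mass)"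
  using Ws1_norm_le_corrected[OF admD(2,3)[OF assms]] nn_integral_corrected(1)[OF assms] by simp

end

section \<open>Existence and uniqueness of minimizers\<close>

lemma liminf_ennreal_le:
  fixes a :: ennreal
  shows "(\<And>n. f n \<le> a) \<Longrightarrow> liminf f \<le> a"
  by (rule Liminf_le) auto

context obstacle_problem
begin

text \<open>
  Lower semicontinuity and closedness, by Fatou's lemma for the corrected integrand: its lower bound
  \<open>- data_bound\<close> is integrable and the same for the whole sequence.
\<close>

lemma adm_limit:
  assumes v: "\<And>l. v l \<in> adm" and w [measurable]: "w \<in> borel_measurable lebesgue"
    and lim: "AE x in lebesgue. (\<lambda>l. v l x) \<longlonglongrightarrow> w x" and le: "\<And>l. J (v l) \<le> \<beta>"
  shows "w \<in> adm" "J w \<le> \<beta>"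
proof -
  have [measurable]: "v l \<in> borel_measurable lebesgue" for l using v by (rule admD(2))
  have "AE x in lebesgue. \<forall>l. x \<notin> \<Omega> \<longrightarrow> v l x = \<phi> x"
    using admD(3)[OF v] unfolding AE_all_countable by blast
  with lim have ext: "AE x in lebesgue. x \<notin> \<Omega> \<longrightarrow> w x = \<phi> x"
    by eventually_elim (auto intro: LIMSEQ_unique)
  have "AE x in lebesgue. \<forall>l. x \<in> A \<longrightarrow> v l x \<ge> \<psi> x"
    using admD(4)[OF v] unfolding AE_all_countable by blast
  with lim have obst: "AE x in lebesgue. x \<in> A \<longrightarrow> w x \<ge> \<psi> x"
    by eventually_elim (auto intro: LIMSEQ_le_const)
  have cont: "isCont (GGs CARD('n) s) t" for t
    using GGs_has_real_derivative DERIV_isCont by blast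
  have conv: "AE p in P. (\<lambda>l. ennreal (corrected (v l) p + data_bound p)) \<longlonglongrightarrow> ennreal (corrected w p + data_bound p)"
    using AE_lebesgue_pairI[OF lim]
  proof eventually_elim
    case (elim p)
    then have 1: "(\<lambda>l. v l (fst p)) \<longlonglongrightarrow> w (fst p)" and 2: "(\<lambda>l. v l (snd p)) \<longlonglongrightarrow> w (snd p)" by auto
    have "(\<lambda>l. (v l (fst p) - v l (snd p)) * inverse (norm (fst p - snd p))) \<longlonglongrightarrow> (w (fst p) - w (snd p)) * inverse (norm (fst p - snd p))"
      by (intro tendsto_intros 1 2)
    then have "(\<lambda>l. GGs CARD('n) s ((v l (fst p) - v l (snd p)) / norm (fst p - snd p))) \<longlonglongrightarrow> GGs CARD('n) s ((w (fst p) - w (snd p)) / norm (fst p - snd p))"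
      unfolding divide_inverse by (rule isCont_tendsto_compose[OF cont])
    then have "(\<lambda>l. corrected (v l) p + data_bound p) \<longlonglongrightarrow> corrected w p + data_bound p"
      unfolding corrected_def correction_def energy_diff_eq by (intro tendsto_intros 1)
    then show ?case by (rule tendsto_ennrealI)
  qed
  have "(\<integral>\<^sup>+p. ennreal (corrected w p + data_bound p) \<partial>P)
      = (\<integral>\<^sup>+p. liminf (\<lambda>l. ennreal (corrected (v l) p + data_bound p)) \<partial>P)"
    by (intro nn_integral_cong_AE) (use conv in \<open>eventually_elim, simp add: lim_imp_Liminf\<close>)
  also have "\<dots> \<le> liminf (\<lambda>l. \<integral>\<^sup>+p. ennreal (corrected (v l) p + data_bound p) \<partial>P)"
    using borel_measurable_integrable[OF integrable_data_bound] by (intro nn_integral_liminf) measurable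
  also have "\<dots> \<le> ennreal (\<beta> + data_mass)"
    by (intro liminf_ennreal_le) (simp add: nn_integral_corrected(1)[OF v] le ennreal_leI)
  finally have I: "(\<integral>\<^sup>+p. ennreal (corrected w p + data_bound p) \<partial>P) \<le> ennreal (\<beta> + data_mass)" .
  have "ennreal slope * min 1 shell_mass * Ws1_norm s \<Omega> w < \<infinity>"
    using order.strict_trans1[OF order_trans[OF Ws1_norm_le_corrected[OF w ext] I]] by simp
  then have "Ws1_norm s \<Omega> w < \<infinity>"
    using slope_pos shell_mass by (auto simp: ennreal_mult_less_top min_def split: if_splits)
  then show w_adm: "w \<in> adm" using ext obst by (simp add: Ws_obst_def Ws_def)
  have "0 \<le> \<beta> + data_mass" using nn_integral_corrected(2)[OF v[of 0]] le[of 0] by linarith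
  then show "J w \<le> \<beta>" using I unfolding nn_integral_corrected(1)[OF w_adm] by (simp add: ennreal_le_iff)
qed

lemma Ws_dominated:
  assumes u: "u \<in> Ws s \<Omega>" and v: "v \<in> Ws s \<Omega>" and w_meas [measurable]: "w \<in> borel_measurable lebesgue"
    and w: "\<And>x. \<bar>w x\<bar> \<le> \<bar>u x\<bar> + \<bar>v x\<bar>" "\<And>x y. \<bar>w x - w y\<bar> \<le> \<bar>u x - u y\<bar> + \<bar>v x - v y\<bar>"
  shows "w \<in> Ws s \<Omega>"
proof -
  have [measurable]: "u \<in> borel_measurable lebesgue" "v \<in> borel_measurable lebesgue"
    using u v by (auto dest: Ws_measurable)
  have "L1_norm \<Omega> w \<le> (\<integral>\<^sup>+x. ennreal \<bar>u x\<bar> * indicator \<Omega> x + ennreal \<bar>v x\<bar> * indicator \<Omega> x \<partial>lebesgue)"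
    unfolding L1_norm_def using w(1)
    by (intro nn_integral_mono) (auto simp: indicator_def ennreal_plus[symmetric] simp del: ennreal_plus intro!: ennreal_leI)
  also have "\<dots> = L1_norm \<Omega> u + L1_norm \<Omega> v"
    unfolding L1_norm_def by (rule nn_integral_add) measurable
  also have "\<dots> < \<infinity>" using u v by (auto simp: Ws_def Ws1_norm_def)
  finally have 1: "L1_norm \<Omega> w < \<infinity>" .
  have "(\<integral>\<^sup>+p. ennreal (interior_diff w p) \<partial>P) \<le> (\<integral>\<^sup>+p. ennreal (interior_diff u p) + ennreal (interior_diff v p) \<partial>P)"
  proof (intro nn_integral_mono)
    fix p
    have "interior_diff w p \<le> interior_diff u p + interior_diff v p"
      using mult_right_mono[OF w(2)[of "fst p" "snd p"] riesz_nonneg[of q p]]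
      by (auto simp: interior_diff_def indicator_def distrib_right)
    then have "ennreal (interior_diff w p) \<le> ennreal (interior_diff u p + interior_diff v p)" by (rule ennreal_leI)
    also have "\<dots> = ennreal (interior_diff u p) + ennreal (interior_diff v p)"
      by (rule ennreal_plus) (auto simp: interior_diff_def)
    finally show "ennreal (interior_diff w p) \<le> ennreal (interior_diff u p) + ennreal (interior_diff v p)" .
  qed
  also have "\<dots> = (\<integral>\<^sup>+p. ennreal (interior_diff u p) \<partial>P) + (\<integral>\<^sup>+p. ennreal (interior_diff v p) \<partial>P)"
    by (rule nn_integral_add) measurable
  also have "\<dots> < \<infinity>"
    using u v by (auto simp: Ws_def Ws1_norm_eq)
  finally show ?thesis using 1 by (simp add: Ws_def Ws1_norm_eq)
qed

lemma adm_dominated: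
  assumes u: "u \<in> adm" and v: "v \<in> adm" and w_meas: "w \<in> borel_measurable lebesgue"
    and w: "\<And>x. \<bar>w x\<bar> \<le> \<bar>u x\<bar> + \<bar>v x\<bar>" "\<And>x y. \<bar>w x - w y\<bar> \<le> \<bar>u x - u y\<bar> + \<bar>v x - v y\<bar>"
    and between: "\<And>x. min (u x) (v x) \<le> w x" "\<And>x. w x \<le> max (u x) (v x)"
  shows "w \<in> adm"
proof -
  have "AE x in lebesgue. x \<notin> \<Omega> \<longrightarrow> w x = \<phi> x"
    using admD(3)[OF u] admD(3)[OF v]
  proof eventually_elim
    case (elim x)
    then show ?case using between[of x] by auto
  qed
  moreover have "AE x in lebesgue. x \<in> A \<longrightarrow> w x \<ge> \<psi> x"
    using admD(4)[OF u] admD(4)[OF v]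
  proof eventually_elim
    case (elim x)
    then show ?case using between(1)[of x] by (auto simp: min_def split: if_splits)
  qed
  ultimately show ?thesis
    using Ws_dominated[OF admD(1)[OF u] admD(1)[OF v] w_meas w] by (simp add: Ws_obst_def)
qed

text \<open>
  Submodularity: replacing two competitors by their maximum and minimum does not increase the total energy.
\<close>

lemma max_min_adm:
  assumes u: "u \<in> adm" and v: "v \<in> adm"
  shows "(\<lambda>x. max (u x) (v x)) \<in> adm" "(\<lambda>x. min (u x) (v x)) \<in> adm"
    and "J (\<lambda>x. max (u x) (v x)) + J (\<lambda>x. min (u x) (v x)) \<le> J u + J v"
proof -
  have [measurable]: "u \<in> borel_measurable lebesgue" "v \<in> borel_measurable lebesgue"
    using u v by (auto dest: admD(2))
  show mx: "(\<lambda>x. max (u x) (v x)) \<in> adm"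
    by (rule adm_dominated[OF u v]) auto
  show mn: "(\<lambda>x. min (u x) (v x)) \<in> adm"
    by (rule adm_dominated[OF u v]) auto
  have i: "set_integrable P (Q_set \<Omega>) (energy_diff s w base)" if "w \<in> adm" for w
    using that base_adm by (rule energy_diff_integrable)
  have "J (\<lambda>x. max (u x) (v x)) + J (\<lambda>x. min (u x) (v x))
     = (LINT p:Q_set \<Omega>|P. energy_diff s (\<lambda>x. max (u x) (v x)) base p + energy_diff s (\<lambda>x. min (u x) (v x)) base p)"
    unfolding J_def by (rule set_integral_add(2)[symmetric]) (intro i mx mn)+
  also have "\<dots> \<le> (LINT p:Q_set \<Omega>|P. energy_diff s u base p + energy_diff s v base p)"
    by (intro set_integral_mono set_integral_add(1) i mx mn u v energy_diff_max_min)
  also have "\<dots> = J u + J v"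
    unfolding J_def by (rule set_integral_add(2)) (intro i u v)+
  finally show "J (\<lambda>x. max (u x) (v x)) + J (\<lambda>x. min (u x) (v x)) \<le> J u + J v" .
qed

text \<open>
  Coercivity bounds the \<open>L\<^sup>1\<close>-norms on \<open>\<Omega>\<close>. By monotone convergence the supremum of
  \<open>|v\<^sub>l - v\<^sub>0|\<close> is integrable, hence finite almost everywhere.
\<close>

lemma monoseq_adm_converges:
  assumes v: "\<And>l. v l \<in> adm" and le: "\<And>l. J (v l) \<le> \<beta>"
    and mono: "AE x in lebesgue. monoseq (\<lambda>l. v l x)"
  shows "\<exists>w\<in>borel_measurable lebesgue. AE x in lebesgue. (\<lambda>l. v l x) \<longlonglongrightarrow> w x"
proof -
  have [measurable]: "v l \<in> borel_measurable lebesgue" for l using v by (rule admD(2))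
  define \<kappa> where "\<kappa> = ennreal slope * min 1 shell_mass"
  have \<kappa>: "\<kappa> \<noteq> 0" "\<kappa> < \<infinity>" using slope_pos shell_mass by (auto simp: \<kappa>_def ennreal_mult_less_top min_def)
  define K where "K = ennreal (\<beta> + data_mass) / \<kappa>"
  have L1: "L1_norm \<Omega> (v l) \<le> K" for l
  proof -
    have "Ws1_norm s \<Omega> (v l) * \<kappa> \<le> ennreal (\<beta> + data_mass)"
      using order_trans[OF coercivity[OF v[of l]] ennreal_leI, of "\<beta> + data_mass"] le[of l] by (simp add: \<kappa>_def mult.commute)
    then have "Ws1_norm s \<Omega> (v l) * \<kappa> / \<kappa> \<le> K" unfolding K_def by (rule divide_right_mono_ennreal)
    moreover have "Ws1_norm s \<Omega> (v l) * \<kappa> / \<kappa> = Ws1_norm s \<Omega> (v l)"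
      using \<kappa> by (intro ennreal_mult_divide_eq) auto
    moreover have "L1_norm \<Omega> (v l) \<le> Ws1_norm s \<Omega> (v l)" by (simp add: Ws1_norm_def)
    ultimately show ?thesis by simp
  qed
  define f where "f l x = ennreal \<bar>v l x - v 0 x\<bar> * indicator \<Omega> x" for l x
  have [measurable]: "f l \<in> borel_measurable lebesgue" for l unfolding f_def by measurable
  have inc: "\<bar>a i - a 0\<bar> \<le> \<bar>a (Suc i) - a 0\<bar>" if "monoseq a" for a :: "nat \<Rightarrow> real" and i
  proof -
    from that consider "incseq a" | "decseq a" by (auto simp: monoseq_iff)
    then show ?thesis
    proof cases
      case 1
      then show ?thesis using incseqD[of a 0 i] incseqD[of a i "Suc i"] by simp
    next
      case 2
      then show ?thesis using decseqD[of a 0 i] decseqD[of a i "Suc i"] by simp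
    qed
  qed
  have "(\<integral>\<^sup>+x. (SUP l. f l x) \<partial>lebesgue) = (SUP l. \<integral>\<^sup>+x. f l x \<partial>lebesgue)"
  proof (rule nn_integral_monotone_convergence_SUP_AE)
    show "AE x in lebesgue. f i x \<le> f (Suc i) x" for i
      using mono by eventually_elim (auto simp: f_def indicator_def intro!: ennreal_leI inc)
  qed simp
  also have "\<dots> \<le> K + K"
  proof (rule SUP_least)
    fix l
    have "(\<integral>\<^sup>+x. f l x \<partial>lebesgue) \<le> (\<integral>\<^sup>+x. ennreal \<bar>v l x\<bar> * indicator \<Omega> x + ennreal \<bar>v 0 x\<bar> * indicator \<Omega> x \<partial>lebesgue)"
      by (intro nn_integral_mono) (auto simp: f_def indicator_def ennreal_plus[symmetric] simp del: ennreal_plus intro!: ennreal_leI)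
    also have "\<dots> = L1_norm \<Omega> (v l) + L1_norm \<Omega> (v 0)"
      unfolding L1_norm_def by (rule nn_integral_add) measurable
    also have "\<dots> \<le> K + K" by (intro add_mono L1)
    finally show "(\<integral>\<^sup>+x. f l x \<partial>lebesgue) \<le> K + K" .
  qed
  also have "\<dots> < \<infinity>" using \<kappa> by (simp add: K_def less_top[symmetric] ennreal_divide_eq_top_iff)
  finally have "(\<integral>\<^sup>+x. (SUP l. f l x) \<partial>lebesgue) \<noteq> \<infinity>" by simp
  then have "AE x in lebesgue. (SUP l. f l x) \<noteq> \<infinity>"
    by (intro nn_integral_noteq_infinite) measurable
  moreover have "AE x in lebesgue. \<forall>l. x \<notin> \<Omega> \<longrightarrow> v l x = \<phi> x"
    using admD(3)[OF v] unfolding AE_all_countable by blast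
  ultimately have "AE x in lebesgue. (\<lambda>l. v l x) \<longlonglongrightarrow> lim (\<lambda>l. v l x)"
    using mono
  proof eventually_elim
    case (elim x)
    have "Bseq (\<lambda>l. v l x)"
    proof (cases "x \<in> \<Omega>")
      case True
      obtain r where r: "0 \<le> r" "(SUP l. f l x) = ennreal r"
        using elim(1) by (cases "SUP l. f l x") auto
      have "\<bar>v l x\<bar> \<le> r + \<bar>v 0 x\<bar>" for l
      proof -
        have "f l x \<le> ennreal r" unfolding r(2)[symmetric] by (rule SUP_upper) simp
        then have "\<bar>v l x - v 0 x\<bar> \<le> r" using True r(1) by (simp add: f_def)
        then show ?thesis by linarith
      qed
      then show ?thesis by (intro BseqI'[of _ "r + \<bar>v 0 x\<bar>"]) simp
    next
      case False
      then show ?thesis using elim(2) by (intro BseqI'[of _ "\<bar>\<phi> x\<bar>"]) simp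
    qed
    then have "convergent (\<lambda>l. v l x)" using elim(3) by (rule Bseq_monoseq_convergent)
    then show ?case by (simp add: convergent_LIMSEQ_iff)
  qed
  then show ?thesis by (intro bexI[of _ "\<lambda>x. lim (\<lambda>l. v l x)"]) measurable
qed

text \<open>
  Take \<open>u\<^sub>k\<close> with energy below \<open>m + 2\<^bsup>-k\<^esup>\<close>, where \<open>m\<close> is the infimum. By submodularity each further maximum
  with \<open>u\<^sub>k\<close> raises the excess over \<open>m\<close> by at most \<open>2\<^bsup>-k\<^esup>\<close>, because the discarded minimum has energy
  at least \<open>m\<close>. The running maxima from index \<open>j\<close> on increase to some \<open>w\<^sub>j\<close> of excess at most \<open>2 / 2\<^sup>j\<close>, and
  \<open>w\<^sub>j\<close> decreases to a minimizer.
\<close>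

lemma minimizer_exists: "\<exists>u\<in>adm. \<forall>v\<in>adm. J u \<le> J v"
proof -
  define m where "m = Inf (J ` adm)"
  have bdd: "bdd_below (J ` adm)"
    using nn_integral_corrected(2) by (intro bdd_belowI[of _ "- data_mass"]) force
  have m_le: "m \<le> J v" if "v \<in> adm" for v
    unfolding m_def using that bdd by (intro cInf_lower) auto
  have "\<exists>u\<in>adm. J u < m + (1/2) ^ k" for k :: nat
  proof -
    have "Inf (J ` adm) < m + (1/2) ^ k" by (simp add: m_def)
    then show ?thesis using base_adm bdd by (subst (asm) cInf_less_iff) auto
  qed
  then obtain u where u: "\<And>k. u k \<in> adm" "\<And>k. J (u k) < m + (1/2) ^ k" by metis
  define M where "M j = rec_nat (u j) (\<lambda>l w x. max (w x) (u (j + Suc l) x))" for j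
  have M_0: "M j 0 = u j" and M_Suc: "M j (Suc l) = (\<lambda>x. max (M j l x) (u (j + Suc l) x))" for j l
    by (simp_all add: M_def)
  have M: "M j l \<in> adm \<and> J (M j l) \<le> m + 2 * (1/2) ^ j - (1/2) ^ (j + l)" for j l
  proof (induction l)
    case 0
    show ?case using u[of j] by (simp add: M_0)
  next
    case (Suc l)
    have mm: "(\<lambda>x. max (M j l x) (u (j + Suc l) x)) \<in> adm" "(\<lambda>x. min (M j l x) (u (j + Suc l) x)) \<in> adm"
      "J (\<lambda>x. max (M j l x) (u (j + Suc l) x)) + J (\<lambda>x. min (M j l x) (u (j + Suc l) x)) \<le> J (M j l) + J (u (j + Suc l))"
      using Suc u(1) by (auto intro!: max_min_adm)
    have "(1/2) ^ (j + l) = 2 * (1/2 :: real) ^ (j + Suc l)" by simp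
    then have "J (M j (Suc l)) \<le> m + 2 * (1/2) ^ j - (1/2) ^ (j + Suc l)"
      using mm(3) m_le[OF mm(2)] u(2)[of "j + Suc l"] Suc unfolding M_Suc by linarith
    then show ?case using mm(1) by (simp add: M_Suc)
  qed
  have M_le: "J (M j l) \<le> m + 2 * (1/2) ^ j" for j l
  proof -
    have "0 < (1/2 :: real) ^ (j + l)" by simp
    with M[of j l] show ?thesis by linarith
  qed
  have "incseq (\<lambda>l. M j l x)" for j x by (rule incseq_SucI) (simp add: M_Suc)
  then have mono: "AE x in lebesgue. monoseq (\<lambda>l. M j l x)" for j
    by (simp add: monoseq_iff)
  have "\<exists>w\<in>borel_measurable lebesgue. AE x in lebesgue. (\<lambda>l. M j l x) \<longlonglongrightarrow> w x" for j
    using M M_le mono by (intro monoseq_adm_converges) auto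
  then obtain w where w: "\<And>j. w j \<in> borel_measurable lebesgue" "\<And>j. AE x in lebesgue. (\<lambda>l. M j l x) \<longlonglongrightarrow> w j x"
    by metis
  have w_adm: "w j \<in> adm" "J (w j) \<le> m + 2 * (1/2) ^ j" for j
    using adm_limit[OF _ w(1) w(2) M_le, of j] M by auto
  have M_shift: "M (Suc j) l x \<le> M j (Suc l) x" for j l x
  proof (induction l)
    case (Suc l)
    then show ?case by (simp add: M_Suc[of "Suc j" l] M_Suc[of j "Suc l"] max.coboundedI1)
  qed (simp add: M_0 M_Suc)
  have "AE x in lebesgue. \<forall>j. (\<lambda>l. M j l x) \<longlonglongrightarrow> w j x"
    using w(2) unfolding AE_all_countable by blast
  then have w_mono: "AE x in lebesgue. monoseq (\<lambda>j. w j x)"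
  proof eventually_elim
    case (elim x)
    have "w (Suc j) x \<le> w j x" for j
      using M_shift elim by (intro LIMSEQ_le[of "\<lambda>l. M (Suc j) l x" _ "\<lambda>l. M j (Suc l) x"] LIMSEQ_Suc) auto
    then show ?case by (auto simp: monoseq_iff intro!: decseq_SucI)
  qed
  have w_le: "J (w j) \<le> m + 2" for j
    using w_adm(2)[of j] power_le_one[of "1/2 :: real" j] by simp
  obtain z where z: "z \<in> borel_measurable lebesgue" "AE x in lebesgue. (\<lambda>j. w j x) \<longlonglongrightarrow> z x"
    using monoseq_adm_converges[OF w_adm(1) w_le w_mono] by (elim bexE)
  have tail: "z \<in> adm \<and> J z \<le> m + 2 * (1/2) ^ k" for k
  proof -
    have 1: "AE x in lebesgue. (\<lambda>j. w (j + k) x) \<longlonglongrightarrow> z x"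
      using z(2) by eventually_elim (rule LIMSEQ_ignore_initial_segment)
    have 2: "J (w (j + k)) \<le> m + 2 * (1/2) ^ k" for j
    proof -
      have "(1/2 :: real) ^ (j + k) \<le> (1/2) ^ k" by (intro power_decreasing) auto
      then show ?thesis using w_adm(2)[of "j + k"] by linarith
    qed
    show ?thesis using adm_limit[of "\<lambda>j. w (j + k)", OF w_adm(1) z(1) 1 2] by blast
  qed
  have "(\<lambda>k. m + 2 * (1/2 :: real) ^ k) \<longlonglongrightarrow> m + 2 * 0"
    by (intro tendsto_intros LIMSEQ_power_zero) simp
  then have "J z \<le> m" using tail by (intro LIMSEQ_le_const) auto
  then show ?thesis using tail m_le by (intro bexI[of _ z]) (auto intro: order_trans)
qed

lemma solves_iff_minimizer:
  "solves_obstacle s \<Omega> A \<phi> \<psi> u \<longleftrightarrow> u \<in> adm \<and> (\<forall>v\<in>adm. J u \<le> J v)"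
  unfolding solves_obstacle_def using energy_diff_integrable integral_energy_diff by auto

text \<open>
  The midpoint of two minimizers would have smaller energy unless their differences agree for almost every
  pair with one point inside and one outside \<open>\<Omega>\<close>. Outside \<open>\<Omega>\<close>, a set of positive measure, the
  minimizers themselves agree, hence also inside.
\<close>

lemma minimizer_unique:
  assumes u: "u \<in> adm" "\<And>v. v \<in> adm \<Longrightarrow> J u \<le> J v" and w: "w \<in> adm" "\<And>v. v \<in> adm \<Longrightarrow> J w \<le> J v"
  shows "AE x in lebesgue. w x = u x"
proof -
  have [measurable]: "u \<in> borel_measurable lebesgue" "w \<in> borel_measurable lebesgue"
    using u w by (auto dest: admD(2))
  define z where "z x = (u x + w x) / 2" for x
  have [measurable]: "z \<in> borel_measurable lebesgue" unfolding z_def by measurable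
  have z: "z \<in> adm"
    by (rule adm_dominated[OF u(1) w(1)]) (auto simp: z_def abs_if field_simps min_def max_def)
  define D where "D p = indicator (Q_set \<Omega>) p * (energy_diff s u z p + energy_diff s w z p)" for p
  have iu: "integrable P (\<lambda>p. indicator (Q_set \<Omega>) p * energy_diff s v z p)" if "v \<in> adm" for v
    using energy_diff_integrable[OF that z] by (simp add: set_integrable_def)
  have D: "integrable P D"
    unfolding D_def distrib_left using iu[OF u(1)] iu[OF w(1)] by simp
  have "(\<integral>p. D p \<partial>P) = (J u - J z) + (J w - J z)"
    unfolding D_def distrib_left integral_energy_diff[OF u(1) z, symmetric] integral_energy_diff[OF w(1) z, symmetric]
    using iu[OF u(1)] iu[OF w(1)] by (simp add: set_lebesgue_integral_def)
  then have D_le: "(\<integral>p. D p \<partial>P) \<le> 0" using u(2)[OF z] w(2)[OF z] by linarith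
  have mid: "(z x - z y) / r = ((u x - u y) / r + (w x - w y) / r) / 2" for x y r
    by (simp add: z_def add_divide_distrib diff_divide_distrib mult.commute)
  have D_eq: "D p = indicator (Q_set \<Omega>) p * ((GGs CARD('n) s ((u (fst p) - u (snd p)) / norm (fst p - snd p))
      + GGs CARD('n) s ((w (fst p) - w (snd p)) / norm (fst p - snd p))
      - 2 * GGs CARD('n) s ((z (fst p) - z (snd p)) / norm (fst p - snd p))) * riesz (q - 1) p)" for p
    by (simp add: D_def energy_diff_eq q_def algebra_simps)
  have D_nonneg: "0 \<le> D p" for p
    unfolding D_eq mid
    using GGs_midpoint_le[of "CARD('n)" s "(u (fst p) - u (snd p)) / norm (fst p - snd p)" "(w (fst p) - w (snd p)) / norm (fst p - snd p)"]
    by (intro mult_nonneg_nonneg) auto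
  have "(\<integral>p. D p \<partial>P) = 0" using D_le Bochner_Integration.integral_nonneg[where M=P and f=D] D_nonneg by (simp add: order_antisym)
  then have "AE p in P. D p = 0" using D D_nonneg by (subst (asm) integral_nonneg_eq_0_iff_AE) auto
  then have "AE p in P. fst p \<in> \<Omega> \<and> snd p \<notin> \<Omega> \<longrightarrow> w (fst p) - w (snd p) = u (fst p) - u (snd p)"
  proof eventually_elim
    case (elim p)
    show ?case
    proof (rule impI, rule ccontr)
      assume a: "fst p \<in> \<Omega> \<and> snd p \<notin> \<Omega>" and ne: "w (fst p) - w (snd p) \<noteq> u (fst p) - u (snd p)"
      then have r: "0 < norm (fst p - snd p)" by auto
      have "0 < riesz (q - 1) p" using r by (simp add: riesz_def)
      moreover have "GGs CARD('n) s ((z (fst p) - z (snd p)) / norm (fst p - snd p))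
        < (GGs CARD('n) s ((u (fst p) - u (snd p)) / norm (fst p - snd p)) + GGs CARD('n) s ((w (fst p) - w (snd p)) / norm (fst p - snd p))) / 2"
        unfolding mid using ne r by (intro GGs_midpoint_less) auto
      moreover have "p \<in> Q_set \<Omega>" using a by (cases p) (auto simp: Q_set_def)
      ultimately show False using elim unfolding D_eq by auto
    qed
  qed
  from lebesgue_pair.AE_pair[OF this]
  have pair: "AE x in lebesgue. AE y in lebesgue. x \<in> \<Omega> \<and> y \<notin> \<Omega> \<longrightarrow> w x - w y = u x - u y" by simp
  have ext: "AE y in lebesgue. y \<notin> \<Omega> \<longrightarrow> w y = u y"
    using admD(3)[OF u(1)] admD(3)[OF w(1)] by eventually_elim auto
  have not_null: "\<not> (AE y in lebesgue. y \<in> \<Omega>)"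
  proof
    assume "AE y in lebesgue. y \<in> \<Omega>"
    then have "emeasure lebesgue \<Omega> = emeasure lebesgue (UNIV :: (real ^ 'n) set)"
      by (intro emeasure_eq_AE) auto
    then show False using \<Omega>_finite by simp
  qed
  show ?thesis
    using pair ext
  proof eventually_elim
    case (elim x)
    show ?case
    proof (cases "x \<in> \<Omega>")
      case True
      have "AE y in lebesgue. w x \<noteq> u x \<longrightarrow> y \<in> \<Omega>"
        using elim(1) ext by eventually_elim (use True in auto)
      then show ?thesis using not_null by auto
    next
      case False
      then show ?thesis using elim(2) by simp
    qed
  qed
qed

lemma J_base: "J base = 0"
  by (simp add: J_def energy_diff_eq set_lebesgue_integral_def)

lemma ennreal_data_mass:
  "ennreal data_mass = ennreal (2 * slope) * (emeasure lebesgue \<Omega> * shell_integral TYPE(real ^ 'n) (q - 1) {..<\<rho>2})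
    + ennreal (2 * slope + 4) * (\<integral>\<^sup>+x\<in>\<Omega>. (\<integral>\<^sup>+y\<in>-\<Omega>. ennreal (\<bar>\<phi> y\<bar> / norm (x - y) powr q)
      * indicator {..<\<rho>2} (norm (x - y)) \<partial>lebesgue) \<partial>lebesgue)
    + ennreal (4 * c) * (\<integral>\<^sup>+p. ennreal (boundary_trace (\<lambda>_. 1) p) \<partial>P)"
proof -
  have nn: "0 \<le> near_weak p" "0 \<le> near_exterior p" "0 \<le> boundary_trace (\<lambda>_. 1) p" for p
    by (auto simp: near_weak_def near_exterior_def boundary_trace_def)
  have [measurable]: "boundary_trace (\<lambda>_. 1) \<in> borel_measurable P" by measurable
  have "ennreal data_mass = (\<integral>\<^sup>+p. ennreal (2 * slope) * ennreal (near_weak p) + ennreal (2 * slope + 4) * ennreal (near_exterior p)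
      + ennreal (4 * c) * ennreal (boundary_trace (\<lambda>_. 1) p) \<partial>P)"
    unfolding nn_integral_data_bound[symmetric] data_bound_def
    using slope_pos c(1) nn by (intro nn_integral_cong) (simp add: ennreal_plus ennreal_mult mult_nonneg_nonneg del: ennreal_plus[symmetric])
  also have "\<dots> = ennreal (2 * slope) * (\<integral>\<^sup>+p. ennreal (near_weak p) \<partial>P) + ennreal (2 * slope + 4) * (\<integral>\<^sup>+p. ennreal (near_exterior p) \<partial>P)
      + ennreal (4 * c) * (\<integral>\<^sup>+p. ennreal (boundary_trace (\<lambda>_. 1) p) \<partial>P)"
    by (simp add: nn_integral_add nn_integral_cmult)
  finally show ?thesis by (simp only: nn_integral_near_weak nn_integral_near_exterior)
qed

end

section \<open>The obstacle problem\<close>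

text \<open>
  The first factor on the right depends on \<open>\<Omega>\<close>, the radii and \<open>s\<close> only. It is formulated without division
  so that positivity of the constants on the left matters only once, for the final constant.
\<close>

lemma (in obstacle_problem) minimizer_estimate:
  assumes u: "u \<in> adm" and le: "J u \<le> J base"
  shows "ennreal slope * min 1 shell_mass * Ws1_norm s \<Omega> u
    \<le> (ennreal (2 * slope) * (emeasure lebesgue \<Omega> * shell_integral TYPE(real ^ 'n) (q - 1) {..<\<rho>2})
        + ennreal (2 * slope + 4) + 4 * (H * Ws1_norm s \<Omega> (\<lambda>_. 1)))
      * ((\<integral>\<^sup>+x\<in>\<Omega>. (\<integral>\<^sup>+y\<in>-\<Omega>. ennreal (\<bar>\<phi> y\<bar> / norm (x - y) powr q)
          * indicator {..<\<rho>2} (norm (x - y)) \<partial>lebesgue) \<partial>lebesgue) + ennreal c + 1)"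
    (is "_ \<le> (?a + ?b + 4 * ?h) * (?t + ennreal c + 1)")
proof -
  have "ennreal slope * min 1 shell_mass * Ws1_norm s \<Omega> u \<le> ennreal (J u + data_mass)" by (rule coercivity[OF u])
  also have "\<dots> \<le> ennreal data_mass" using le J_base by (intro ennreal_leI) simp
  also have "ennreal data_mass = ?a + ?b * ?t + ennreal (4 * c) * (\<integral>\<^sup>+p. ennreal (boundary_trace (\<lambda>_. 1) p) \<partial>P)" by (rule ennreal_data_mass)
  also have "(\<integral>\<^sup>+p. ennreal (boundary_trace (\<lambda>_. 1) p) \<partial>P) \<le> ?h"
    using H(2)[of "\<lambda>_. 1"] by (subst nn_integral_boundary_trace) auto
  also have "ennreal (4 * c) * ?h = 4 * ?h * ennreal c" using c(1) by (simp add: ennreal_mult mult_ac)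
  also have "?a + ?b * ?t + 4 * ?h * ennreal c \<le> (?a + ?b + 4 * ?h) * 1 + (?a + ?b + 4 * ?h) * ?t + (?a + ?b + 4 * ?h) * ennreal c"
  proof (intro add_mono)
    show "?a \<le> (?a + ?b + 4 * ?h) * 1" by (simp add: add.assoc)
    have "?b \<le> ?a + ?b + 4 * ?h" by (simp add: add_increasing add_increasing2)
    then show "?b * ?t \<le> (?a + ?b + 4 * ?h) * ?t" by (rule mult_right_mono) simp
    have "4 * ?h \<le> ?a + ?b + 4 * ?h" by (simp add: add_increasing)
    then show "4 * ?h * ennreal c \<le> (?a + ?b + 4 * ?h) * ennreal c" by (rule mult_right_mono) simp
  qed
  also have "\<dots> = (?a + ?b + 4 * ?h) * (?t + ennreal c + 1)" by (simp only: distrib_left add_ac)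
  finally show ?thesis by (simp add: mult_left_mono add_left_mono)
qed

lemma shell_integral_tail:
  assumes "0 < \<rho>"
  shows "shell_integral TYPE('a::euclidean_space) (real DIM('a) + s) {\<rho>..}
    = ennreal (\<rho> powr - s) * shell_integral TYPE('a) (real DIM('a) + s) {1..}"
  using assms by (subst shell_integral_scale[of "{1..}" _ \<rho>]) auto

text \<open>
  Tails scale like \<open>\<rho>\<^bsup>-s\<^esup>\<close>, so the tail beyond \<open>\<rho>2\<close> is the fraction \<open>a / (4 + a)\<close> of the one beyond \<open>\<rho>1\<close>
  and the annulus carries the fraction \<open>4 / (4 + a)\<close>.
\<close>

lemma shell_integral_balance:
  fixes s a \<rho>1 \<rho>2 :: real
  assumes s: "0 < s" and a: "0 < a" and \<rho>: "0 < \<rho>1" "\<rho>1 < \<rho>2" and ratio: "\<rho>2 powr - s = a / (4 + a) * \<rho>1 powr - s"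
  shows "4 * shell_integral TYPE('a::euclidean_space) (real DIM('a) + s) {\<rho>2..}
    = ennreal a * shell_integral TYPE('a) (real DIM('a) + s) {\<rho>1..<\<rho>2}"
proof -
  define S where "S R = shell_integral TYPE('a) (real DIM('a) + s) R" for R
  have split: "S {\<rho>1..} = S {\<rho>1..<\<rho>2} + S {\<rho>2..}"
    unfolding S_def shell_integral_def using \<rho>
    by (subst nn_integral_add[symmetric]) (measurable, auto simp: indicator_def intro!: nn_integral_cong)
  have "S {1..} < \<infinity>" unfolding S_def using s by (intro shell_integral_at_infinity) simp
  then obtain F where F: "0 \<le> F" "S {1..} = ennreal F" by (cases "S {1..}") auto
  have tail: "S {\<rho>..} = ennreal (\<rho> powr - s * F)" if "0 < \<rho>" for \<rho>
    using shell_integral_tail[OF that, where 'a='a, of s] F by (simp add: S_def ennreal_mult)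
  define f where "f = \<rho>1 powr - s * F"
  have S1: "S {\<rho>1..} = ennreal f" and S2: "S {\<rho>2..} = ennreal (a / (4 + a) * f)"
    using tail[of \<rho>1] tail[of \<rho>2] \<rho> by (simp_all add: f_def ratio mult.assoc)
  have f: "0 \<le> f" using F by (simp add: f_def)
  have "S {\<rho>1..<\<rho>2} < \<infinity>" unfolding S_def using \<rho>(1) by (rule shell_integral_annulus_finite)
  then obtain g where g: "0 \<le> g" "S {\<rho>1..<\<rho>2} = ennreal g" by (cases "S {\<rho>1..<\<rho>2}") auto
  have "ennreal (g + a / (4 + a) * f) = ennreal g + ennreal (a / (4 + a) * f)"
    using a f g(1) by (intro ennreal_plus) auto
  then have "ennreal f = ennreal (g + a / (4 + a) * f)" using split unfolding S1 S2 g(2) by (simp only:)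
  then have "f = g + a / (4 + a) * f" using a f g(1) by (subst (asm) ennreal_inj) auto
  then have "g = 4 / (4 + a) * f" using a by (simp add: field_simps)
  then have "4 * (a / (4 + a) * f) = a * g" by simp
  then have "ennreal (4 * (a / (4 + a) * f)) = ennreal (a * g)" by simp
  then have "4 * S {\<rho>2..} = ennreal a * S {\<rho>1..<\<rho>2}"
    unfolding S2 g(2) using a f g(1) by (subst (asm) (1 2) ennreal_mult) auto
  then show ?thesis by (simp add: S_def)
qed

text \<open>
  The signed distance of \<open>y\<close> to \<open>\<Omega>\<close> is at most its distance to any point of \<open>\<Omega>\<close>.
\<close>

lemma near_tail_le_Tail_L1:
  fixes \<Omega> :: "(real ^ 'n) set"
  shows "(\<integral>\<^sup>+x\<in>\<Omega>. (\<integral>\<^sup>+y\<in>-\<Omega>. ennreal (\<bar>\<phi> y\<bar> / norm (x - y) powr (real CARD('n) + s))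
      * indicator {..<\<rho>} (norm (x - y)) \<partial>lebesgue) \<partial>lebesgue) \<le> Tail_L1 s \<phi> (sdist_nbhd \<Omega> \<rho> - \<Omega>) \<Omega>"
  unfolding Tail_L1_def Tail_def
proof (intro nn_integral_mono)
  fix x :: "real ^ 'n"
  have "(\<integral>\<^sup>+y\<in>-\<Omega>. ennreal (\<bar>\<phi> y\<bar> / norm (x - y) powr (real CARD('n) + s)) * indicator {..<\<rho>} (norm (x - y)) \<partial>lebesgue)
     \<le> (\<integral>\<^sup>+y\<in>sdist_nbhd \<Omega> \<rho> - \<Omega>. ennreal (\<bar>\<phi> y\<bar> / norm (x - y) powr (real CARD('n) + s)) \<partial>lebesgue)" if x: "x \<in> \<Omega>"
  proof (intro nn_integral_mono)
    fix y
    have "y \<in> sdist_nbhd \<Omega> \<rho>" if "norm (x - y) < \<rho>"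
      using that infdist_le[OF x, of y] infdist_nonneg[of y "- \<Omega>"]
      by (simp add: sdist_nbhd_def signed_dist_def dist_norm norm_minus_commute)
    then show "ennreal (\<bar>\<phi> y\<bar> / norm (x - y) powr (real CARD('n) + s)) * indicator {..<\<rho>} (norm (x - y)) * indicator (- \<Omega>) y
      \<le> ennreal (\<bar>\<phi> y\<bar> / norm (x - y) powr (real CARD('n) + s)) * indicator (sdist_nbhd \<Omega> \<rho> - \<Omega>) y"
      by (auto simp: indicator_def)
  qed
  then show "(\<integral>\<^sup>+y\<in>-\<Omega>. ennreal (\<bar>\<phi> y\<bar> / norm (x - y) powr (real CARD('n) + s)) * indicator {..<\<rho>} (norm (x - y)) \<partial>lebesgue) * indicator \<Omega> x
     \<le> (\<integral>\<^sup>+y\<in>sdist_nbhd \<Omega> \<rho> - \<Omega>. ennreal (\<bar>\<phi> y\<bar> / norm (x - y) powr (real CARD('n) + s)) \<partial>lebesgue) * indicator \<Omega> x"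
    by (cases "x \<in> \<Omega>") auto
qed

lemma Linf_upper_bound:
  assumes "open A" "\<psi> \<in> Linf A"
  shows "AE x in lebesgue. x \<in> A \<longrightarrow> \<psi> x \<le> enn2real (Linf_norm A \<psi>)"
    and "ennreal (enn2real (Linf_norm A \<psi>)) = Linf_norm A \<psi>"
proof -
  show eq: "ennreal (enn2real (Linf_norm A \<psi>)) = Linf_norm A \<psi>" using assms(2) by (simp add: Linf_def)
  have "AE x in lebesgue_on A. ennreal \<bar>\<psi> x\<bar> \<le> Linf_norm A \<psi>"
    unfolding Linf_norm_def by (rule esssup_AE)
  then have "AE x in lebesgue. x \<in> A \<longrightarrow> ennreal \<bar>\<psi> x\<bar> \<le> Linf_norm A \<psi>"
    using assms(1) by (subst (asm) AE_restrict_space_iff) auto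
  then show "AE x in lebesgue. x \<in> A \<longrightarrow> \<psi> x \<le> enn2real (Linf_norm A \<psi>)"
  proof eventually_elim
    case (elim x)
    show ?case
    proof
      assume "x \<in> A"
      with elim have "ennreal \<bar>\<psi> x\<bar> \<le> ennreal (enn2real (Linf_norm A \<psi>))" by (simp add: eq)
      then show "\<psi> x \<le> enn2real (Linf_norm A \<psi>)" by (simp add: ennreal_le_iff)
    qed
  qed
qed

lemma diameter_pos_open:
  fixes \<Omega> :: "'a::euclidean_space set"
  assumes "bounded \<Omega>" "open \<Omega>" "\<Omega> \<noteq> {}"
  shows "0 < diameter \<Omega>"
proof -
  obtain x where x: "x \<in> \<Omega>" using assms(3) by blast
  then obtain d where d: "0 < d" "ball x d \<subseteq> \<Omega>" using assms(2) open_contains_ball by blast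
  obtain b :: 'a where b: "b \<in> Basis" using nonempty_Basis by blast
  define y where "y = x + (d / 2) *\<^sub>R b"
  have xy: "dist x y = d / 2" using b d(1) by (simp add: y_def dist_norm)
  then have "y \<in> \<Omega>" using d by (auto simp: subset_iff)
  then have "dist x y \<le> diameter \<Omega>" using assms(1) x by (intro diameter_bounded_bound)
  then show ?thesis using xy d(1) by linarith
qed

text \<open>
  The radii are \<open>\<rho>1 = 2 diam \<Omega>\<close> and \<open>\<rho>2 = \<Upsilon> diam \<Omega>\<close>; their ratio \<open>\<Upsilon> / 2\<close> is fixed by the balance, hence depends
  only on \<open>n\<close> and \<open>s\<close>.
\<close>

theorem theorem2p4:
  fixes s :: real
  assumes "0 < s" and "s < 1"
  shows "\<exists>\<Upsilon>>1. \<forall>\<Omega> :: (real ^ 'n) set.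
    bounded \<Omega> \<and> open \<Omega> \<and> lipschitz_boundary \<Omega> \<longrightarrow>
    (\<exists>C>0. \<forall>A \<psi> \<phi>.
       open A \<and> A \<subseteq> \<Omega> \<and> \<psi> \<in> Linf A \<and> \<phi> \<in> borel_measurable lebesgue \<and>
       Tail_L1 s \<phi> (sdist_nbhd \<Omega> (\<Upsilon> * diameter \<Omega>) - \<Omega>) \<Omega> < \<infinity> \<longrightarrow>
       (\<exists>u. solves_obstacle s \<Omega> A \<phi> \<psi> u \<and>
          (\<forall>w. solves_obstacle s \<Omega> A \<phi> \<psi> w \<longrightarrow> (AE x in lebesgue. w x = u x)) \<and>
          Ws1_norm s \<Omega> u \<le>
            ennreal C * (Tail_L1 s \<phi> (sdist_nbhd \<Omega> (\<Upsilon> * diameter \<Omega>) - \<Omega>) \<Omega> + Linf_norm A \<psi> + 1)))"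
proof -
  define a where "a = Gs CARD('n) s 1"
  have a: "0 < a" using Gs_strict_mono[of 0 1 "CARD('n)" s] by (simp add: a_def)
  define k where "k = a / (4 + a)"
  have k: "0 < k" "k < 1" using a by (auto simp: k_def)
  define \<Upsilon> where "\<Upsilon> = 2 * k powr (- 1 / s)"
  have "1 < k powr (- 1 / s)"
  proof -
    have "k powr 0 < k powr (- 1 / s)" using k assms(1) by (intro powr_less_mono') auto
    then show ?thesis using k by simp
  qed
  then have \<Upsilon>: "2 < \<Upsilon>" by (simp add: \<Upsilon>_def)
  have \<Upsilon>k: "(\<Upsilon> / 2) powr - s = k" using k assms(1) by (simp add: \<Upsilon>_def powr_powr)
  show ?thesis
  proof (rule exI[of _ \<Upsilon>], intro conjI allI impI)
    show "1 < \<Upsilon>" using \<Upsilon> by simp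
    fix \<Omega> :: "(real ^ 'n) set"
    assume "bounded \<Omega> \<and> open \<Omega> \<and> lipschitz_boundary \<Omega>"
    then have \<Omega>: "bounded \<Omega>" "open \<Omega>" "lipschitz_boundary \<Omega>" by auto
    obtain H where H: "H < \<infinity>" "\<And>u. u \<in> borel_measurable lebesgue \<Longrightarrow>
      (\<integral>\<^sup>+x\<in>\<Omega>. (\<integral>\<^sup>+y\<in>-\<Omega>. ennreal (\<bar>u x\<bar> / norm (x - y) powr (real CARD('n) + s)) \<partial>lebesgue) \<partial>lebesgue)
        \<le> H * Ws1_norm s \<Omega> u"
      using fractional_hardy[OF \<Omega> assms] by blast
    \<comment> \<open>For empty \<open>\<Omega>\<close> the radius only has to be positive.\<close>
    define \<rho>1 where "\<rho>1 = (if \<Omega> = {} then 1 else 2 * diameter \<Omega>)"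
    define \<rho>2 where "\<rho>2 = \<Upsilon> / 2 * \<rho>1"
    have \<rho>1: "0 < \<rho>1" using diameter_pos_open[OF \<Omega>(1,2)] by (auto simp: \<rho>1_def)
    have \<rho>2: "\<rho>1 < \<rho>2" using \<rho>1 \<Upsilon> by (simp add: \<rho>2_def)
    have diam: "norm (x - y) < \<rho>1" if "x \<in> \<Omega>" "y \<in> \<Omega>" for x y
    proof -
      have "dist x y \<le> diameter \<Omega>" using \<Omega>(1) that by (intro diameter_bounded_bound)
      moreover have "\<Omega> \<noteq> {}" using that by blast
      ultimately show ?thesis using diameter_pos_open[OF \<Omega>(1,2)] by (simp add: \<rho>1_def dist_norm)
    qed
    have "\<rho>2 powr - s = k * \<rho>1 powr - s"
      unfolding \<rho>2_def using \<rho>1 \<Upsilon> \<Upsilon>k by (subst powr_mult) auto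
    then have bal: "4 * shell_integral TYPE(real ^ 'n) (real CARD('n) + s) {\<rho>2..}
        = ennreal a * shell_integral TYPE(real ^ 'n) (real CARD('n) + s) {\<rho>1..<\<rho>2}"
      using shell_integral_balance[where 'a="real ^ 'n", OF assms(1) a \<rho>1 \<rho>2] by (simp add: k_def)
    define q where "q = real CARD('n) + s"
    define near where "near \<phi> = (\<integral>\<^sup>+x\<in>\<Omega>. (\<integral>\<^sup>+y\<in>-\<Omega>. ennreal (\<bar>\<phi> y\<bar> / norm (x - y) powr q)
      * indicator {..<\<rho>2} (norm (x - y)) \<partial>lebesgue) \<partial>lebesgue)" for \<phi>
    have near_le: "near \<phi> \<le> Tail_L1 s \<phi> (sdist_nbhd \<Omega> (\<Upsilon> * diameter \<Omega>) - \<Omega>) \<Omega>" for \<phi>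
    proof (cases "\<Omega> = {}")
      case True
      then show ?thesis by (simp add: near_def)
    next
      case False
      then have "\<rho>2 = \<Upsilon> * diameter \<Omega>" by (simp add: \<rho>2_def \<rho>1_def)
      then show ?thesis unfolding near_def q_def using near_tail_le_Tail_L1[where \<Omega>=\<Omega> and \<phi>=\<phi> and s=s and \<rho>=\<rho>2] by simp
    qed
    define \<mu> where "\<mu> = ennreal a * min 1 (shell_integral TYPE(real ^ 'n) q {\<rho>1..<\<rho>2})"
    define K where "K = ennreal (2 * a) * (emeasure lebesgue \<Omega> * shell_integral TYPE(real ^ 'n) (q - 1) {..<\<rho>2})
        + ennreal (2 * a + 4) + 4 * (H * Ws1_norm s \<Omega> (\<lambda>_. 1))"
    have op: "obstacle_problem \<Omega> A s q a c \<rho>1 \<rho>2 \<phi> \<psi> H"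
      if "open A" "A \<subseteq> \<Omega>" "\<phi> \<in> borel_measurable lebesgue" "0 \<le> c" "AE x in lebesgue. x \<in> A \<longrightarrow> \<psi> x \<le> c"
        "near \<phi> < \<infinity>" for A \<phi> \<psi> c
      using that \<Omega> H \<rho>1 \<rho>2 diam assms bal unfolding near_def
      by unfold_locales (auto simp: q_def a_def)
    have \<mu>: "\<mu> \<noteq> 0" "\<mu> < \<infinity>" and K: "K < \<infinity>"
    proof -
      \<comment> \<open>Finiteness of the constants concerns \<open>\<Omega>\<close> only, so any admissible data may be used here.\<close>
      interpret obstacle_problem \<Omega> "{}" s q a 0 \<rho>1 \<rho>2 "\<lambda>_. 0" "\<lambda>_. 0" H
        by (rule op) (auto simp: near_def)
      show "\<mu> \<noteq> 0" "\<mu> < \<infinity>"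
        using shell_mass a by (auto simp: \<mu>_def shell_mass_def ennreal_mult_less_top min_def)
      have "Ws1_norm s \<Omega> (\<lambda>_. 1) < \<infinity>" using const_Ws[of 1] by (simp add: Ws_def)
      then show "K < \<infinity>"
        using near_weak_shell_finite \<Omega>_finite H(1) by (simp add: K_def ennreal_mult_less_top)
    qed
    define C where "C = enn2real (K / \<mu>) + 1"
    have "K / \<mu> < \<infinity>" using K \<mu> by (simp add: less_top[symmetric] ennreal_divide_eq_top_iff)
    then have KC: "K / \<mu> \<le> ennreal C"
      by (cases "K / \<mu>") (auto simp: C_def intro!: ennreal_leI simp del: ennreal_plus)
    show "\<exists>C>0. \<forall>A \<psi> \<phi>.
       open A \<and> A \<subseteq> \<Omega> \<and> \<psi> \<in> Linf A \<and> \<phi> \<in> borel_measurable lebesgue \<and>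
       Tail_L1 s \<phi> (sdist_nbhd \<Omega> (\<Upsilon> * diameter \<Omega>) - \<Omega>) \<Omega> < \<infinity> \<longrightarrow>
       (\<exists>u. solves_obstacle s \<Omega> A \<phi> \<psi> u \<and>
          (\<forall>w. solves_obstacle s \<Omega> A \<phi> \<psi> w \<longrightarrow> (AE x in lebesgue. w x = u x)) \<and>
          Ws1_norm s \<Omega> u \<le>
            ennreal C * (Tail_L1 s \<phi> (sdist_nbhd \<Omega> (\<Upsilon> * diameter \<Omega>) - \<Omega>) \<Omega> + Linf_norm A \<psi> + 1))"
    proof (intro exI[of _ C] conjI allI impI)
      show "0 < C" by (simp add: C_def add_nonneg_pos)
      fix A :: "(real ^ 'n) set" and \<psi> \<phi> :: "real ^ 'n \<Rightarrow> real"
      define Tl where "Tl = Tail_L1 s \<phi> (sdist_nbhd \<Omega> (\<Upsilon> * diameter \<Omega>) - \<Omega>) \<Omega>"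
      assume *: "open A \<and> A \<subseteq> \<Omega> \<and> \<psi> \<in> Linf A \<and> \<phi> \<in> borel_measurable lebesgue \<and>
         Tail_L1 s \<phi> (sdist_nbhd \<Omega> (\<Upsilon> * diameter \<Omega>) - \<Omega>) \<Omega> < \<infinity>"
      define c where "c = enn2real (Linf_norm A \<psi>)"
      have c_eq: "ennreal c = Linf_norm A \<psi>" and c_upper: "AE x in lebesgue. x \<in> A \<longrightarrow> \<psi> x \<le> c"
        using * Linf_upper_bound[of A \<psi>] by (auto simp: c_def)
      interpret obstacle_problem \<Omega> A s q a c \<rho>1 \<rho>2 \<phi> \<psi> H
        using * c_upper near_le[of \<phi>] by (intro op) (auto simp: c_def intro: le_less_trans)
      obtain u where u: "u \<in> adm" "\<And>v. v \<in> adm \<Longrightarrow> J u \<le> J v" using minimizer_exists by blast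
      have "\<mu> * Ws1_norm s \<Omega> u \<le> K * (near \<phi> + ennreal c + 1)"
        using minimizer_estimate[OF u(1) u(2)[OF base_adm]] by (simp only: \<mu>_def shell_mass_def K_def near_def)
      also have "\<dots> \<le> K * (Tl + Linf_norm A \<psi> + 1)"
        unfolding c_eq Tl_def by (intro mult_left_mono add_mono near_le) auto
      finally have "Ws1_norm s \<Omega> u * \<mu> / \<mu> \<le> K * (Tl + Linf_norm A \<psi> + 1) / \<mu>"
        by (intro divide_right_mono_ennreal) (simp add: mult.commute)
      also have "Ws1_norm s \<Omega> u * \<mu> / \<mu> = Ws1_norm s \<Omega> u"
        using \<mu> by (intro ennreal_mult_divide_eq) auto
      also have "K * (Tl + Linf_norm A \<psi> + 1) / \<mu> = K / \<mu> * (Tl + Linf_norm A \<psi> + 1)"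
        by (simp add: divide_ennreal_def mult_ac)
      also have "\<dots> \<le> ennreal C * (Tl + Linf_norm A \<psi> + 1)" by (rule mult_right_mono[OF KC]) simp
      finally have est: "Ws1_norm s \<Omega> u \<le> ennreal C * (Tl + Linf_norm A \<psi> + 1)" .
      show "\<exists>u. solves_obstacle s \<Omega> A \<phi> \<psi> u \<and>
          (\<forall>w. solves_obstacle s \<Omega> A \<phi> \<psi> w \<longrightarrow> (AE x in lebesgue. w x = u x)) \<and>
          Ws1_norm s \<Omega> u \<le>
            ennreal C * (Tail_L1 s \<phi> (sdist_nbhd \<Omega> (\<Upsilon> * diameter \<Omega>) - \<Omega>) \<Omega> + Linf_norm A \<psi> + 1)"
        using u est minimizer_unique[OF u] unfolding solves_iff_minimizer Tl_def
        by (intro exI[of _ u]) auto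
    qed
  qed
qed

end
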